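(* Consider the asymmetric generalized exclusion process on $\mathbb T_N^d$ accelerated by $N^{1+\kappa}$, with $0<\kappa\le\alpha$, started from $\mu_{N,0}$, and let $H_N(t)$ be the relative entropy of its law $\mu_{N,t}$ with respect to the slowly varying product measure $\nu_{N,t}$ (all as defined in the context). Suppose that $H_N(0)=o(N^{d-2\alpha})$ as $N\to\infty$. (i) If $d=1$ and $\alpha\in(0,1/2)$, then for every $\kappa\in(0,\alpha]\cap(0,1-2\alpha)$ and every $t\in[0,T]$, $H_N(t)=o(N^{1-2\alpha})$ as $N\to\infty$. (ii) If $d\ge2$ and $\alpha>0$, then for every $\kappa\in(0,\alpha]\cap(0,1)$ and every $t\in[0,T]$, $H_N(t)=o(N^{d-2\alpha})$ as $N\to\infty$.
   Context: Lattice and dynamics. Let $d\ge1$, $\mathbb T^d=(\mathbb R/\mathbb Z)^d$, $\mathbb T_N^d=\mathbb Z^d/(N\mathbb Z^d)$. Fix an integer $K>0$ and let $\Omega_N^d=\{0,1,\dots,K\}^{\mathbb T_N^d}$; for $\eta\in\Omega_N^d$, $\eta_x$ is the number of particles at $x$. Let $e_1,\dots,e_d$ be the canonical basis and $e_{i+d}=-e_i$ for $1\le i\le d$. Fix rates $p_i\ge0$, $1\le i\le 2d$, with $p_i+p_{i+d}>0$ for each $1\le i\le d$, and assume that $m=(m_i)_{1\le i\le d}$, $m_i=p_i-p_{i+d}$, is a nonzero vector. The generator is $$\mathcal L_Nf(\eta)=\sum_{i=1}^{2d}\sum_{x\in\mathbb T_N^d}c_{x,i}(\eta)\,[f(\eta^{x,x+e_i})-f(\eta)],\qquad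 c_{x,i}(\eta)=p_i\,\eta_x(K-\eta_{x+e_i}),$$ where $\eta^{x,y}$ is obtained from $\eta$ by moving one particle from $x$ to $y$ (so $\eta_x$ becomes $\eta_x-1$, $\eta_y$ becomes $\eta_y+1$, other coordinates unchanged). Product measures. For $\varrho\in[0,K]$ let $\nu^1_\varrho$ be the binomial law $\nu_\varrho^1(k)=\binom Kk(\varrho/K)^k(1-\varrho/K)^{K-k}$, $k=0,\dots,K$. Perturbed profile. Fix $\varrho_*\in(0,K)$, $\rho^{\rm ini}\in C^\infty(\mathbb T^d)$, $\alpha>0$, $0<\kappa\le\alpha$, and put $\lambda=K-2\varrho_*$. Let $\rho=\rho(s,u)$ be the smooth solution of the Burgers equation $$\partial_s\rho(s,u)-m\cdot\nabla\big(\rho^2(s,u)\big)=0,\qquad \rho(0,u)=\rho^{\rm ini}(u),\quad u\in\mathbb T^d.$$ If $\kappa=\alpha$, $T>0$ is fixed such that this solution is smooth on $[0,T]$; if $\kappa<\alpha$, $T>0$ is arbitrary. For $t\in[0,T]$ and $N$ sufficiently large set $$\varrho_N(t,u)=\varrho_*+N^{-\alpha}\rho(N^{\kappa-\alpha}t,\,u-N^\kappa\lambda tm),$$ which takes values in $(0,K)$ for $N$ large. Initial law. $\mu_{N,0}$ is a probability measure on $\Omega_N^d$ associated to the profile $\varrho_*+N^{-\alpha}\rho^{\rm ini}$: for any $\varphi\in C(\mathbb T^d)$ and $\varepsilon>0$, $$\lim_{N\to\infty}\mu_{N,0}\Big\{\Big|\frac1{N^{d-\alpha}}\sum_{x\in\mathbb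 T_N^d}(\eta_x-\varrho_* )\varphi(\tfrac xN)-\int_{\mathbb T^d}\rho^{\rm ini}(u)\varphi(u)\,du\Big|>\varepsilon\Big\}=0.$$ Relative entropy. Let $\eta(t)$ be the Markov process with generator $N^{1+\kappa}\mathcal L_N$ and initial law $\mu_{N,0}$, and let $\mu_{N,t}$ be the law of $\eta(t)$. Let $\nu_{N,t}(d\eta)=\bigotimes_{x\in\mathbb T_N^d}\nu^1_{\varrho_N(t,x/N)}(d\eta_x)$, $f_{N,t}=\mu_{N,t}/\nu_{N,t}$, and $H_N(t)=\sum_{\eta\in\Omega_N^d}f_{N,t}(\eta)\log f_{N,t}(\eta)\,\nu_{N,t}(\eta)$. *)

theory Defs
  imports
    "HOL-Probability.Probability"
    "HOL-Library.Landau_Symbols"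
begin

text \<open>
  The dimension is d = CARD('d). The discrete torus is represented by the representatives of
  the classes modulo N with all coordinates in {0..<N}, so that sums of sites are reduced
  modulo N. A direction is an element of the sum type 'd + 'd, where Inl i stands for the
  vector e_i and Inr i for its negative, so p (Inr i) is the rate written p_{i+d} in the
  usual enumeration of the 2d directions. Functions on the continuous torus are functions on
  real^'d that have period 1 in each coordinate.
\<close>

type_synonym 'd site = "int ^ 'd"
type_synonym 'd config = "int ^ 'd \<Rightarrow> nat"

definition torus :: "nat \<Rightarrow> 'd::finite site set" where
  "torus N = {x. \<forall>i. x $ i \<in> {0..<int N}}"

fun dir :: "'d::finite + 'd \<Rightarrow> 'd site" where
  "dir (Inl i) = axis i 1"
| "dir (Inr i) = - axis i 1"

definition torus_add :: "nat \<Rightarrow> 'd::finite site \<Rightarrow> 'd site \<Rightarrow> 'd site" where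
  "torus_add N x y = (\<chi> i. (x $ i + y $ i) mod int N)"

definition embed_site :: "nat \<Rightarrow> 'd::finite site \<Rightarrow> real ^ 'd" where
  "embed_site N x = (\<chi> i. real_of_int (x $ i) / real N)"

text \<open>
  A configuration is a function on the torus, extended by 0 to all of int^'d; this is the
  convention of PiE_dflt and Pi_pmf with default value 0.
\<close>

definition Config :: "nat \<Rightarrow> nat \<Rightarrow> 'd::finite config set" where
  "Config K N = PiE_dflt (torus N) 0 (\<lambda>_. {0..K})"

text \<open>
  The two updates are made one after the other, so nothing moves if x = y. The truncated
  subtraction only matters when no particle is present at x, and then the jump rate is 0.
\<close>

definition move :: "'d::finite config \<Rightarrow> 'd site \<Rightarrow> 'd site \<Rightarrow> 'd config" where
  "move \<eta> x y = (let \<eta>' = \<eta>(x := \<eta> x - 1) in \<eta>'(y := \<eta>' y + 1))"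

definition rate :: "nat \<Rightarrow> ('d::finite + 'd \<Rightarrow> real) \<Rightarrow> nat \<Rightarrow> 'd site \<Rightarrow> 'd + 'd \<Rightarrow> 'd config \<Rightarrow> real" where
  "rate K p N x i \<eta> = p i * real (\<eta> x) * (real K - real (\<eta> (torus_add N x (dir i))))"

definition generator ::
  "nat \<Rightarrow> ('d::finite + 'd \<Rightarrow> real) \<Rightarrow> nat \<Rightarrow> ('d config \<Rightarrow> real) \<Rightarrow> 'd config \<Rightarrow> real" where
  "generator K p N f \<eta> =
     (\<Sum>i\<in>UNIV. \<Sum>x\<in>torus N. rate K p N x i \<eta> * (f (move \<eta> x (torus_add N x (dir i))) - f \<eta>))"

definition drift :: "('d::finite + 'd \<Rightarrow> real) \<Rightarrow> real ^ 'd" where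
  "drift p = (\<chi> i. p (Inl i) - p (Inr i))"

text \<open>
  The semigroup exp (t L) of a generator L. The state space S of the Markov processes below
  is finite and L f is determined on S by the values of f on S, so L is a bounded operator
  on functions on S and the exponential series converges at every state in S.
\<close>

definition exp_semigroup :: "(('s \<Rightarrow> real) \<Rightarrow> 's \<Rightarrow> real) \<Rightarrow> real \<Rightarrow> ('s \<Rightarrow> real) \<Rightarrow> 's \<Rightarrow> real" where
  "exp_semigroup L t f \<eta> = (\<Sum>n. t ^ n / fact n * (L ^^ n) f \<eta>)"

definition natural_filtration :: "'w measure \<Rightarrow> (real \<Rightarrow> 'w \<Rightarrow> 's) \<Rightarrow> real \<Rightarrow> 'w measure" where
  "natural_filtration M X s = sigma (space M) {X r -` A \<inter> space M |r A. 0 \<le> r \<and> r \<le> s}"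

definition markov_process ::
  "'w measure \<Rightarrow> (real \<Rightarrow> 'w \<Rightarrow> 's) \<Rightarrow> 's set \<Rightarrow> (('s \<Rightarrow> real) \<Rightarrow> 's \<Rightarrow> real) \<Rightarrow> bool" where
  "markov_process M X S L \<longleftrightarrow>
     prob_space M \<and>
     (\<forall>t\<ge>0. X t \<in> measurable M (count_space S)) \<and>
     (\<forall>f s t. 0 \<le> s \<and> s \<le> t \<longrightarrow>
        (AE \<omega> in M. real_cond_exp M (natural_filtration M X s) (\<lambda>\<omega>'. f (X t \<omega>')) \<omega> =
                    exp_semigroup L (t - s) f (X s \<omega>)))"

text \<open>The mass function of the law of X t.\<close>

definition law :: "'w measure \<Rightarrow> (real \<Rightarrow> 'w \<Rightarrow> 's) \<Rightarrow> real \<Rightarrow> 's \<Rightarrow> real" where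
  "law M X t \<eta> = measure M {\<omega> \<in> space M. X t \<omega> = \<eta>}"

text \<open>
  Continuous differentiability of order k, in all variables jointly. On a set with boundary
  such as {0..T} \<times> UNIV the derivatives are taken within the set, where they are unique.
\<close>

fun Ck_on :: "nat \<Rightarrow> 'a::euclidean_space set \<Rightarrow> ('a \<Rightarrow> real) \<Rightarrow> bool" where
  "Ck_on 0 S f \<longleftrightarrow> continuous_on S f"
| "Ck_on (Suc k) S f \<longleftrightarrow>
     f differentiable_on S \<and>
     (\<forall>b\<in>Basis. Ck_on k S (\<lambda>x. frechet_derivative f (at x within S) b))"

definition smooth_on :: "'a::euclidean_space set \<Rightarrow> ('a \<Rightarrow> real) \<Rightarrow> bool" where
  "smooth_on S f \<longleftrightarrow> (\<forall>k. Ck_on k S f)"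

definition periodic :: "(real ^ 'd::finite \<Rightarrow> real) \<Rightarrow> bool" where
  "periodic f \<longleftrightarrow> (\<forall>u i. f (u + axis i 1) = f u)"

definition burgers_solution ::
  "real ^ 'd::finite \<Rightarrow> (real ^ 'd \<Rightarrow> real) \<Rightarrow> real \<Rightarrow> (real \<Rightarrow> real ^ 'd \<Rightarrow> real) \<Rightarrow> bool" where
  "burgers_solution m \<rho>ini \<tau> \<rho> \<longleftrightarrow>
     smooth_on ({0..\<tau>} \<times> UNIV) (\<lambda>(s, u). \<rho> s u) \<and>
     (\<forall>s\<in>{0..\<tau>}. periodic (\<rho> s)) \<and>
     (\<forall>s\<in>{0..\<tau>}. \<forall>u. \<exists>D g.
        ((\<lambda>r. \<rho> r u) has_real_derivative D) (at s within {0..\<tau>}) \<and>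
        (GDERIV (\<lambda>v. (\<rho> s v)\<^sup>2) u :> g) \<and>
        D - m \<bullet> g = 0) \<and>
     (\<forall>u. \<rho> 0 u = \<rho>ini u)"

definition profile ::
  "nat \<Rightarrow> ('d::finite + 'd \<Rightarrow> real) \<Rightarrow> real \<Rightarrow> real \<Rightarrow> real \<Rightarrow> (real \<Rightarrow> real ^ 'd \<Rightarrow> real) \<Rightarrow>
   nat \<Rightarrow> real \<Rightarrow> real ^ 'd \<Rightarrow> real" where
  "profile K p \<rho>star \<alpha> \<kappa> \<rho> N t u =
     (let lam = real K - 2 * \<rho>star in
      \<rho>star + real N powr (-\<alpha>) *
        \<rho> (real N powr (\<kappa> - \<alpha>) * t) (u - (real N powr \<kappa> * lam * t) *\<^sub>R drift p))"

text \<open>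
  For a bounded function rho the profile takes values in the open interval from 0 to K, and
  the binomial parameter below lies in (0, 1), for all large N. The finitely many other N do
  not matter for the asymptotic statements.
\<close>

definition product_law :: "nat \<Rightarrow> nat \<Rightarrow> (real ^ 'd::finite \<Rightarrow> real) \<Rightarrow> 'd config pmf" where
  "product_law K N r = Pi_pmf (torus N) 0 (\<lambda>x. binomial_pmf K (r (embed_site N x) / real K))"

text \<open>The convention 0 log 0 = 0 is built in, since ln 0 is multiplied by f = 0.\<close>

definition rel_entropy :: "'s set \<Rightarrow> ('s \<Rightarrow> real) \<Rightarrow> ('s \<Rightarrow> real) \<Rightarrow> real" where
  "rel_entropy S \<mu> \<nu> = (\<Sum>\<eta>\<in>S. let f = \<mu> \<eta> / \<nu> \<eta> in f * ln f * \<nu> \<eta>)"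

definition entropy_H ::
  "nat \<Rightarrow> ('d::finite + 'd \<Rightarrow> real) \<Rightarrow> real \<Rightarrow> real \<Rightarrow> real \<Rightarrow> (real \<Rightarrow> real ^ 'd \<Rightarrow> real) \<Rightarrow>
   (nat \<Rightarrow> 'w measure) \<Rightarrow> (nat \<Rightarrow> real \<Rightarrow> 'w \<Rightarrow> 'd config) \<Rightarrow> nat \<Rightarrow> real \<Rightarrow> real" where
  "entropy_H K p \<rho>star \<alpha> \<kappa> \<rho> M X N t =
     rel_entropy (Config K N) (law (M N) (X N) t)
       (pmf (product_law K N (profile K p \<rho>star \<alpha> \<kappa> \<rho> N t)))"

definition associated_to_profile ::
  "real \<Rightarrow> real \<Rightarrow> (real ^ 'd::finite \<Rightarrow> real) \<Rightarrow> (nat \<Rightarrow> 'd config pmf) \<Rightarrow> bool" where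
  "associated_to_profile \<rho>star \<alpha> \<rho>ini \<mu> \<longleftrightarrow>
     (\<forall>\<phi> \<epsilon>. continuous_on UNIV \<phi> \<and> periodic \<phi> \<and> \<epsilon> > 0 \<longrightarrow>
        (\<lambda>N. measure_pmf.prob (\<mu> N)
           {\<eta>. \<bar>1 / real N powr (real CARD('d) - \<alpha>) *
                  (\<Sum>x\<in>torus N. (real (\<eta> x) - \<rho>star) * \<phi> (embed_site N x))
                - integral (cbox 0 1) (\<lambda>u. \<rho>ini u * \<phi> u)\<bar> > \<epsilon>})
        \<longlonglongrightarrow> 0)"

end

theory Submission
  imports Defs
begin

text \<open>
  Differentiate the relative entropy H in time and use the inequality
  a (ln b - ln a) \<le> b - a - (sqrt b - sqrt a)^2. With om x = (eta x - r x) / (r x (K - r x)), where r is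
  the profile at the sites, the entropy production is at most minus the Dirichlet form (times
  N^(1 + kappa)), plus a linear term in om whose coefficients are small because the profile solves
  the Burgers equation up to discretization errors, plus a sum over bonds of a(x) om x om (x + e_j)
  with coefficients of order N^(kappa - alpha).

  No exponential moments are needed. Enumerate the sites and subtract from om x its conditional
  mean m x given the earlier sites: the differences are orthogonal and the sum of the second
  moments of the m x is at most a constant times H. This bounds linear forms and quadratic forms with zero
  diagonal by H plus a variance term, which is too large for nearest neighbour products.
  Therefore om (x + e_j) is first replaced by its mean over a box of side 2^n, doubling the box in one
  coordinate at a time. Each doubling is a discrete gradient, which integration by parts
  bounds by a small part of the Dirichlet form plus the expectation of a square, with n d
  steps in total. With 2^n of order N^g for a suitable g, the derivative of H is
  at most a constant times H plus o(N^(d - 2 alpha)), and Gronwall's inequality applies.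
\<close>

subsection \<open>Martingale decomposition under a finite product measure\<close>

text \<open>The block exponent \<open>g\<close> is pinned from both sides. In a quadratic form with
  coefficients of order A = N^(\<kappa> - \<alpha>) the products of two orthogonal differences have
  mean zero, but the cross terms leave a variance A^2 N^d, which exceeds the target N^(d - 2
  \<alpha>) by N^(2 \<kappa>). A mean over a block of side N^g removes a factor N^(g d), whence 2
  \<kappa> < g d. The price is paid in the integration by parts against N^(1 + \<kappa>) times the
  Dirichlet form: the entropy gets the coefficient N^(2 g - 1 - \<kappa>), whence 2 g < 1 +
  \<kappa>, and the variance, relative to the target, is N^(\<kappa> - 1) times the energy of the
  flow that spreads a unit mass over the block. For the dyadic flow this energy is of order N^g if d
  = 1 and at most logarithmic if d is at least 2, whence \<kappa> < 1 - g or \<kappa> < 1. For d = 1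
  a suitable \<open>g\<close> exists exactly if 3 \<kappa> < 1, which \<kappa> \<le> \<alpha> and
  \<kappa> < 1 - 2 \<alpha> guarantee.\<close>

definition wmean :: "'c set \<Rightarrow> ('c \<Rightarrow> real) \<Rightarrow> ('c \<Rightarrow> real) \<Rightarrow> real" where
  "wmean S \<mu> F = (\<Sum>\<eta>\<in>S. \<mu> \<eta> * F \<eta>)"

lemma wmean_add: "wmean S \<mu> (\<lambda>\<eta>. F \<eta> + G \<eta>) = wmean S \<mu> F + wmean S \<mu> G"
  by (simp add: wmean_def algebra_simps sum.distrib)

lemma wmean_diff: "wmean S \<mu> (\<lambda>\<eta>. F \<eta> - G \<eta>) = wmean S \<mu> F - wmean S \<mu> G"
  by (simp add: wmean_def algebra_simps sum_subtractf)

lemma wmean_cmult: "wmean S \<mu> (\<lambda>\<eta>. c * F \<eta>) = c * wmean S \<mu> F"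
  by (simp add: wmean_def sum_distrib_left algebra_simps)

lemma wmean_sum: "wmean S \<mu> (\<lambda>\<eta>. \<Sum>i\<in>I. F i \<eta>) = (\<Sum>i\<in>I. wmean S \<mu> (F i))"
  unfolding wmean_def sum_distrib_left by (rule sum.swap)

lemma wmean_const: "(\<Sum>\<eta>\<in>S. \<mu> \<eta>) = 1 \<Longrightarrow> wmean S \<mu> (\<lambda>_. c) = c"
  by (simp add: wmean_def flip: sum_distrib_right)

lemma wmean_mono:
  "(\<And>\<eta>. \<eta> \<in> S \<Longrightarrow> 0 \<le> \<mu> \<eta>) \<Longrightarrow> (\<And>\<eta>. \<eta> \<in> S \<Longrightarrow> F \<eta> \<le> G \<eta>) \<Longrightarrow> wmean S \<mu> F \<le> wmean S \<mu> G"
  by (auto simp: wmean_def intro!: sum_mono mult_left_mono)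

lemma wmean_nonneg:
  "(\<And>\<eta>. \<eta> \<in> S \<Longrightarrow> 0 \<le> \<mu> \<eta>) \<Longrightarrow> (\<And>\<eta>. \<eta> \<in> S \<Longrightarrow> 0 \<le> F \<eta>) \<Longrightarrow> 0 \<le> wmean S \<mu> F"
  by (auto simp: wmean_def intro!: sum_nonneg)

lemma wmean_cong: "(\<And>\<eta>. \<eta> \<in> S \<Longrightarrow> F \<eta> = G \<eta>) \<Longrightarrow> wmean S \<mu> F = wmean S \<mu> G"
  by (auto simp: wmean_def intro!: sum.cong)

definition kl :: "'c set \<Rightarrow> ('c \<Rightarrow> real) \<Rightarrow> ('c \<Rightarrow> real) \<Rightarrow> real" where
  "kl S \<mu> \<nu> = (\<Sum>\<eta>\<in>S. \<mu> \<eta> * ln (\<mu> \<eta> / \<nu> \<eta>))"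

text \<open>Entropy inequality, pointwise from ln z \<le> z - 1 at z = \<nu> exp(G) / \<mu>. The
  exponential moment is required only to be at most 1, which is what a supermartingale
  delivers.\<close>

lemma gibbs_variational:
  assumes "\<And>\<eta>. \<eta> \<in> S \<Longrightarrow> 0 < \<mu> \<eta>" "\<And>\<eta>. \<eta> \<in> S \<Longrightarrow> 0 < \<nu> \<eta>"
    and "(\<Sum>\<eta>\<in>S. \<mu> \<eta>) = 1" and "(\<Sum>\<eta>\<in>S. \<nu> \<eta> * exp (G \<eta>)) \<le> 1"
  shows "wmean S \<mu> G \<le> kl S \<mu> \<nu>"
proof -
  have "\<mu> \<eta> * G \<eta> - \<mu> \<eta> * ln (\<mu> \<eta> / \<nu> \<eta>) \<le> \<nu> \<eta> * exp (G \<eta>) - \<mu> \<eta>" if "\<eta> \<in> S" for \<eta>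
  proof -
    have p: "\<mu> \<eta> > 0" "\<nu> \<eta> > 0" using assms that by auto
    have "ln (\<nu> \<eta> * exp (G \<eta>) / \<mu> \<eta>) \<le> \<nu> \<eta> * exp (G \<eta>) / \<mu> \<eta> - 1"
      using p by (intro ln_le_minus_one) auto
    also have "ln (\<nu> \<eta> * exp (G \<eta>) / \<mu> \<eta>) = G \<eta> - ln (\<mu> \<eta> / \<nu> \<eta>)"
      using p by (simp add: ln_mult ln_div)
    finally have "\<mu> \<eta> * (G \<eta> - ln (\<mu> \<eta> / \<nu> \<eta>)) \<le> \<mu> \<eta> * (\<nu> \<eta> * exp (G \<eta>) / \<mu> \<eta> - 1)"
      using p by (intro mult_left_mono) auto
    thus ?thesis using p by (simp add: algebra_simps)
  qed
  hence "(\<Sum>\<eta>\<in>S. \<mu> \<eta> * G \<eta> - \<mu> \<eta> * ln (\<mu> \<eta> / \<nu> \<eta>)) \<le> (\<Sum>\<eta>\<in>S. \<nu> \<eta> * exp (G \<eta>) - \<mu> \<eta>)"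
    by (rule sum_mono)
  thus ?thesis
    using assms(3,4) by (simp add: wmean_def kl_def sum_subtractf)
qed

lemma exp_le_quadratic:
  fixes y :: real
  assumes "\<bar>y\<bar> \<le> 1"
  shows "exp y \<le> 1 + y + y\<^sup>2"
proof (cases "y \<ge> 0")
  case True
  thus ?thesis using assms by (intro exp_bound) auto
next
  case False
  define z where "z = - y"
  have z: "z > 0" using False by (simp add: z_def)
  \<comment> \<open>For negative arguments the claim is exp(- z) \<le> 1 - z + z^2, obtained by
    inverting the Taylor lower bound for exp z; the product of the two quadratics exceeds 1 for
    every z > 0.\<close>
  have "1 \<le> (1 - z + z\<^sup>2) * (1 + z + z\<^sup>2 / 2)"
  proof -
    have "(1 - z + z\<^sup>2) * (1 + z + z\<^sup>2 / 2) = 1 + (z ^ 2 / 2 + z ^ 3 / 2 + z ^ 4 / 2)"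
      by (simp add: field_simps power2_eq_square power3_eq_cube power4_eq_xxxx)
    thus ?thesis using z by simp
  qed
  also have "\<dots> \<le> (1 - z + z\<^sup>2) * exp z"
  proof (rule mult_left_mono)
    show "1 + z + z\<^sup>2 / 2 \<le> exp z" using z by (intro exp_lower_Taylor_quadratic) auto
    have "0 \<le> (1 - z)\<^sup>2 + z" using z by simp
    also have "(1 - z)\<^sup>2 + z = 1 - z + z\<^sup>2" by (simp add: power2_eq_square algebra_simps)
    finally show "0 \<le> 1 - z + z\<^sup>2" .
  qed
  finally have "exp (- z) \<le> 1 - z + z\<^sup>2" by (simp add: exp_minus field_simps)
  thus ?thesis by (simp add: z_def)
qed

text \<open>Tower property on a finite space. The information is an equivalence relation
  \<open>R\<close> whose classes are the atoms, the quotient is the conditional mean of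
  \<open>F\<close> on the class of \<eta>, and a \<open>g\<close> constant on classes is measurable.
  Symmetry of \<open>R\<close> lets the two points of a pair exchange roles.\<close>

lemma wmean_cond:
  fixes \<mu> :: "'c \<Rightarrow> real"
  assumes fin: "finite S" and eq: "equiv S R" and pos: "\<And>\<eta>. \<eta> \<in> S \<Longrightarrow> 0 < \<mu> \<eta>"
    and g: "\<And>\<eta> \<eta>'. (\<eta>, \<eta>') \<in> R \<Longrightarrow> g \<eta> = g \<eta>'"
  shows "wmean S \<mu> (\<lambda>\<eta>. g \<eta> * ((\<Sum>\<eta>'\<in>R `` {\<eta>}. \<mu> \<eta>' * F \<eta>') / (\<Sum>\<eta>'\<in>R `` {\<eta>}. \<mu> \<eta>')))
       = wmean S \<mu> (\<lambda>\<eta>. g \<eta> * F \<eta>)"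
proof -
  define Z where "Z = (\<lambda>\<eta>. \<Sum>\<eta>'\<in>R `` {\<eta>}. \<mu> \<eta>')"
  have RS: "R \<subseteq> S \<times> S" using eq by (auto simp: equiv_def refl_on_def)
  have sub: "R `` {\<eta>} \<subseteq> S" for \<eta> using RS by auto
  have finR: "finite (R `` {\<eta>})" for \<eta> using finite_subset[OF sub fin] .
  have Zpos: "Z \<eta> > 0" if "\<eta> \<in> S" for \<eta>
    unfolding Z_def using that eq sub pos finR equiv_class_self[OF eq that]
    by (intro sum_pos) auto
  have cls: "R `` {\<eta>} = R `` {\<eta>'}" if "(\<eta>, \<eta>') \<in> R" for \<eta> \<eta>'
    using equiv_class_eq[OF eq that] .
  have sw: "(\<Sum>\<eta>\<in>S. \<Sum>\<eta>'\<in>R `` {\<eta>}. h \<eta> \<eta>') = (\<Sum>\<eta>'\<in>S. \<Sum>\<eta>\<in>R `` {\<eta>'}. h \<eta> \<eta>')"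
    for h :: "'c \<Rightarrow> 'c \<Rightarrow> real"
  proof -
    have "(\<Sum>\<eta>\<in>S. \<Sum>\<eta>'\<in>R `` {\<eta>}. h \<eta> \<eta>') = (\<Sum>\<eta>\<in>S. \<Sum>\<eta>'\<in>S. if (\<eta>, \<eta>') \<in> R then h \<eta> \<eta>' else 0)"
      by (intro sum.cong refl sum.mono_neutral_cong_left fin) (use sub in auto)
    also have "\<dots> = (\<Sum>\<eta>'\<in>S. \<Sum>\<eta>\<in>S. if (\<eta>, \<eta>') \<in> R then h \<eta> \<eta>' else 0)" by (rule sum.swap)
    also have "\<dots> = (\<Sum>\<eta>'\<in>S. \<Sum>\<eta>\<in>S. if (\<eta>', \<eta>) \<in> R then h \<eta> \<eta>' else 0)"
      using eq by (intro sum.cong refl if_cong) (auto simp: equiv_def sym_def)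
    also have "\<dots> = (\<Sum>\<eta>'\<in>S. \<Sum>\<eta>\<in>R `` {\<eta>'}. h \<eta> \<eta>')"
      by (intro sum.cong refl sum.mono_neutral_cong_right fin) (use sub in auto)
    finally show ?thesis .
  qed
  have "wmean S \<mu> (\<lambda>\<eta>. g \<eta> * ((\<Sum>\<eta>'\<in>R `` {\<eta>}. \<mu> \<eta>' * F \<eta>') / Z \<eta>))
     = (\<Sum>\<eta>\<in>S. \<Sum>\<eta>'\<in>R `` {\<eta>}. \<mu> \<eta> * g \<eta> / Z \<eta> * (\<mu> \<eta>' * F \<eta>'))"
    by (simp add: wmean_def sum_distrib_left mult.assoc sum_divide_distrib)
  also have "\<dots> = (\<Sum>\<eta>'\<in>S. \<Sum>\<eta>\<in>R `` {\<eta>'}. \<mu> \<eta> * g \<eta> / Z \<eta> * (\<mu> \<eta>' * F \<eta>'))" by (rule sw)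
  also have "\<dots> = (\<Sum>\<eta>'\<in>S. \<mu> \<eta>' * (g \<eta>' * F \<eta>'))"
  proof (intro sum.cong refl)
    fix \<eta>' assume s: "\<eta>' \<in> S"
    have "(\<Sum>\<eta>\<in>R `` {\<eta>'}. \<mu> \<eta> * g \<eta> / Z \<eta> * (\<mu> \<eta>' * F \<eta>'))
       = (\<Sum>\<eta>\<in>R `` {\<eta>'}. \<mu> \<eta> * (g \<eta>' / Z \<eta>' * (\<mu> \<eta>' * F \<eta>')))"
    proof (intro sum.cong refl)
      fix \<eta> assume "\<eta> \<in> R `` {\<eta>'}"
      hence r: "(\<eta>', \<eta>) \<in> R" by auto
      have "Z \<eta> = Z \<eta>'" unfolding Z_def using cls[OF r] by simp
      with g[OF r] show "\<mu> \<eta> * g \<eta> / Z \<eta> * (\<mu> \<eta>' * F \<eta>') = \<mu> \<eta> * (g \<eta>' / Z \<eta>' * (\<mu> \<eta>' * F \<eta>'))" by simp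
    qed
    also have "\<dots> = Z \<eta>' * (g \<eta>' / Z \<eta>' * (\<mu> \<eta>' * F \<eta>'))" unfolding Z_def by (rule sum_distrib_right[symmetric])
    also have "\<dots> = \<mu> \<eta>' * (g \<eta>' * F \<eta>')" using Zpos[OF s] by simp
    finally show "(\<Sum>\<eta>\<in>R `` {\<eta>'}. \<mu> \<eta> * g \<eta> / Z \<eta> * (\<mu> \<eta>' * F \<eta>')) = \<mu> \<eta>' * (g \<eta>' * F \<eta>')" .
  qed
  finally show ?thesis by (simp add: wmean_def Z_def)
qed

section \<open>Finite product measures and resampling of one site\<close>

locale finite_product =
  fixes \<Lambda> :: "'s set" and K :: nat and w :: "'s \<Rightarrow> nat \<Rightarrow> real"
  assumes finite_sites: "finite \<Lambda>"
    and w_pos: "\<And>x k. x \<in> \<Lambda> \<Longrightarrow> k \<le> K \<Longrightarrow> 0 < w x k"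
    and w_sum: "\<And>x. x \<in> \<Lambda> \<Longrightarrow> (\<Sum>k\<le>K. w x k) = 1"
begin

definition "\<Omega> = PiE_dflt \<Lambda> (0::nat) (\<lambda>_. {0..K})"

definition "\<nu> \<eta> = (\<Prod>x\<in>\<Lambda>. w x (\<eta> x))"

lemma finite_\<Omega>: "finite \<Omega>"
  unfolding \<Omega>_def using finite_sites by (intro finite_PiE_dflt) auto

lemma \<Omega>_le: "\<eta> \<in> \<Omega> \<Longrightarrow> \<eta> x \<le> K"
  by (auto simp: \<Omega>_def PiE_dflt_def) (metis zero_le)

lemma \<Omega>_upd: "\<eta> \<in> \<Omega> \<Longrightarrow> x \<in> \<Lambda> \<Longrightarrow> k \<le> K \<Longrightarrow> \<eta>(x := k) \<in> \<Omega>"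
  by (auto simp: \<Omega>_def PiE_dflt_def)

lemma \<nu>_pos: "\<eta> \<in> \<Omega> \<Longrightarrow> 0 < \<nu> \<eta>"
  unfolding \<nu>_def by (intro prod_pos) (auto intro!: w_pos simp: \<Omega>_le)

lemma \<nu>_split: "x \<in> \<Lambda> \<Longrightarrow> \<nu> \<eta> = w x (\<eta> x) * (\<Prod>y\<in>\<Lambda> - {x}. w y (\<eta> y))"
  unfolding \<nu>_def using finite_sites by (rule prod.remove)

text \<open>Refreshing one coordinate leaves the product measure invariant: exchanging the stored
  value at \<open>x\<close> with the fresh value \<open>k\<close> is an involution of pairs that
  preserves the weight \<open>\<nu> \<eta> * w x k\<close>.\<close>

lemma resample:
  assumes x: "x \<in> \<Lambda>"
  shows "(\<Sum>\<eta>\<in>\<Omega>. \<nu> \<eta> * F \<eta>) = (\<Sum>\<eta>\<in>\<Omega>. \<nu> \<eta> * (\<Sum>k\<le>K. w x k * F (\<eta>(x := k))))"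
proof -
  have "(\<Sum>\<eta>\<in>\<Omega>. \<nu> \<eta> * (\<Sum>k\<le>K. w x k * F (\<eta>(x := k))))
      = (\<Sum>(\<eta>, k)\<in>\<Omega> \<times> {..K}. \<nu> \<eta> * w x k * F (\<eta>(x := k)))"
    by (simp add: sum.cartesian_product[symmetric] sum_distrib_left mult.assoc)
  also have "\<dots> = (\<Sum>(\<eta>, k)\<in>\<Omega> \<times> {..K}. \<nu> \<eta> * w x k * F \<eta>)"
  proof (rule sum.reindex_bij_witness[where i = "\<lambda>(\<eta>, k). (\<eta>(x := k), \<eta> x)" and j = "\<lambda>(\<eta>, k). (\<eta>(x := k), \<eta> x)"])
    have "(\<Prod>y\<in>\<Lambda> - {x}. w y (if y = x then k else \<eta> y)) = (\<Prod>y\<in>\<Lambda> - {x}. w y (\<eta> y))" for k \<eta>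
      by (rule prod.cong) auto
    thus "(case (case a of (\<eta>, k) \<Rightarrow> (\<eta>(x := k), \<eta> x)) of (\<eta>, k) \<Rightarrow> \<nu> \<eta> * w x k * F \<eta>) =
        (case a of (\<eta>, k) \<Rightarrow> \<nu> \<eta> * w x k * F (\<eta>(x := k)))" for a
      by (cases a) (simp add: \<nu>_split[OF x])
  qed (use x in \<open>auto simp: \<Omega>_le \<Omega>_upd\<close>)
  also have "\<dots> = (\<Sum>\<eta>\<in>\<Omega>. \<nu> \<eta> * F \<eta> * (\<Sum>k\<le>K. w x k))"
    by (simp add: sum.cartesian_product[symmetric] sum_distrib_left mult_ac)
  finally show ?thesis using w_sum[OF x] by simp
qed

text \<open>The entropy bound is the Gibbs variational inequality for the exponential supermartingale
  with predictable coefficients m / (2 b^2); the factor 2 keeps the exponents in the range of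
  the quadratic bound on exp.\<close>

lemma martingale_decomposition:
  fixes \<mu> :: "('s \<Rightarrow> nat) \<Rightarrow> real" and \<omega> :: "'s \<Rightarrow> nat \<Rightarrow> real"
  assumes pos: "\<And>\<eta>. \<eta> \<in> \<Omega> \<Longrightarrow> 0 < \<mu> \<eta>" and prob: "(\<Sum>\<eta>\<in>\<Omega>. \<mu> \<eta>) = 1"
    and \<nu>_prob: "(\<Sum>\<eta>\<in>\<Omega>. \<nu> \<eta>) = 1"
    and centred: "\<And>x. x \<in> \<Lambda> \<Longrightarrow> (\<Sum>k\<le>K. w x k * \<omega> x k) = 0"
    and bnd: "\<And>x k. x \<in> \<Lambda> \<Longrightarrow> k \<le> K \<Longrightarrow> \<bar>\<omega> x k\<bar> \<le> b" and b: "b > 0"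
  obtains m where "\<And>x \<eta>. x \<in> \<Lambda> \<Longrightarrow> \<eta> \<in> \<Omega> \<Longrightarrow> \<bar>m x \<eta>\<bar> \<le> b"
    and "(\<Sum>x\<in>\<Lambda>. wmean \<Omega> \<mu> (\<lambda>\<eta>. (m x \<eta>)\<^sup>2)) \<le> 4 * b\<^sup>2 * kl \<Omega> \<mu> \<nu>"
    and "\<And>x. x \<in> \<Lambda> \<Longrightarrow> wmean \<Omega> \<mu> (\<lambda>\<eta>. \<omega> x (\<eta> x) - m x \<eta>) = 0"
    and "\<And>x y. x \<in> \<Lambda> \<Longrightarrow> y \<in> \<Lambda> \<Longrightarrow> x \<noteq> y \<Longrightarrow>
           wmean \<Omega> \<mu> (\<lambda>\<eta>. (\<omega> x (\<eta> x) - m x \<eta>) * (\<omega> y (\<eta> y) - m y \<eta>)) = 0"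
proof -
  obtain h n where h: "bij_betw h {0..<n::nat} \<Lambda>" using ex_bij_betw_nat_finite[OF finite_sites] by blast
  have h\<Lambda>: "i < n \<Longrightarrow> h i \<in> \<Lambda>" for i using h by (auto simp: bij_betw_def)
  have hinj: "i < n \<Longrightarrow> j < n \<Longrightarrow> h i = h j \<longleftrightarrow> i = j" for i j using h by (auto simp: bij_betw_def inj_on_def)
  \<comment> \<open>The information carried by the first \<open>i\<close> sites of the enumeration.
    Accordingly \<open>m i\<close> is the conditional mean, under \<open>\<mu>\<close> and not under
    \<open>\<nu>\<close>, of the field at site \<open>h i\<close> given the sites strictly before
    it.\<close>
  define R where "R = (\<lambda>i. {(\<eta>, \<eta>'). \<eta> \<in> \<Omega> \<and> \<eta>' \<in> \<Omega> \<and> (\<forall>j<i. \<eta> (h j) = \<eta>' (h j))})"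
  have eqR: "equiv \<Omega> (R i)" for i
    by (auto simp: equiv_def refl_on_def sym_def trans_def R_def)
  define m where "m = (\<lambda>i \<eta>. (\<Sum>\<eta>'\<in>R i `` {\<eta>}. \<mu> \<eta>' * \<omega> (h i) (\<eta>' (h i))) / (\<Sum>\<eta>'\<in>R i `` {\<eta>}. \<mu> \<eta>'))"
  have mR: "m j \<eta> = m j \<eta>'" if "(\<eta>, \<eta>') \<in> R i" "j \<le> i" for i j \<eta> \<eta>'
  proof -
    have "(\<eta>, \<eta>') \<in> R j" using that by (auto simp: R_def)
    from equiv_class_eq[OF eqR this] show ?thesis unfolding m_def by simp
  qed
  have cond: "wmean \<Omega> \<mu> (\<lambda>\<eta>. g \<eta> * m i \<eta>) = wmean \<Omega> \<mu> (\<lambda>\<eta>. g \<eta> * \<omega> (h i) (\<eta> (h i)))"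
    if "\<And>\<eta> \<eta>'. (\<eta>, \<eta>') \<in> R i \<Longrightarrow> g \<eta> = g \<eta>'" for g i
    unfolding m_def by (rule wmean_cond[OF finite_\<Omega> eqR pos that])
  have mb: "\<bar>m i \<eta>\<bar> \<le> b" if i: "i < n" and \<eta>: "\<eta> \<in> \<Omega>" for i \<eta>
  proof -
    have sub: "R i `` {\<eta>} \<subseteq> \<Omega>" by (auto simp: R_def)
    have Z: "(\<Sum>\<eta>'\<in>R i `` {\<eta>}. \<mu> \<eta>') > 0"
      using sub pos finite_subset[OF sub finite_\<Omega>] equiv_class_self[OF eqR \<eta>, of i] by (intro sum_pos) auto
    have "\<bar>\<Sum>\<eta>'\<in>R i `` {\<eta>}. \<mu> \<eta>' * \<omega> (h i) (\<eta>' (h i))\<bar> \<le> (\<Sum>\<eta>'\<in>R i `` {\<eta>}. \<mu> \<eta>' * b)"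
    proof (rule order_trans[OF sum_abs], rule sum_mono)
      fix \<eta>' assume "\<eta>' \<in> R i `` {\<eta>}"
      with sub have e: "\<eta>' \<in> \<Omega>" by auto
      show "\<bar>\<mu> \<eta>' * \<omega> (h i) (\<eta>' (h i))\<bar> \<le> \<mu> \<eta>' * b"
        using pos[OF e] bnd[OF h\<Lambda>[OF i] \<Omega>_le[OF e]] by (simp add: abs_mult)
    qed
    also have "\<dots> = b * (\<Sum>\<eta>'\<in>R i `` {\<eta>}. \<mu> \<eta>')" by (simp add: sum_distrib_left mult.commute)
    finally show ?thesis using Z unfolding m_def by (simp add: divide_le_eq)
  qed
  \<comment> \<open>The case j = i is included: \<open>m i\<close> looks only at indices below
    \<open>i\<close>, so it does not see a change at site \<open>h i\<close>.\<close>
  have prefix: "m j (\<eta>(h i := k)) = m j \<eta>" if "j \<le> i" "i < n" "\<eta> \<in> \<Omega>" "k \<le> K" for i j k \<eta>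
    using that by (intro mR[where i = i]) (auto simp: R_def hinj intro!: \<Omega>_upd h\<Lambda>)
  define \<theta> where "\<theta> = (\<lambda>i \<eta>. m i \<eta> / (2 * b\<^sup>2))"
  define G where "G = (\<lambda>k \<eta>. \<Sum>i<k. \<theta> i \<eta> * \<omega> (h i) (\<eta> (h i)) - (\<theta> i \<eta>)\<^sup>2 * b\<^sup>2)"
  have single: "(\<Sum>k\<le>K. w (h i) k * exp (\<theta> i \<eta> * \<omega> (h i) k - (\<theta> i \<eta>)\<^sup>2 * b\<^sup>2)) \<le> 1"
    if i: "i < n" and \<eta>: "\<eta> \<in> \<Omega>" for i \<eta>
  proof -
    let ?t = "\<theta> i \<eta>"
    have "w (h i) k * exp (?t * \<omega> (h i) k) \<le> w (h i) k * (1 + ?t\<^sup>2 * b\<^sup>2) + ?t * (w (h i) k * \<omega> (h i) k)" if k: "k \<le> K" for k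
    proof -
      let ?o = "\<omega> (h i) k"
      have o: "\<bar>?o\<bar> \<le> b" using bnd[OF h\<Lambda>[OF i] k] .
      have "\<bar>?t\<bar> \<le> b / (2 * b\<^sup>2)" unfolding \<theta>_def using mb[OF i \<eta>] b by (simp add: divide_right_mono)
      hence t: "\<bar>?t\<bar> \<le> 1 / (2 * b)" using b by (simp add: power2_eq_square)
      have "\<bar>?t * ?o\<bar> \<le> 1 / (2 * b) * b" unfolding abs_mult using t o b by (intro mult_mono) auto
      hence y: "\<bar>?t * ?o\<bar> \<le> 1 / 2" using b by simp
      have "exp (?t * ?o) \<le> 1 + ?t * ?o + (?t * ?o)\<^sup>2"
        using y by (intro exp_le_quadratic) auto
      also have "(?t * ?o)\<^sup>2 \<le> ?t\<^sup>2 * b\<^sup>2"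
        unfolding power_mult_distrib using o b by (intro mult_left_mono) (auto simp flip: abs_le_square_iff)
      finally have "w (h i) k * exp (?t * ?o) \<le> w (h i) k * (1 + ?t * ?o + ?t\<^sup>2 * b\<^sup>2)"
        using w_pos[OF h\<Lambda>[OF i] k] by (intro mult_left_mono) auto
      thus ?thesis by (simp add: algebra_simps)
    qed
    hence "(\<Sum>k\<le>K. w (h i) k * exp (?t * \<omega> (h i) k)) \<le>
      (\<Sum>k\<le>K. w (h i) k * (1 + ?t\<^sup>2 * b\<^sup>2) + ?t * (w (h i) k * \<omega> (h i) k))" by (intro sum_mono) auto
    also have "\<dots> = 1 + ?t\<^sup>2 * b\<^sup>2"
      using centred[OF h\<Lambda>[OF i]] w_sum[OF h\<Lambda>[OF i]]
      by (simp add: sum.distrib flip: sum_distrib_left sum_distrib_right)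
    also have "\<dots> \<le> exp (?t\<^sup>2 * b\<^sup>2)" by (rule exp_ge_add_one_self)
    finally show ?thesis by (simp add: exp_diff divide_le_eq flip: sum_divide_distrib)
  qed
  have super: "(\<Sum>\<eta>\<in>\<Omega>. \<nu> \<eta> * exp (G k \<eta>)) \<le> 1" if "k \<le> n" for k
    using that
  proof (induction k)
    case 0
    thus ?case using \<nu>_prob by (simp add: G_def)
  next
    case (Suc i)
    hence i: "i < n" by simp
    \<comment> \<open>\<open>G i\<close> and \<open>\<theta> i\<close> depend on earlier sites only,
      so a fresh value at \<open>h i\<close> enters the last factor alone, and its mean under the
      one-site weight is at most 1.\<close>
    have "(\<Sum>\<eta>\<in>\<Omega>. \<nu> \<eta> * exp (G (Suc i) \<eta>))
       = (\<Sum>\<eta>\<in>\<Omega>. \<nu> \<eta> * (\<Sum>k\<le>K. w (h i) k * exp (G (Suc i) (\<eta>(h i := k)))))"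
      by (rule resample[OF h\<Lambda>[OF i]])
    also have "\<dots> = (\<Sum>\<eta>\<in>\<Omega>. \<nu> \<eta> * (exp (G i \<eta>) *
        (\<Sum>k\<le>K. w (h i) k * exp (\<theta> i \<eta> * \<omega> (h i) k - (\<theta> i \<eta>)\<^sup>2 * b\<^sup>2))))"
    proof (intro sum.cong refl arg_cong2[where f = "(*)"])
      fix \<eta> assume \<eta>: "\<eta> \<in> \<Omega>"
      have "G (Suc i) (\<eta>(h i := k)) = G i \<eta> + (\<theta> i \<eta> * \<omega> (h i) k - (\<theta> i \<eta>)\<^sup>2 * b\<^sup>2)" if "k \<le> K" for k
      proof -
        have "G i (\<eta>(h i := k)) = G i \<eta>"
          unfolding G_def \<theta>_def using i \<eta> that by (intro sum.cong refl) (auto simp: prefix hinj)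
        thus ?thesis using prefix[of i i \<eta> k] i \<eta> that by (simp add: G_def \<theta>_def)
      qed
      thus "(\<Sum>k\<le>K. w (h i) k * exp (G (Suc i) (\<eta>(h i := k)))) = exp (G i \<eta>) *
        (\<Sum>k\<le>K. w (h i) k * exp (\<theta> i \<eta> * \<omega> (h i) k - (\<theta> i \<eta>)\<^sup>2 * b\<^sup>2))"
        unfolding sum_distrib_left by (intro sum.cong refl) (simp add: exp_add)
    qed
    also have "\<dots> \<le> (\<Sum>\<eta>\<in>\<Omega>. \<nu> \<eta> * (exp (G i \<eta>) * 1))"
      using single[OF i] \<nu>_pos by (intro sum_mono mult_left_mono) (auto simp: less_imp_le)
    also have "\<dots> \<le> 1" using Suc by simp
    finally show ?case .
  qed
  have "wmean \<Omega> \<mu> (G n) \<le> kl \<Omega> \<mu> \<nu>"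
    by (rule gibbs_variational[OF pos \<nu>_pos prob super]) auto
  \<comment> \<open>Under \<open>\<mu>\<close> the linear term averages to m^2 / (2 b^2) by
    conditioning, and the compensator is m^2 / (4 b^2); their difference m^2 / (4 b^2) is the origin
    of the factor 4 b^2 in front of the entropy.\<close>
  also have "wmean \<Omega> \<mu> (G n) = (\<Sum>i<n. wmean \<Omega> \<mu> (\<lambda>\<eta>. (m i \<eta>)\<^sup>2) / (4 * b\<^sup>2))"
  proof -
    have "wmean \<Omega> \<mu> (\<lambda>\<eta>. \<theta> i \<eta> * \<omega> (h i) (\<eta> (h i)) - (\<theta> i \<eta>)\<^sup>2 * b\<^sup>2)
        = wmean \<Omega> \<mu> (\<lambda>\<eta>. (m i \<eta>)\<^sup>2) / (4 * b\<^sup>2)" if "i < n" for i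
    proof -
      have "wmean \<Omega> \<mu> (\<lambda>\<eta>. \<theta> i \<eta> * \<omega> (h i) (\<eta> (h i))) = wmean \<Omega> \<mu> (\<lambda>\<eta>. \<theta> i \<eta> * m i \<eta>)"
        unfolding \<theta>_def using mR by (intro cond[symmetric]) auto
      hence "wmean \<Omega> \<mu> (\<lambda>\<eta>. \<theta> i \<eta> * \<omega> (h i) (\<eta> (h i)) - (\<theta> i \<eta>)\<^sup>2 * b\<^sup>2)
         = wmean \<Omega> \<mu> (\<lambda>\<eta>. \<theta> i \<eta> * m i \<eta> - (\<theta> i \<eta>)\<^sup>2 * b\<^sup>2)" by (simp add: wmean_diff)
      also have "\<dots> = wmean \<Omega> \<mu> (\<lambda>\<eta>. 1 / (4 * b\<^sup>2) * (m i \<eta>)\<^sup>2)"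
        using b by (intro wmean_cong) (simp add: \<theta>_def field_simps power2_eq_square)
      finally show ?thesis by (subst (asm) wmean_cmult) simp
    qed
    thus ?thesis unfolding G_def wmean_sum by (intro sum.cong refl) auto
  qed
  finally have sq: "(\<Sum>i<n. wmean \<Omega> \<mu> (\<lambda>\<eta>. (m i \<eta>)\<^sup>2)) \<le> 4 * b\<^sup>2 * kl \<Omega> \<mu> \<nu>"
    using b by (simp add: divide_le_eq mult.commute flip: sum_divide_distrib)
  have mean0: "wmean \<Omega> \<mu> (\<lambda>\<eta>. \<omega> (h i) (\<eta> (h i)) - m i \<eta>) = 0" for i
    using cond[of i "\<lambda>_. 1"] by (simp add: wmean_diff)
  \<comment> \<open>The earlier difference is determined by the first \<open>j\<close> sites, and
    the later one has conditional mean zero given those sites.\<close>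
  have orth: "wmean \<Omega> \<mu> (\<lambda>\<eta>. (\<omega> (h i) (\<eta> (h i)) - m i \<eta>) * (\<omega> (h j) (\<eta> (h j)) - m j \<eta>)) = 0" if "i < j" for i j
  proof -
    have "wmean \<Omega> \<mu> (\<lambda>\<eta>. (\<omega> (h i) (\<eta> (h i)) - m i \<eta>) * m j \<eta>)
        = wmean \<Omega> \<mu> (\<lambda>\<eta>. (\<omega> (h i) (\<eta> (h i)) - m i \<eta>) * \<omega> (h j) (\<eta> (h j)))"
    proof (rule cond)
      fix \<eta> \<eta>' assume r: "(\<eta>, \<eta>') \<in> R j"
      have "\<eta> (h i) = \<eta>' (h i)" using r that by (auto simp: R_def)
      thus "\<omega> (h i) (\<eta> (h i)) - m i \<eta> = \<omega> (h i) (\<eta>' (h i)) - m i \<eta>'" using mR[OF r] that by simp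
    qed
    thus ?thesis by (simp add: right_diff_distrib wmean_diff)
  qed
  define idx where "idx = the_inv_into {0..<n} h"
  have idx: "idx x < n" "h (idx x) = x" if "x \<in> \<Lambda>" for x
  proof -
    have inj: "inj_on h {0..<n}" and im: "h ` {0..<n} = \<Lambda>" using h by (auto simp: bij_betw_def)
    show "h (idx x) = x" unfolding idx_def using inj im that by (intro f_the_inv_into_f) auto
    show "idx x < n" unfolding idx_def using the_inv_into_into[OF inj, of x "{0..<n}"] im that by auto
  qed
  show ?thesis
  proof (rule that[of "\<lambda>x. m (idx x)"])
    show "\<bar>m (idx x) \<eta>\<bar> \<le> b" if "x \<in> \<Lambda>" "\<eta> \<in> \<Omega>" for x \<eta> using mb idx that by blast
    have "(\<Sum>x\<in>\<Lambda>. wmean \<Omega> \<mu> (\<lambda>\<eta>. (m (idx x) \<eta>)\<^sup>2)) = (\<Sum>i<n. wmean \<Omega> \<mu> (\<lambda>\<eta>. (m i \<eta>)\<^sup>2))"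
      by (rule sum.reindex_bij_witness[where i = h and j = idx])
         (use idx h\<Lambda> hinj in \<open>auto, metis\<close>)
    thus "(\<Sum>x\<in>\<Lambda>. wmean \<Omega> \<mu> (\<lambda>\<eta>. (m (idx x) \<eta>)\<^sup>2)) \<le> 4 * b\<^sup>2 * kl \<Omega> \<mu> \<nu>" using sq by simp
    show "wmean \<Omega> \<mu> (\<lambda>\<eta>. \<omega> x (\<eta> x) - m (idx x) \<eta>) = 0" if "x \<in> \<Lambda>" for x
      using mean0[of "idx x"] idx[OF that] by simp
    show "wmean \<Omega> \<mu> (\<lambda>\<eta>. (\<omega> x (\<eta> x) - m (idx x) \<eta>) * (\<omega> y (\<eta> y) - m (idx y) \<eta>)) = 0"
      if "x \<in> \<Lambda>" "y \<in> \<Lambda>" "x \<noteq> y" for x y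
    proof (cases "idx x < idx y")
      case True
      thus ?thesis using orth[OF True] idx that by simp
    next
      case False
      hence "idx y < idx x" using idx that by (metis linorder_neqE_nat)
      thus ?thesis using orth[of "idx y" "idx x"] idx that by (simp add: mult.commute)
    qed
  qed
qed

end

subsection \<open>Linear and quadratic forms on the discrete torus\<close>

lemma torus_alt: "torus N = vec_lambda ` (PiE UNIV (\<lambda>_. {0..<int N}))"
proof (rule set_eqI)
  fix x :: "int ^ 'd"
  show "x \<in> torus N \<longleftrightarrow> x \<in> vec_lambda ` (PiE UNIV (\<lambda>_. {0..<int N}))"
    by (auto simp: torus_def image_iff intro!: bexI[of _ "vec_nth x"])
qed

lemma finite_torus [simp]: "finite (torus N)"
  unfolding torus_alt by (intro finite_imageI finite_PiE) auto

lemma card_torus: "card (torus N :: (int ^ 'd::finite) set) = N ^ CARD('d)"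
proof -
  have "inj_on vec_lambda (PiE (UNIV :: 'd set) (\<lambda>_. {0..<int N}))"
    by (auto simp: inj_on_def vec_lambda_inject)
  thus ?thesis unfolding torus_alt by (simp add: card_image card_PiE)
qed

lemma torus_add_in [simp]: "N > 0 \<Longrightarrow> torus_add N x y \<in> torus N"
  by (auto simp: torus_def torus_add_def)

lemma torus_add_assoc: "torus_add N (torus_add N x y) z = torus_add N x (y + z)"
  by (auto simp: torus_add_def vec_eq_iff mod_simps algebra_simps)

lemma torus_add_0 [simp]: "x \<in> torus N \<Longrightarrow> torus_add N x 0 = x"
  by (auto simp: torus_add_def torus_def vec_eq_iff)

lemma torus_add_eq_iff:
  assumes "N > 0"
  shows "torus_add N x y = torus_add N x z \<longleftrightarrow> (\<forall>i. int N dvd (y $ i - z $ i))"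
  by (auto simp: torus_add_def vec_eq_iff mod_eq_dvd_iff)

lemma torus_add_eq_self_iff:
  assumes "N > 0" "x \<in> torus N"
  shows "torus_add N x y = x \<longleftrightarrow> (\<forall>i. int N dvd (y $ i))"
  using torus_add_eq_iff[OF assms(1), of x y 0] assms(2) by simp

lemma sum_torus_shift:
  assumes "N > 0"
  shows "(\<Sum>x\<in>torus N. g (torus_add N x z)) = (\<Sum>x\<in>torus N. g x)"
  by (rule sum.reindex_bij_witness[where j = "\<lambda>x. torus_add N x z" and i = "\<lambda>x. torus_add N x (- z)"])
     (use assms in \<open>auto simp: torus_add_assoc\<close>)

section \<open>Second moments of sums of translated fields\<close>

lemma sum_power2_le_card:
  fixes f :: "'a \<Rightarrow> real"
  shows "(\<Sum>i\<in>I. f i)\<^sup>2 \<le> real (card I) * (\<Sum>i\<in>I. (f i)\<^sup>2)"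
  using sum_squared_le_sum_of_squares[of f I] by (cases "finite I") (simp_all add: mult.commute)

text \<open>Cauchy-Schwarz gives one factor \<open>card J\<close>; the other appears because each of
  the \<open>card J\<close> translated sums over \<open>v\<close> equals the untranslated
  one.\<close>

lemma wmean_power2_sum_shift:
  assumes N: "N > 0" and \<mu>: "\<And>\<eta>. \<eta> \<in> S \<Longrightarrow> 0 \<le> \<mu> \<eta>"
  shows "(\<Sum>v\<in>torus N. wmean S \<mu> (\<lambda>\<eta>. (\<Sum>j\<in>J. u (torus_add N v (z j)) \<eta>)\<^sup>2))
       \<le> (real (card J))\<^sup>2 * (\<Sum>v\<in>torus N. wmean S \<mu> (\<lambda>\<eta>. (u v \<eta>)\<^sup>2))"
proof -
  have "(\<Sum>v\<in>torus N. wmean S \<mu> (\<lambda>\<eta>. (\<Sum>j\<in>J. u (torus_add N v (z j)) \<eta>)\<^sup>2))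
     \<le> (\<Sum>v\<in>torus N. wmean S \<mu> (\<lambda>\<eta>. real (card J) * (\<Sum>j\<in>J. (u (torus_add N v (z j)) \<eta>)\<^sup>2)))"
    by (intro sum_mono wmean_mono \<mu> sum_power2_le_card)
  also have "\<dots> = real (card J) * (\<Sum>v\<in>torus N. \<Sum>j\<in>J. wmean S \<mu> (\<lambda>\<eta>. (u (torus_add N v (z j)) \<eta>)\<^sup>2))"
    by (simp add: wmean_cmult wmean_sum sum_distrib_left)
  also have "\<dots> = real (card J) * (\<Sum>j\<in>J. \<Sum>v\<in>torus N. wmean S \<mu> (\<lambda>\<eta>. (u (torus_add N v (z j)) \<eta>)\<^sup>2))"
    by (subst sum.swap) simp
  also have "\<dots> = real (card J) * (\<Sum>j\<in>J. \<Sum>v\<in>torus N. wmean S \<mu> (\<lambda>\<eta>. (u v \<eta>)\<^sup>2))"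
    by (subst sum_torus_shift[OF N, where g = "\<lambda>v. wmean S \<mu> (\<lambda>\<eta>. (u v \<eta>)\<^sup>2)"]) simp
  finally show ?thesis by (simp add: power2_eq_square)
qed

text \<open>Only pairs of indices with the same site survive in the expanded square.
  \<open>M\<close> bounds how often one site is hit: the index set will later consist of steps of
  lattice paths, which meet a site repeatedly.\<close>

lemma wmean_power2_sum_orthogonal:
  assumes J: "finite J" and T: "\<And>j. j \<in> J \<Longrightarrow> t j \<in> T"
    and orth: "\<And>x y. x \<in> T \<Longrightarrow> y \<in> T \<Longrightarrow> x \<noteq> y \<Longrightarrow> wmean S \<mu> (\<lambda>\<eta>. u x \<eta> * u y \<eta>) = 0"
    and B: "\<And>x. x \<in> T \<Longrightarrow> wmean S \<mu> (\<lambda>\<eta>. (u x \<eta>)\<^sup>2) \<le> B" "0 \<le> B"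
    and mult: "\<And>j. j \<in> J \<Longrightarrow> card {j' \<in> J. t j' = t j} \<le> M"
  shows "wmean S \<mu> (\<lambda>\<eta>. (\<Sum>j\<in>J. u (t j) \<eta>)\<^sup>2) \<le> real (card J) * (real M * B)"
proof -
  have "wmean S \<mu> (\<lambda>\<eta>. (\<Sum>j\<in>J. u (t j) \<eta>)\<^sup>2) = (\<Sum>j\<in>J. \<Sum>j'\<in>J. wmean S \<mu> (\<lambda>\<eta>. u (t j) \<eta> * u (t j') \<eta>))"
    by (simp add: power2_eq_square sum_product wmean_sum)
  also have "\<dots> \<le> (\<Sum>j\<in>J. real M * B)"
  proof (rule sum_mono)
    fix j assume j: "j \<in> J"
    have "(\<Sum>j'\<in>J. wmean S \<mu> (\<lambda>\<eta>. u (t j) \<eta> * u (t j') \<eta>))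
        = (\<Sum>j'\<in>{j' \<in> J. t j' = t j}. wmean S \<mu> (\<lambda>\<eta>. (u (t j) \<eta>)\<^sup>2))"
      by (rule sum.mono_neutral_cong_right) (use J T[OF j] T in \<open>auto simp: power2_eq_square intro!: orth\<close>)
    also have "\<dots> = real (card {j' \<in> J. t j' = t j}) * wmean S \<mu> (\<lambda>\<eta>. (u (t j) \<eta>)\<^sup>2)" by simp
    also have "\<dots> \<le> real (card {j' \<in> J. t j' = t j}) * B" using B(1)[OF T[OF j]] by (rule mult_left_mono) simp
    also have "\<dots> \<le> real M * B" using mult[OF j] B(2) by (intro mult_right_mono) auto
    finally show "(\<Sum>j'\<in>J. wmean S \<mu> (\<lambda>\<eta>. u (t j) \<eta> * u (t j') \<eta>)) \<le> real M * B" .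
  qed
  finally show ?thesis by simp
qed

text \<open>\<open>h\<close> stands for a multiple of the relative entropy and \<open>B\<close> for
  a bound on the variance of one martingale difference. In the bounds below the predictable part
  \<open>m\<close> is paid by \<open>h\<close> through Cauchy-Schwarz or Young, and the differences
  by \<open>B\<close> through orthogonality.\<close>

locale decomposed_field =
  fixes N :: nat and S :: "'c set" and \<mu> :: "'c \<Rightarrow> real"
    and \<omega> m :: "'d::finite site \<Rightarrow> 'c \<Rightarrow> real" and h B :: real
  assumes N: "N > 0"
    and \<mu>_nonneg: "\<And>\<eta>. \<eta> \<in> S \<Longrightarrow> 0 \<le> \<mu> \<eta>" and \<mu>_prob: "(\<Sum>\<eta>\<in>S. \<mu> \<eta>) = 1"
    and m_sq: "(\<Sum>x\<in>torus N. wmean S \<mu> (\<lambda>\<eta>. (m x \<eta>)\<^sup>2)) \<le> h"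
    and mean0: "\<And>x. x \<in> torus N \<Longrightarrow> wmean S \<mu> (\<lambda>\<eta>. \<omega> x \<eta> - m x \<eta>) = 0"
    and orth: "\<And>x y. x \<in> torus N \<Longrightarrow> y \<in> torus N \<Longrightarrow> x \<noteq> y \<Longrightarrow>
       wmean S \<mu> (\<lambda>\<eta>. (\<omega> x \<eta> - m x \<eta>) * (\<omega> y \<eta> - m y \<eta>)) = 0"
    and d_sq: "\<And>x. x \<in> torus N \<Longrightarrow> wmean S \<mu> (\<lambda>\<eta>. (\<omega> x \<eta> - m x \<eta>)\<^sup>2) \<le> B"
begin

lemma h_nonneg: "0 \<le> h"
  using m_sq by (rule order_trans[rotated]) (intro sum_nonneg wmean_nonneg \<mu>_nonneg; simp)

lemma B_nonneg: "0 \<le> B"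
proof -
  have "(0 :: 'd site) \<in> torus N" using N by (auto simp: torus_def)
  from d_sq[OF this] show ?thesis by (rule order_trans[rotated]) (intro wmean_nonneg \<mu>_nonneg; simp)
qed

text \<open>The differences have mean zero, so only \<open>m\<close> is left, and Young's inequality
  separates it from the coefficients.\<close>

lemma linear_bound:
  "wmean S \<mu> (\<lambda>\<eta>. \<Sum>x\<in>torus N. a x * \<omega> x \<eta>) \<le> h / 2 + (\<Sum>x\<in>torus N. (a x)\<^sup>2) / 2"
proof -
  have "wmean S \<mu> (\<lambda>\<eta>. \<Sum>x\<in>torus N. a x * \<omega> x \<eta>) = (\<Sum>x\<in>torus N. a x * wmean S \<mu> (m x))"
    using mean0 by (simp add: wmean_sum wmean_cmult wmean_diff)
  also have "\<dots> = (\<Sum>x\<in>torus N. wmean S \<mu> (\<lambda>\<eta>. a x * m x \<eta>))" by (simp add: wmean_cmult)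
  also have "\<dots> \<le> (\<Sum>x\<in>torus N. wmean S \<mu> (\<lambda>\<eta>. (1/2) * (m x \<eta>)\<^sup>2 + (a x)\<^sup>2 / 2))"
  proof (intro sum_mono wmean_mono \<mu>_nonneg)
    fix x \<eta>
    have "0 \<le> (a x - m x \<eta>)\<^sup>2" by simp
    thus "a x * m x \<eta> \<le> (1/2) * (m x \<eta>)\<^sup>2 + (a x)\<^sup>2 / 2" by (simp add: power2_eq_square algebra_simps)
  qed
  also have "\<dots> = (\<Sum>x\<in>torus N. wmean S \<mu> (\<lambda>\<eta>. (m x \<eta>)\<^sup>2)) / 2 + (\<Sum>x\<in>torus N. (a x)\<^sup>2) / 2"
    unfolding wmean_add wmean_cmult wmean_const[OF \<mu>_prob] sum.distrib
    by (simp add: sum_divide_distrib)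
  also have "\<dots> \<le> h / 2 + (\<Sum>x\<in>torus N. (a x)\<^sup>2) / 2" using m_sq by simp
  finally show ?thesis .
qed

lemma orthogonal_bound:
  assumes J: "finite J" and A: "\<And>x. x \<in> torus N \<Longrightarrow> \<bar>a x\<bar> \<le> A"
    and mult: "\<And>j. j \<in> J \<Longrightarrow> card {j' \<in> J. torus_add N v (z j') = torus_add N v (z j)} \<le> M"
  shows "wmean S \<mu> (\<lambda>\<eta>. (\<Sum>j\<in>J. a (torus_add N v (z j)) * (\<omega> (torus_add N v (z j)) \<eta> - m (torus_add N v (z j)) \<eta>))\<^sup>2)
       \<le> real (card J) * (real M * (A\<^sup>2 * B))"
proof (rule wmean_power2_sum_orthogonal[where T = "torus N" and t = "\<lambda>j. torus_add N v (z j)" and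
    u = "\<lambda>x \<eta>. a x * (\<omega> x \<eta> - m x \<eta>)", OF J])
  show "torus_add N v (z j) \<in> torus N" for j using N by simp
  show "0 \<le> A\<^sup>2 * B" using B_nonneg by simp
  show "card {j' \<in> J. torus_add N v (z j') = torus_add N v (z j)} \<le> M" if "j \<in> J" for j using mult[OF that] .
  fix x :: "'d site" assume x: "x \<in> torus N"
  have "wmean S \<mu> (\<lambda>\<eta>. (a x * (\<omega> x \<eta> - m x \<eta>))\<^sup>2) = (a x)\<^sup>2 * wmean S \<mu> (\<lambda>\<eta>. (\<omega> x \<eta> - m x \<eta>)\<^sup>2)"
    by (simp add: power_mult_distrib wmean_cmult)
  also have "\<dots> \<le> A\<^sup>2 * B"
    using A[OF x] d_sq[OF x] B_nonneg
    by (intro mult_mono wmean_nonneg \<mu>_nonneg) (auto simp flip: abs_le_square_iff)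
  finally show "wmean S \<mu> (\<lambda>\<eta>. (a x * (\<omega> x \<eta> - m x \<eta>))\<^sup>2) \<le> A\<^sup>2 * B" .
  fix y assume y: "y \<in> torus N" "x \<noteq> y"
  have "wmean S \<mu> (\<lambda>\<eta>. a x * (\<omega> x \<eta> - m x \<eta>) * (a y * (\<omega> y \<eta> - m y \<eta>)))
    = wmean S \<mu> (\<lambda>\<eta>. (a x * a y) * ((\<omega> x \<eta> - m x \<eta>) * (\<omega> y \<eta> - m y \<eta>)))" by (simp add: mult_ac)
  also have "\<dots> = 0" unfolding wmean_cmult orth[OF x y] by simp
  finally show "wmean S \<mu> (\<lambda>\<eta>. a x * (\<omega> x \<eta> - m x \<eta>) * (a y * (\<omega> y \<eta> - m y \<eta>))) = 0" .
qed

text \<open>Splitting \<omega> into \<open>m\<close> and its difference gives two costs: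
  \<open>card J\<close> squared for the first part by Cauchy-Schwarz, but only
  \<open>card J * M\<close> per site for the orthogonal part. The gap between the two factors is the
  gain of averaging.\<close>

lemma square_bound:
  assumes J: "finite J" and A: "\<And>x. x \<in> torus N \<Longrightarrow> \<bar>a x\<bar> \<le> A"
    and mult: "\<And>v j. v \<in> torus N \<Longrightarrow> j \<in> J \<Longrightarrow> card {j' \<in> J. torus_add N v (z j') = torus_add N v (z j)} \<le> M"
  shows "(\<Sum>v\<in>torus N. wmean S \<mu> (\<lambda>\<eta>. (\<Sum>j\<in>J. a (torus_add N v (z j)) * \<omega> (torus_add N v (z j)) \<eta>)\<^sup>2))
     \<le> 2 * A\<^sup>2 * (real (card J))\<^sup>2 * h + 2 * A\<^sup>2 * real (card J) * real M * B * real (card (torus N :: 'd site set))"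
proof -
  let ?p = "\<lambda>v j. torus_add N v (z j)"
  let ?X = "\<lambda>v \<eta>. \<Sum>j\<in>J. a (?p v j) * m (?p v j) \<eta>"
  let ?Y = "\<lambda>v \<eta>. \<Sum>j\<in>J. a (?p v j) * (\<omega> (?p v j) \<eta> - m (?p v j) \<eta>)"
  have "wmean S \<mu> (\<lambda>\<eta>. (\<Sum>j\<in>J. a (?p v j) * \<omega> (?p v j) \<eta>)\<^sup>2)
     \<le> wmean S \<mu> (\<lambda>\<eta>. 2 * (?X v \<eta>)\<^sup>2 + 2 * (?Y v \<eta>)\<^sup>2)" for v
  proof (intro wmean_mono \<mu>_nonneg)
    fix \<eta>
    have "(\<Sum>j\<in>J. a (?p v j) * \<omega> (?p v j) \<eta>) = ?X v \<eta> + ?Y v \<eta>"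
      by (simp add: algebra_simps flip: sum.distrib)
    moreover have "(s + t)\<^sup>2 \<le> 2 * s\<^sup>2 + 2 * t\<^sup>2" for s t :: real
      using zero_le_power2[of "s - t"] by (simp add: power2_eq_square algebra_simps)
    ultimately show "(\<Sum>j\<in>J. a (?p v j) * \<omega> (?p v j) \<eta>)\<^sup>2 \<le> 2 * (?X v \<eta>)\<^sup>2 + 2 * (?Y v \<eta>)\<^sup>2" by simp
  qed
  hence "(\<Sum>v\<in>torus N. wmean S \<mu> (\<lambda>\<eta>. (\<Sum>j\<in>J. a (?p v j) * \<omega> (?p v j) \<eta>)\<^sup>2))
     \<le> (\<Sum>v\<in>torus N. 2 * wmean S \<mu> (\<lambda>\<eta>. (?X v \<eta>)\<^sup>2) + 2 * wmean S \<mu> (\<lambda>\<eta>. (?Y v \<eta>)\<^sup>2))"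
    by (intro sum_mono) (simp add: wmean_add wmean_cmult)
  also have "\<dots> = 2 * (\<Sum>v\<in>torus N. wmean S \<mu> (\<lambda>\<eta>. (?X v \<eta>)\<^sup>2)) + 2 * (\<Sum>v\<in>torus N. wmean S \<mu> (\<lambda>\<eta>. (?Y v \<eta>)\<^sup>2))"
    by (simp add: sum.distrib sum_distrib_left)
  also have "\<dots> \<le> 2 * ((real (card J))\<^sup>2 * (A\<^sup>2 * h)) + 2 * (\<Sum>v\<in>(torus N :: 'd site set). real (card J) * (real M * (A\<^sup>2 * B)))"
  proof (intro add_mono mult_left_mono)
    have "(\<Sum>v\<in>torus N. wmean S \<mu> (\<lambda>\<eta>. (?X v \<eta>)\<^sup>2))
        \<le> (real (card J))\<^sup>2 * (\<Sum>v\<in>torus N. wmean S \<mu> (\<lambda>\<eta>. (a v * m v \<eta>)\<^sup>2))"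
      by (rule wmean_power2_sum_shift[OF N \<mu>_nonneg])
    also have "(\<Sum>v\<in>torus N. wmean S \<mu> (\<lambda>\<eta>. (a v * m v \<eta>)\<^sup>2)) \<le> (\<Sum>v\<in>torus N. A\<^sup>2 * wmean S \<mu> (\<lambda>\<eta>. (m v \<eta>)\<^sup>2))"
      unfolding power_mult_distrib wmean_cmult using A[THEN order_trans[OF _ abs_ge_self]]
      by (intro sum_mono mult_right_mono wmean_nonneg \<mu>_nonneg) (auto simp flip: abs_le_square_iff)
    also have "\<dots> \<le> A\<^sup>2 * h" unfolding sum_distrib_left[symmetric] using m_sq by (intro mult_left_mono) auto
    finally show "(\<Sum>v\<in>torus N. wmean S \<mu> (\<lambda>\<eta>. (?X v \<eta>)\<^sup>2)) \<le> (real (card J))\<^sup>2 * (A\<^sup>2 * h)"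
      by (simp add: mult_left_mono)
    show "(\<Sum>v\<in>torus N. wmean S \<mu> (\<lambda>\<eta>. (?Y v \<eta>)\<^sup>2)) \<le> (\<Sum>v\<in>(torus N :: 'd site set). real (card J) * (real M * (A\<^sup>2 * B)))"
      by (intro sum_mono orthogonal_bound J A mult)
  qed auto
  finally show ?thesis by (simp add: algebra_simps)
qed

text \<open>Inserting \<omega> = m + d in both factors leaves three sums. The products of two d's
  have mean zero because \<open>Q0\<close> excludes the diagonal. The other two sums carry a factor
  \<open>m\<close>, paid by \<open>h\<close>; a mean of d's over \<open>Q\<close> has variance of
  order \<open>B / card Q\<close>, because \<open>inj\<close> keeps the translates distinct on the
  torus.\<close>

lemma quadratic_bound:
  assumes Q: "finite Q" "Q \<noteq> {}" and A: "\<And>x. x \<in> torus N \<Longrightarrow> \<bar>a x\<bar> \<le> A"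
    and Q0: "\<And>x z. x \<in> torus N \<Longrightarrow> z \<in> Q \<Longrightarrow> torus_add N x z \<noteq> x"
    and inj: "\<And>z z'. z \<in> Q \<Longrightarrow> z' \<in> Q \<Longrightarrow> (\<forall>i. int N dvd (z $ i - z' $ i)) \<Longrightarrow> z = z'"
  shows "wmean S \<mu> (\<lambda>\<eta>. \<Sum>x\<in>torus N. a x * \<omega> x \<eta> * ((\<Sum>z\<in>Q. \<omega> (torus_add N x z) \<eta>) / real (card Q)))
     \<le> (1 + A\<^sup>2) * h + 2 * A\<^sup>2 * B * real (card (torus N :: 'd site set)) / real (card Q)"
proof -
  let ?q = "real (card Q)" and ?n = "real (card (torus N :: 'd site set))"
  have q: "?q > 0" using Q by (simp add: card_gt_0_iff)
  have young: "s * t \<le> s\<^sup>2 / 2 + t\<^sup>2 / 2" for s t :: real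
    using zero_le_power2[of "s - t"] by (simp add: power2_eq_square algebra_simps)
  let ?d = "\<lambda>x \<eta>. \<omega> x \<eta> - m x \<eta>"
  have card1: "card {z' \<in> Q. torus_add N v z' = torus_add N v z} \<le> 1" if "z \<in> Q" for v z
  proof -
    have "{z' \<in> Q. torus_add N v z' = torus_add N v z} = {z}"
      using inj that by (auto simp: torus_add_eq_iff[OF N])
    thus ?thesis by simp
  qed
  have card1': "card {z' \<in> Q. torus_add N v (- z') = torus_add N v (- z)} \<le> 1" if "z \<in> Q" for v z
  proof -
    have "{z' \<in> Q. torus_add N v (- z') = torus_add N v (- z)} = {z}"
      using inj that by (auto simp: torus_add_eq_iff[OF N] dvd_diff_commute)
    thus ?thesis by simp
  qed
  have "wmean S \<mu> (\<lambda>\<eta>. \<Sum>x\<in>torus N. m x \<eta> * (a x * ((\<Sum>z\<in>Q. \<omega> (torus_add N x z) \<eta>) / ?q)))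
     \<le> (\<Sum>x\<in>torus N. wmean S \<mu> (\<lambda>\<eta>. (1/2) * (m x \<eta>)\<^sup>2 + A\<^sup>2 / (2 * ?q\<^sup>2) * (\<Sum>z\<in>Q. 1 * \<omega> (torus_add N x z) \<eta>)\<^sup>2))"
    unfolding wmean_sum
  proof (intro sum_mono wmean_mono \<mu>_nonneg)
    fix x :: "'d site" and \<eta> assume x: "x \<in> torus N"
    let ?s = "\<Sum>z\<in>Q. \<omega> (torus_add N x z) \<eta>"
    have "(a x)\<^sup>2 \<le> A\<^sup>2" using A[OF x] by (auto simp flip: abs_le_square_iff)
    hence "(a x * (?s / ?q))\<^sup>2 \<le> A\<^sup>2 * (?s / ?q)\<^sup>2" unfolding power_mult_distrib by (rule mult_right_mono) simp
    with young[of "m x \<eta>" "a x * (?s / ?q)"]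
    show "m x \<eta> * (a x * (?s / ?q)) \<le> (1/2) * (m x \<eta>)\<^sup>2 + A\<^sup>2 / (2 * ?q\<^sup>2) * (\<Sum>z\<in>Q. 1 * \<omega> (torus_add N x z) \<eta>)\<^sup>2"
      by (simp add: power_divide)
  qed
  also have "\<dots> = (1/2) * (\<Sum>x\<in>torus N. wmean S \<mu> (\<lambda>\<eta>. (m x \<eta>)\<^sup>2)) + A\<^sup>2 / (2 * ?q\<^sup>2) *
      (\<Sum>x\<in>torus N. wmean S \<mu> (\<lambda>\<eta>. (\<Sum>z\<in>Q. 1 * \<omega> (torus_add N x z) \<eta>)\<^sup>2))"
    by (simp only: wmean_add wmean_cmult sum.distrib sum_distrib_left)
  also have "\<dots> \<le> (1/2) * h + A\<^sup>2 / (2 * ?q\<^sup>2) * (2 * 1\<^sup>2 * ?q\<^sup>2 * h + 2 * 1\<^sup>2 * ?q * real 1 * B * ?n)"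
    by (intro add_mono mult_left_mono m_sq square_bound[where a = "\<lambda>_. 1" and z = "\<lambda>z. z"] Q card1) auto
  also have "\<dots> = h / 2 + A\<^sup>2 * h + A\<^sup>2 * B * ?n / ?q" using q by (simp add: field_simps power2_eq_square)
  finally have T1: "wmean S \<mu> (\<lambda>\<eta>. \<Sum>x\<in>torus N. m x \<eta> * (a x * ((\<Sum>z\<in>Q. \<omega> (torus_add N x z) \<eta>) / ?q)))
     \<le> h / 2 + A\<^sup>2 * h + A\<^sup>2 * B * ?n / ?q" .
  \<comment> \<open>Here the mean over \<open>Q\<close> sits on \<open>m\<close>; the substitution y
    = x + z moves it to the differences, where orthogonality can exploit it.\<close>
  have "wmean S \<mu> (\<lambda>\<eta>. \<Sum>x\<in>torus N. a x * ?d x \<eta> * ((\<Sum>z\<in>Q. m (torus_add N x z) \<eta>) / ?q))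
      = wmean S \<mu> (\<lambda>\<eta>. \<Sum>y\<in>torus N. m y \<eta> * ((\<Sum>z\<in>Q. a (torus_add N y (- z)) * ?d (torus_add N y (- z)) \<eta>) / ?q))"
  proof (rule wmean_cong)
    fix \<eta>
    have "(\<Sum>x\<in>torus N. a x * ?d x \<eta> * ((\<Sum>z\<in>Q. m (torus_add N x z) \<eta>) / ?q))
       = (\<Sum>z\<in>Q. \<Sum>x\<in>torus N. a x * ?d x \<eta> * m (torus_add N x z) \<eta> / ?q)"
      by (subst sum.swap) (simp add: sum_distrib_left sum_divide_distrib)
    also have "\<dots> = (\<Sum>z\<in>Q. \<Sum>y\<in>torus N. a (torus_add N y (- z)) * ?d (torus_add N y (- z)) \<eta> * m y \<eta> / ?q)"
    proof (rule sum.cong[OF refl])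
      fix z
      show "(\<Sum>x\<in>torus N. a x * ?d x \<eta> * m (torus_add N x z) \<eta> / ?q)
        = (\<Sum>y\<in>torus N. a (torus_add N y (- z)) * ?d (torus_add N y (- z)) \<eta> * m y \<eta> / ?q)"
        by (subst sum_torus_shift[OF N, where z = "z", symmetric])
           (auto simp: torus_add_assoc intro!: sum.cong)
    qed
    also have "\<dots> = (\<Sum>y\<in>torus N. m y \<eta> * ((\<Sum>z\<in>Q. a (torus_add N y (- z)) * ?d (torus_add N y (- z)) \<eta>) / ?q))"
      by (subst sum.swap) (simp add: sum_distrib_left sum_divide_distrib mult_ac)
    finally show "(\<Sum>x\<in>torus N. a x * ?d x \<eta> * ((\<Sum>z\<in>Q. m (torus_add N x z) \<eta>) / ?q)) = \<dots>" .
  qed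
  also have "\<dots> \<le> (\<Sum>y\<in>torus N. wmean S \<mu> (\<lambda>\<eta>. (1/2) * (m y \<eta>)\<^sup>2 + 1 / (2 * ?q\<^sup>2) * (\<Sum>z\<in>Q. a (torus_add N y (- z)) * ?d (torus_add N y (- z)) \<eta>)\<^sup>2))"
    unfolding wmean_sum
  proof (intro sum_mono wmean_mono \<mu>_nonneg)
    fix y \<eta>
    show "m y \<eta> * ((\<Sum>z\<in>Q. a (torus_add N y (- z)) * ?d (torus_add N y (- z)) \<eta>) / ?q) \<le>
      (1/2) * (m y \<eta>)\<^sup>2 + 1 / (2 * ?q\<^sup>2) * (\<Sum>z\<in>Q. a (torus_add N y (- z)) * ?d (torus_add N y (- z)) \<eta>)\<^sup>2"
      using young[of "m y \<eta>" "(\<Sum>z\<in>Q. a (torus_add N y (- z)) * ?d (torus_add N y (- z)) \<eta>) / ?q"]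
      by (simp add: power_divide)
  qed
  also have "\<dots> = (1/2) * (\<Sum>x\<in>torus N. wmean S \<mu> (\<lambda>\<eta>. (m x \<eta>)\<^sup>2)) + 1 / (2 * ?q\<^sup>2) *
      (\<Sum>y\<in>torus N. wmean S \<mu> (\<lambda>\<eta>. (\<Sum>z\<in>Q. a (torus_add N y (- z)) * ?d (torus_add N y (- z)) \<eta>)\<^sup>2))"
    by (simp only: wmean_add wmean_cmult sum.distrib sum_distrib_left)
  also have "\<dots> \<le> (1/2) * h + 1 / (2 * ?q\<^sup>2) * (\<Sum>y\<in>(torus N :: 'd site set). ?q * (real 1 * (A\<^sup>2 * B)))"
    by (intro add_mono mult_left_mono m_sq sum_mono orthogonal_bound[where z = "\<lambda>z. - z"] Q card1' A) auto
  also have "\<dots> = h / 2 + A\<^sup>2 * B * ?n / ?q / 2" using q by (simp add: field_simps power2_eq_square)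
  finally have T2: "wmean S \<mu> (\<lambda>\<eta>. \<Sum>x\<in>torus N. a x * ?d x \<eta> * ((\<Sum>z\<in>Q. m (torus_add N x z) \<eta>) / ?q))
     \<le> h / 2 + A\<^sup>2 * B * ?n / ?q / 2" .
  have T3: "wmean S \<mu> (\<lambda>\<eta>. \<Sum>x\<in>torus N. \<Sum>z\<in>Q. a x / ?q * (?d x \<eta> * ?d (torus_add N x z) \<eta>)) = 0"
    unfolding wmean_sum wmean_cmult
  proof (intro sum.neutral ballI)
    fix x :: "'d site" and z assume "x \<in> torus N" "z \<in> Q"
    thus "a x / ?q * wmean S \<mu> (\<lambda>\<eta>. ?d x \<eta> * ?d (torus_add N x z) \<eta>) = 0"
      using orth[of x "torus_add N x z"] N Q0[of x z] by simp
  qed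
  have "wmean S \<mu> (\<lambda>\<eta>. \<Sum>x\<in>torus N. a x * \<omega> x \<eta> * ((\<Sum>z\<in>Q. \<omega> (torus_add N x z) \<eta>) / ?q))
     = wmean S \<mu> (\<lambda>\<eta>. (\<Sum>x\<in>torus N. m x \<eta> * (a x * ((\<Sum>z\<in>Q. \<omega> (torus_add N x z) \<eta>) / ?q)))
       + (\<Sum>x\<in>torus N. a x * ?d x \<eta> * ((\<Sum>z\<in>Q. m (torus_add N x z) \<eta>) / ?q))
       + (\<Sum>x\<in>torus N. \<Sum>z\<in>Q. a x / ?q * (?d x \<eta> * ?d (torus_add N x z) \<eta>)))"
  proof (rule wmean_cong)
    fix \<eta>
    have "(\<Sum>z\<in>Q. a x / ?q * (?d x \<eta> * ?d (torus_add N x z) \<eta>)) =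
        a x * ?d x \<eta> * ((\<Sum>z\<in>Q. ?d (torus_add N x z) \<eta>) / ?q)" for x
      by (simp add: sum_distrib_left sum_divide_distrib mult.assoc)
    thus "(\<Sum>x\<in>torus N. a x * \<omega> x \<eta> * ((\<Sum>z\<in>Q. \<omega> (torus_add N x z) \<eta>) / ?q))
     = (\<Sum>x\<in>torus N. m x \<eta> * (a x * ((\<Sum>z\<in>Q. \<omega> (torus_add N x z) \<eta>) / ?q)))
       + (\<Sum>x\<in>torus N. a x * ?d x \<eta> * ((\<Sum>z\<in>Q. m (torus_add N x z) \<eta>) / ?q))
       + (\<Sum>x\<in>torus N. \<Sum>z\<in>Q. a x / ?q * (?d x \<eta> * ?d (torus_add N x z) \<eta>))"
      by (simp add: sum_subtractf diff_divide_distrib algebra_simps flip: sum.distrib)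
  qed
  also have "\<dots> \<le> (h / 2 + A\<^sup>2 * h + A\<^sup>2 * B * ?n / ?q) + (h / 2 + A\<^sup>2 * B * ?n / ?q / 2) + 0"
    unfolding wmean_add by (intro add_mono T1 T2) (rule eq_refl[OF T3])
  also have "\<dots> \<le> (1 + A\<^sup>2) * h + 2 * A\<^sup>2 * B * ?n / ?q"
  proof -
    define Y where "Y = A\<^sup>2 * B * ?n / ?q"
    have "0 \<le> Y" using B_nonneg by (simp add: Y_def)
    moreover have "(1 + A\<^sup>2) * h = h + A\<^sup>2 * h" by (simp add: algebra_simps)
    moreover have "2 * A\<^sup>2 * B * ?n / ?q = 2 * Y" by (simp add: Y_def)
    ultimately show ?thesis unfolding Y_def[symmetric] by simp
  qed
  finally show ?thesis .
qed

end

subsection \<open>Change of variables and integration by parts\<close>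

lemma sum_UNIV_Plus:
  fixes g :: "'a::finite + 'b::finite \<Rightarrow> 'c::comm_monoid_add"
  shows "(\<Sum>i\<in>UNIV. g i) = (\<Sum>i\<in>UNIV. g (Inl i)) + (\<Sum>i\<in>UNIV. g (Inr i))"
  unfolding UNIV_Plus_UNIV[symmetric] by (subst sum.Plus) auto

lemma move_apply: "x \<noteq> y \<Longrightarrow> move \<eta> x y z = (if z = x then \<eta> x - 1 else if z = y then \<eta> y + 1 else \<eta> z)"
  by (simp add: move_def Let_def)

lemma move_move: "x \<noteq> y \<Longrightarrow> \<eta> x > 0 \<Longrightarrow> move (move \<eta> x y) y x = \<eta>"
  by (auto simp: move_def Let_def fun_eq_iff)

text \<open>The binomial weight with mean \<open>r x\<close>. As a Bernstein polynomial it has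
  explicit moments and an explicit derivative in \<open>r x\<close>.\<close>

definition site_weight :: "nat \<Rightarrow> ('s \<Rightarrow> real) \<Rightarrow> 's \<Rightarrow> nat \<Rightarrow> real" where
  "site_weight K r x k = Bernstein K k (r x / real K)"

text \<open>\<open>ratio\<close> confines to the interval from 1/2 to 2 the factor by which the
  product measure fails to be reversible on a bond. A profile close to a constant satisfies
  it.\<close>

locale lattice_gas =
  fixes K N :: nat and r :: "'d::finite site \<Rightarrow> real"
  assumes K: "K > 0" and N: "N > 1"
    and r_pos: "\<And>x. x \<in> torus N \<Longrightarrow> 0 < r x" and r_less: "\<And>x. x \<in> torus N \<Longrightarrow> r x < real K"
    and ratio: "\<And>x y. x \<in> torus N \<Longrightarrow> y \<in> torus N \<Longrightarrow> r x * (real K - r y) \<le> 2 * (r y * (real K - r x))"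
begin

sublocale finite_product "torus N" K "site_weight K r"
proof
  fix x :: "'d site" and k assume x: "x \<in> torus N"
  show "0 < site_weight K r x k" if "k \<le> K"
    using that r_pos[OF x] r_less[OF x] K by (simp add: site_weight_def Bernstein_def)
  show "(\<Sum>k\<le>K. site_weight K r x k) = 1" by (simp add: site_weight_def)
qed simp

lemma \<Omega>_eq: "\<Omega> = Config K N"
  by (simp add: \<Omega>_def Config_def)

text \<open>Up to the factor \<open>K\<close> this is the score of the binomial law: the derivative
  of \<open>ln (site_weight K r x k)\<close> in the mean \<open>r x\<close> is
  \<open>real K * om x k\<close>.\<close>

definition om :: "'d site \<Rightarrow> nat \<Rightarrow> real" where
  "om x k = (real k - r x) / (r x * (real K - r x))"

lemma om_centred: 
  assumes "x \<in> torus N"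
  shows "(\<Sum>k\<le>K. site_weight K r x k * om x k) = 0"
proof -
  have "(\<Sum>k\<le>K. site_weight K r x k * om x k)
     = (\<Sum>k\<le>K. (real k * Bernstein K k (r x / real K) - r x * Bernstein K k (r x / real K)) / (r x * (real K - r x)))"
    by (intro sum.cong refl) (simp add: om_def site_weight_def algebra_simps)
  also have "\<dots> = ((\<Sum>k\<le>K. real k * Bernstein K k (r x / real K)) - r x * (\<Sum>k\<le>K. Bernstein K k (r x / real K)))
        / (r x * (real K - r x))"
    by (simp only: sum_divide_distrib[symmetric] sum_subtractf sum_distrib_left)
  finally   show ?thesis using K by simp
qed

text \<open>Detailed balance of the birth and death chain on one site, with birth rate proportional
  to K - k and death rate proportional to k.\<close>

lemma site_weight_Suc:
  assumes "k < K"
  shows "site_weight K r x k * (real K - real k) * r x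
       = site_weight K r x (Suc k) * real (Suc k) * (real K - r x)"
proof -
  let ?q = "r x / real K"
  have ch: "real (K choose k) * (real K - real k) = real (K choose Suc k) * real (Suc k)"
  proof -
    have "Suc k * (K choose Suc k) = (K choose k) * (K - k)"
      using binomial_absorb_comp[of K k] binomial_absorption[of k K] assms
      by (metis Suc_times_binomial_eq add_diff_cancel_left' binomial_absorption mult.commute choose_mult_lemma Suc_times_binomial)
    hence "real (Suc k * (K choose Suc k)) = real ((K choose k) * (K - k))" by simp
    thus ?thesis using assms by (simp only: of_nat_mult) (simp add: of_nat_diff mult.commute)
  qed
  have e: "K - k = Suc (K - Suc k)" using assms by simp
  have "site_weight K r x k * (real K - real k) * r x =
      (real (K choose k) * (real K - real k)) * ?q ^ k * (1 - ?q) ^ (K - Suc k) * ((1 - ?q) * r x)"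
    unfolding site_weight_def Bernstein_def e by (simp add: mult_ac)
  also have "(1 - ?q) * r x = ?q * (real K - r x)" using K by (simp add: field_simps)
  finally show ?thesis unfolding ch site_weight_def Bernstein_def by (simp add: mult_ac)
qed

lemma move_in_\<Omega>:
  assumes "\<eta> \<in> \<Omega>" "x \<in> torus N" "y \<in> torus N" "x \<noteq> y" "\<eta> x > 0" "\<eta> y < K"
  shows "move \<eta> x y \<in> \<Omega>"
  using assms by (auto simp: \<Omega>_def PiE_dflt_def move_apply)

text \<open>Detailed balance for one particle crossing a bond, assembled from
  \<open>site_weight_Suc\<close> at the two ends. The two profile factors agree when r x = r y, so
  at constant density the symmetric exchange on a bond is reversible.\<close>

lemma \<nu>_move:
  assumes \<eta>: "\<eta> \<in> \<Omega>" and xy: "x \<in> torus N" "y \<in> torus N" "x \<noteq> y" and pos: "\<eta> x > 0" "\<eta> y < K"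
  shows "\<nu> \<eta> * (real (\<eta> x) * (real K - real (\<eta> y))) * (r y * (real K - r x))
       = \<nu> (move \<eta> x y) * (real (move \<eta> x y y) * (real K - real (move \<eta> x y x))) * (r x * (real K - r y))"
proof -
  let ?w = "site_weight K r" and ?\<eta>' = "move \<eta> x y"
  have split: "\<nu> \<zeta> = ?w x (\<zeta> x) * (?w y (\<zeta> y) * (\<Prod>z\<in>torus N - {x} - {y}. ?w z (\<zeta> z)))" for \<zeta>
    unfolding \<nu>_def using xy by (simp add: prod.remove[of _ x] prod.remove[of _ y])
  have rest: "(\<Prod>z\<in>torus N - {x} - {y}. ?w z (?\<eta>' z)) = (\<Prod>z\<in>torus N - {x} - {y}. ?w z (\<eta> z))"
    using xy by (intro prod.cong) (auto simp: move_apply)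
  obtain k where k: "\<eta> x = Suc k" using pos by (cases "\<eta> x") auto
  have kK: "k < K" using \<Omega>_le[OF \<eta>, of x] k by simp
  have a: "?w x (\<eta> x) * real (\<eta> x) * (real K - r x) = ?w x (?\<eta>' x) * (real K - real (?\<eta>' x)) * r x"
    using site_weight_Suc[OF kK, of x] xy k by (simp add: move_apply)
  have b: "?w y (\<eta> y) * (real K - real (\<eta> y)) * r y = ?w y (?\<eta>' y) * real (?\<eta>' y) * (real K - r y)"
    using site_weight_Suc[OF pos(2), of y] xy by (simp add: move_apply)
  let ?P = "\<Prod>z\<in>torus N - {x} - {y}. ?w z (\<eta> z)"
  have "\<nu> \<eta> * (real (\<eta> x) * (real K - real (\<eta> y))) * (r y * (real K - r x))
     = (?w x (\<eta> x) * real (\<eta> x) * (real K - r x)) * (?w y (\<eta> y) * (real K - real (\<eta> y)) * r y) * ?P"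
    by (subst split) (simp add: mult_ac)
  also have "\<dots> = \<nu> ?\<eta>' * (real (?\<eta>' y) * (real K - real (?\<eta>' x))) * (r x * (real K - r y))"
    unfolding a b by (subst split) (simp add: rest mult_ac)
  finally show ?thesis .
qed

section \<open>Jump rates, odds of a bond and the Dirichlet form\<close>

definition jump :: "'d site \<Rightarrow> 'd site \<Rightarrow> 'd config \<Rightarrow> real" where
  "jump x y \<eta> = real (\<eta> x) * (real K - real (\<eta> y))"

definition odds :: "'d site \<Rightarrow> 'd site \<Rightarrow> real" where
  "odds x y = (r x * (real K - r y)) / (r y * (real K - r x))"

lemma jump_nonneg: "\<eta> \<in> \<Omega> \<Longrightarrow> 0 \<le> jump x y \<eta>"
  using \<Omega>_le[of \<eta> y] by (simp add: jump_def)

lemma jump_le: "\<eta> \<in> \<Omega> \<Longrightarrow> jump x y \<eta> \<le> (real K)\<^sup>2"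
  unfolding jump_def power2_eq_square using \<Omega>_le[of \<eta>] by (intro mult_mono) auto

lemma jump_eq_0: "\<eta> \<in> \<Omega> \<Longrightarrow> \<not> (\<eta> x > 0 \<and> \<eta> y < K) \<Longrightarrow> jump x y \<eta> = 0"
  using \<Omega>_le[of \<eta> y] by (auto simp: jump_def)

lemma r_prod_pos: "x \<in> torus N \<Longrightarrow> y \<in> torus N \<Longrightarrow> 0 < r x * (real K - r y)"
  using r_pos r_less by simp

lemma odds_pos: "x \<in> torus N \<Longrightarrow> y \<in> torus N \<Longrightarrow> 0 < odds x y"
  using r_prod_pos by (simp add: odds_def)

lemma odds_le: "x \<in> torus N \<Longrightarrow> y \<in> torus N \<Longrightarrow> odds x y \<le> 2"
  using r_prod_pos[of y x] ratio[of x y] by (simp add: odds_def divide_le_eq)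

lemma odds_ge: "x \<in> torus N \<Longrightarrow> y \<in> torus N \<Longrightarrow> 1 / 2 \<le> odds x y"
  using r_prod_pos[of y x] ratio[of y x] by (simp add: odds_def le_divide_eq)

text \<open>The move from \<open>x\<close> to \<open>y\<close> is a bijection between the
  configurations that allow it and those that allow the reverse move; \<open>odds x y\<close> is the
  Jacobian supplied by \<open>\<nu>_move\<close>. Forbidden moves drop out because their rate
  vanishes.\<close>

lemma change_of_variables:
  assumes xy: "x \<in> torus N" "y \<in> torus N" "x \<noteq> y"
  shows "(\<Sum>\<eta>\<in>\<Omega>. \<nu> \<eta> * (jump x y \<eta> * G \<eta> (move \<eta> x y)))
       = (\<Sum>\<eta>\<in>\<Omega>. \<nu> \<eta> * (odds x y * jump y x \<eta> * G (move \<eta> y x) \<eta>))"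
proof -
  let ?A = "{\<eta> \<in> \<Omega>. \<eta> x > 0 \<and> \<eta> y < K}" and ?B = "{\<eta> \<in> \<Omega>. \<eta> y > 0 \<and> \<eta> x < K}"
  have "(\<Sum>\<eta>\<in>\<Omega>. \<nu> \<eta> * (jump x y \<eta> * G \<eta> (move \<eta> x y))) = (\<Sum>\<eta>\<in>?A. \<nu> \<eta> * (jump x y \<eta> * G \<eta> (move \<eta> x y)))"
    using finite_\<Omega> by (intro sum.mono_neutral_right) (auto simp: jump_eq_0)
  also have "\<dots> = (\<Sum>\<eta>\<in>?B. \<nu> \<eta> * (odds x y * jump y x \<eta> * G (move \<eta> y x) \<eta>))"
  proof (rule sum.reindex_bij_witness[where i = "\<lambda>\<eta>. move \<eta> y x" and j = "\<lambda>\<eta>. move \<eta> x y"])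
    fix \<eta> assume \<eta>: "\<eta> \<in> ?A"
    show "move (move \<eta> x y) y x = \<eta>" using xy \<eta> by (simp add: move_move)
    show "move \<eta> x y \<in> ?B" using \<eta> xy \<Omega>_le[of \<eta> x] by (auto simp: move_in_\<Omega>) (auto simp: move_apply)
    have "\<nu> \<eta> * jump x y \<eta> * (r y * (real K - r x)) = \<nu> (move \<eta> x y) * jump y x (move \<eta> x y) * (r x * (real K - r y))"
      unfolding jump_def using \<eta> xy by (intro \<nu>_move) auto
    hence "\<nu> \<eta> * jump x y \<eta> = \<nu> (move \<eta> x y) * jump y x (move \<eta> x y) * odds x y"
      using r_prod_pos[OF xy(2,1)] unfolding odds_def times_divide_eq_right
      by (metis nonzero_eq_divide_eq less_irrefl)
    thus "\<nu> (move \<eta> x y) * (odds x y * jump y x (move \<eta> x y) * G (move (move \<eta> x y) y x) (move \<eta> x y)) =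
         \<nu> \<eta> * (jump x y \<eta> * G \<eta> (move \<eta> x y))"
      using \<open>move (move \<eta> x y) y x = \<eta>\<close> by (simp add: mult_ac)
  next
    fix \<eta> assume \<eta>: "\<eta> \<in> ?B"
    show "move (move \<eta> y x) x y = \<eta>" using xy \<eta> by (simp add: move_move)
    show "move \<eta> y x \<in> ?A" using \<eta> xy \<Omega>_le[of \<eta> y] by (auto simp: move_in_\<Omega>) (auto simp: move_apply)
  qed
  also have "\<dots> = (\<Sum>\<eta>\<in>\<Omega>. \<nu> \<eta> * (odds x y * jump y x \<eta> * G (move \<eta> y x) \<eta>))"
    using finite_\<Omega> by (intro sum.mono_neutral_left) (auto simp: jump_eq_0)
  finally show ?thesis .
qed

text \<open>This identity is the reason for the normalisation of \<open>om\<close>: the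
  antisymmetric combination of the rates across a bond is a discrete gradient of \<open>om\<close>,
  up to a product that carries the small factor r x - r y.\<close>

lemma jump_antisym:
  assumes xy: "x \<in> torus N" "y \<in> torus N"
  shows "odds x y * jump y x \<eta> - jump x y \<eta>
       = real K * (r x * (real K - r y)) * (om y (\<eta> y) - om x (\<eta> x) - om x (\<eta> x) * om y (\<eta> y) * (r x - r y))"
proof -
  have "r x > 0" "r y > 0" "real K - r x > 0" "real K - r y > 0" using r_pos r_less xy by auto
  thus ?thesis unfolding odds_def jump_def om_def
    by (simp add: divide_simps) (simp add: algebra_simps)
qed

definition dirichlet :: "('d config \<Rightarrow> real) \<Rightarrow> 'd site \<Rightarrow> 'd site \<Rightarrow> real" where
  "dirichlet f x y = (\<Sum>\<eta>\<in>\<Omega>. \<nu> \<eta> * (jump x y \<eta> * (sqrt (f (move \<eta> x y)) - sqrt (f \<eta>))\<^sup>2))"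

lemma dirichlet_nonneg: "0 \<le> dirichlet f x y"
  unfolding dirichlet_def using \<nu>_pos jump_nonneg by (intro sum_nonneg mult_nonneg_nonneg) (auto simp: less_imp_le)

lemma dirichlet_swap:
  assumes "x \<in> torus N" "y \<in> torus N" "x \<noteq> y"
  shows "dirichlet f y x = odds y x * dirichlet f x y"
proof -
  have "dirichlet f y x = (\<Sum>\<eta>\<in>\<Omega>. \<nu> \<eta> * (odds y x * jump x y \<eta> * (sqrt (f \<eta>) - sqrt (f (move \<eta> x y)))\<^sup>2))"
    unfolding dirichlet_def
    using change_of_variables[of y x "\<lambda>\<eta> \<zeta>. (sqrt (f \<zeta>) - sqrt (f \<eta>))\<^sup>2"] assms by simp
  thus ?thesis by (simp add: dirichlet_def sum_distrib_left mult_ac power2_commute)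
qed

text \<open>Since \<open>g\<close> does not see the move, \<open>change_of_variables\<close> turns
  the antisymmetric rates into a difference of \<open>f\<close> along the move. This difference
  factors as (sqrt f' - sqrt f) (sqrt f' + sqrt f), and Young's inequality applies. The constant 3
  K^2 is 2 K^2 + K^2, one rate being weighted by odds of at most 2.\<close>

lemma integration_by_parts:
  assumes xy: "x \<in> torus N" "y \<in> torus N" "x \<noteq> y"
    and f: "\<And>\<eta>. \<eta> \<in> \<Omega> \<Longrightarrow> 0 \<le> f \<eta>" and g: "\<And>\<eta>. g (move \<eta> x y) = g \<eta>" "\<And>\<eta>. g (move \<eta> y x) = g \<eta>" and \<delta>: "\<delta> > 0"
  shows "wmean \<Omega> (\<lambda>\<eta>. \<nu> \<eta> * f \<eta>) (\<lambda>\<eta>. g \<eta> * (odds x y * jump y x \<eta> - jump x y \<eta>))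
       \<le> \<delta> * dirichlet f x y + 3 * (real K)\<^sup>2 / (2 * \<delta>) * wmean \<Omega> (\<lambda>\<eta>. \<nu> \<eta> * f \<eta>) (\<lambda>\<eta>. (g \<eta>)\<^sup>2)"
proof -
  have cv: "(\<Sum>\<eta>\<in>\<Omega>. \<nu> \<eta> * (jump x y \<eta> * (h \<eta> * f (move \<eta> x y))))
      = (\<Sum>\<eta>\<in>\<Omega>. \<nu> \<eta> * (odds x y * jump y x \<eta> * (h \<eta> * f \<eta>)))" if "\<And>\<eta>. h (move \<eta> y x) = h \<eta>" for h
    using change_of_variables[OF xy, of "\<lambda>\<eta> \<zeta>. h \<eta> * f \<zeta>"] that by simp
  have "wmean \<Omega> (\<lambda>\<eta>. \<nu> \<eta> * f \<eta>) (\<lambda>\<eta>. g \<eta> * (odds x y * jump y x \<eta> - jump x y \<eta>))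
     = (\<Sum>\<eta>\<in>\<Omega>. \<nu> \<eta> * (odds x y * jump y x \<eta> * (g \<eta> * f \<eta>))) - (\<Sum>\<eta>\<in>\<Omega>. \<nu> \<eta> * (jump x y \<eta> * (g \<eta> * f \<eta>)))"
    by (simp add: wmean_def algebra_simps flip: sum_subtractf)
  also have "\<dots> = (\<Sum>\<eta>\<in>\<Omega>. \<nu> \<eta> * (jump x y \<eta> * (g \<eta> * f (move \<eta> x y)))) - (\<Sum>\<eta>\<in>\<Omega>. \<nu> \<eta> * (jump x y \<eta> * (g \<eta> * f \<eta>)))"
    by (subst cv) (use g in auto)
  also have "\<dots> = (\<Sum>\<eta>\<in>\<Omega>. \<nu> \<eta> * (jump x y \<eta> * (g \<eta> * (f (move \<eta> x y) - f \<eta>))))"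
    by (simp add: algebra_simps flip: sum_subtractf)
  also have "\<dots> \<le> (\<Sum>\<eta>\<in>\<Omega>. \<nu> \<eta> * (jump x y \<eta> * (\<delta> * (sqrt (f (move \<eta> x y)) - sqrt (f \<eta>))\<^sup>2 + 1 / (2 * \<delta>) * ((g \<eta>)\<^sup>2 * (f (move \<eta> x y) + f \<eta>)))))"
  proof (rule sum_mono)
    fix \<eta> assume \<eta>: "\<eta> \<in> \<Omega>"
    show "\<nu> \<eta> * (jump x y \<eta> * (g \<eta> * (f (move \<eta> x y) - f \<eta>)))
      \<le> \<nu> \<eta> * (jump x y \<eta> * (\<delta> * (sqrt (f (move \<eta> x y)) - sqrt (f \<eta>))\<^sup>2 + 1 / (2 * \<delta>) * ((g \<eta>)\<^sup>2 * (f (move \<eta> x y) + f \<eta>))))"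
    proof (cases "\<eta> x > 0 \<and> \<eta> y < K")
      case True
      define a b where "a = sqrt (f \<eta>)" and "b = sqrt (f (move \<eta> x y))"
      have fa: "f \<eta> = a\<^sup>2" "f (move \<eta> x y) = b\<^sup>2" unfolding a_def b_def
        using f \<eta> move_in_\<Omega>[OF \<eta> xy] True by auto
      have sq: "sqrt (f \<eta>) = a" "sqrt (f (move \<eta> x y)) = b" by (simp_all add: a_def b_def)
      have "g \<eta> * (b\<^sup>2 - a\<^sup>2) \<le> \<delta> * (b - a)\<^sup>2 + 1 / (4 * \<delta>) * ((g \<eta>)\<^sup>2 * (b + a)\<^sup>2)"
      proof -
        have "0 \<le> (2 * \<delta> * (b - a) - g \<eta> * (b + a))\<^sup>2 / (4 * \<delta>)" using \<delta> by simp
        also have "\<dots> = \<delta> * (b - a)\<^sup>2 + 1 / (4 * \<delta>) * ((g \<eta>)\<^sup>2 * (b + a)\<^sup>2) - g \<eta> * (b\<^sup>2 - a\<^sup>2)"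
          using \<delta> by (simp add: field_simps power2_eq_square)
        finally show ?thesis by simp
      qed
      moreover have "1 / (4 * \<delta>) * ((g \<eta>)\<^sup>2 * (b + a)\<^sup>2) \<le> 1 / (4 * \<delta>) * ((g \<eta>)\<^sup>2 * (2 * (b\<^sup>2 + a\<^sup>2)))"
      proof (intro mult_left_mono)
        show "(b + a)\<^sup>2 \<le> 2 * (b\<^sup>2 + a\<^sup>2)"
          using zero_le_power2[of "b - a"] by (simp add: power2_eq_square algebra_simps)
      qed (use \<delta> in auto)
      ultimately have "g \<eta> * (b\<^sup>2 - a\<^sup>2) \<le> \<delta> * (b - a)\<^sup>2 + 1 / (4 * \<delta>) * ((g \<eta>)\<^sup>2 * (2 * (b\<^sup>2 + a\<^sup>2)))"
        by linarith
      moreover have "1 / (4 * \<delta>) * ((g \<eta>)\<^sup>2 * (2 * (b\<^sup>2 + a\<^sup>2))) = 1 / (2 * \<delta>) * ((g \<eta>)\<^sup>2 * (b\<^sup>2 + a\<^sup>2))"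
        using \<delta> by (simp add: divide_simps)
      ultimately have "g \<eta> * (f (move \<eta> x y) - f \<eta>) \<le> \<delta> * (sqrt (f (move \<eta> x y)) - sqrt (f \<eta>))\<^sup>2 + 1 / (2 * \<delta>) * ((g \<eta>)\<^sup>2 * (f (move \<eta> x y) + f \<eta>))"
        unfolding sq unfolding fa by simp
      thus ?thesis using \<nu>_pos[OF \<eta>] jump_nonneg[OF \<eta>] by (intro mult_left_mono) auto
    qed (simp add: jump_eq_0[OF \<eta>])
  qed
  also have "\<dots> = \<delta> * dirichlet f x y + 1 / (2 * \<delta>) * ((\<Sum>\<eta>\<in>\<Omega>. \<nu> \<eta> * (jump x y \<eta> * ((g \<eta>)\<^sup>2 * f (move \<eta> x y)))) + (\<Sum>\<eta>\<in>\<Omega>. \<nu> \<eta> * (jump x y \<eta> * ((g \<eta>)\<^sup>2 * f \<eta>))))"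
    unfolding dirichlet_def sum_distrib_left sum.distrib[symmetric] by (intro sum.cong refl) (simp add: algebra_simps add_divide_distrib)
  also have "(\<Sum>\<eta>\<in>\<Omega>. \<nu> \<eta> * (jump x y \<eta> * ((g \<eta>)\<^sup>2 * f (move \<eta> x y)))) = (\<Sum>\<eta>\<in>\<Omega>. \<nu> \<eta> * (odds x y * jump y x \<eta> * ((g \<eta>)\<^sup>2 * f \<eta>)))"
    by (rule cv) (simp add: g)
  also have "\<dots> + (\<Sum>\<eta>\<in>\<Omega>. \<nu> \<eta> * (jump x y \<eta> * ((g \<eta>)\<^sup>2 * f \<eta>))) = wmean \<Omega> (\<lambda>\<eta>. \<nu> \<eta> * f \<eta>) (\<lambda>\<eta>. (odds x y * jump y x \<eta> + jump x y \<eta>) * (g \<eta>)\<^sup>2)"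
    by (simp add: wmean_def algebra_simps flip: sum.distrib)
  also have "\<dots> \<le> wmean \<Omega> (\<lambda>\<eta>. \<nu> \<eta> * f \<eta>) (\<lambda>\<eta>. 3 * (real K)\<^sup>2 * (g \<eta>)\<^sup>2)"
  proof (intro wmean_mono mult_right_mono)
    fix \<eta> assume \<eta>: "\<eta> \<in> \<Omega>"
    have "odds x y * jump y x \<eta> \<le> 2 * (real K)\<^sup>2"
      using odds_le[OF xy(1,2)] odds_pos[OF xy(1,2)] jump_le[OF \<eta>] jump_nonneg[OF \<eta>] by (intro mult_mono) auto
    thus "odds x y * jump y x \<eta> + jump x y \<eta> \<le> 3 * (real K)\<^sup>2" using jump_le[OF \<eta>, of x y] by simp
    show "0 \<le> \<nu> \<eta> * f \<eta>" using \<nu>_pos[OF \<eta>] f[OF \<eta>] by simp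
  qed auto
  finally show ?thesis using \<delta> unfolding wmean_cmult by (simp add: mult_left_mono divide_right_mono)
qed

end

subsection \<open>Replacement by block averages\<close>

text \<open>The box has its lowest corner at the unit vector in direction j, so that a translate of it by x does not contain x.
  The side is doubled in the directions of D.\<close>

definition corner_box :: "'d::finite \<Rightarrow> nat \<Rightarrow> 'd set \<Rightarrow> 'd site set" where
  "corner_box j k D = {z. \<forall>i. (if i = j then 1 else 0) \<le> z $ i \<and>
      z $ i < (if i = j then 1 else 0) + (if i \<in> D then 2 ^ Suc k else 2 ^ k)}"

lemma corner_box_Suc: "corner_box j k UNIV = corner_box j (Suc k) {}"
  by (simp add: corner_box_def)

lemma corner_box_0: "corner_box j 0 {} = {axis j 1}"
proof -
  have "z \<in> corner_box j 0 {} \<longleftrightarrow> (\<forall>i. z $ i = (if i = j then 1 else 0))" for z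
    unfolding corner_box_def by (simp add: order_eq_iff)
  thus ?thesis by (auto simp: axis_def vec_eq_iff)
qed

lemma finite_corner_box: "finite (corner_box j k D)"
proof -
  have "corner_box j k D \<subseteq> torus (2 + 2 ^ Suc k)"
  proof
    fix z assume z: "z \<in> corner_box j k D"
    have "0 \<le> z $ i \<and> z $ i < 2 + 2 * 2 ^ k" for i
    proof -
      have "(if i = j then 1 else 0) \<le> z $ i" "z $ i < (if i = j then 1 else 0) + (if i \<in> D then 2 ^ Suc k else 2 ^ k)"
        using z by (auto simp: corner_box_def)
      moreover have "(0 :: int) < 2 ^ k" by simp
      ultimately show ?thesis by (auto split: if_splits)
    qed
    thus "z \<in> torus (2 + 2 ^ Suc k)" by (simp add: torus_def)
  qed
  thus ?thesis by (rule finite_subset) simp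
qed

text \<open>The doubled box consists of the old box and a disjoint translate of it, which later
  makes a difference of box means a telescoping sum of gradients.\<close>

lemma corner_box_insert:
  assumes "i \<notin> D"
  shows "corner_box j k (insert i D) = corner_box j k D \<union> (\<lambda>z. z + axis i (2 ^ k)) ` corner_box j k D" (is "?L = ?A \<union> ?B")
    and "corner_box j k D \<inter> (\<lambda>z. z + axis i (2 ^ k)) ` corner_box j k D = {}"
proof -
  have B: "z \<in> ?B \<longleftrightarrow> z - axis i (2 ^ k) \<in> corner_box j k D" for z :: "int ^ 'a"
    by (auto simp: image_iff intro!: bexI[of _ "z - axis i (2 ^ k)"])
  have p: "(0 :: int) < 2 ^ k" by simp
  have coord: "z $ a - axis i (2 ^ k) $ a = z $ a - (if a = i then 2 ^ k else 0)" for z :: "int ^ 'a" and a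
    by (simp add: axis_def)
  show "?L = ?A \<union> ?B"
  proof (rule set_eqI, rule iffI)
    fix z assume z: "z \<in> ?L"
    show "z \<in> ?A \<union> ?B"
    proof (cases "z $ i < (if i = j then 1 else 0) + 2 ^ k")
      case True
      have "z \<in> ?A" unfolding corner_box_def mem_Collect_eq
      proof
        fix a
        have "(if a = j then 1 else 0) \<le> z $ a \<and> z $ a < (if a = j then 1 else 0) + (if a \<in> insert i D then 2 ^ Suc k else 2 ^ k)"
          using z unfolding corner_box_def mem_Collect_eq by blast
        thus "(if a = j then 1 else 0) \<le> z $ a \<and> z $ a < (if a = j then 1 else 0) + (if a \<in> D then 2 ^ Suc k else 2 ^ k)"
          using True assms by (auto split: if_splits)
      qed
      thus ?thesis by simp
    next
      case False
      have "z \<in> ?B" unfolding B unfolding corner_box_def mem_Collect_eq vector_minus_component coord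
      proof
        fix a
        have "(if a = j then 1 else 0) \<le> z $ a \<and> z $ a < (if a = j then 1 else 0) + (if a \<in> insert i D then 2 ^ Suc k else 2 ^ k)"
          using z unfolding corner_box_def mem_Collect_eq by blast
        thus "(if a = j then 1 else 0) \<le> z $ a - (if a = i then 2 ^ k else 0) \<and>
          z $ a - (if a = i then 2 ^ k else 0) < (if a = j then 1 else 0) + (if a \<in> D then 2 ^ Suc k else 2 ^ k)"
          using False assms by (auto split: if_splits)
      qed
      thus ?thesis by simp
    qed
  next
    fix z assume "z \<in> ?A \<union> ?B"
    thus "z \<in> ?L"
    proof
      assume z: "z \<in> ?A"
      show ?thesis unfolding corner_box_def mem_Collect_eq
      proof
        fix a
        have "(if a = j then 1 else 0) \<le> z $ a \<and> z $ a < (if a = j then 1 else 0) + (if a \<in> D then 2 ^ Suc k else 2 ^ k)"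
          using z by (auto simp: corner_box_def)
        thus "(if a = j then 1 else 0) \<le> z $ a \<and> z $ a < (if a = j then 1 else 0) + (if a \<in> insert i D then 2 ^ Suc k else 2 ^ k)"
          using p by (auto split: if_splits)
      qed
    next
      assume "z \<in> ?B"
      hence z: "z - axis i (2 ^ k) \<in> corner_box j k D" using B by simp
      show ?thesis unfolding corner_box_def mem_Collect_eq
      proof
        fix a
        have "(if a = j then 1 else 0) \<le> z $ a - (if a = i then 2 ^ k else 0) \<and>
          z $ a - (if a = i then 2 ^ k else 0) < (if a = j then 1 else 0) + (if a \<in> D then 2 ^ Suc k else 2 ^ k)"
          using z unfolding corner_box_def mem_Collect_eq vector_minus_component coord by blast
        thus "(if a = j then 1 else 0) \<le> z $ a \<and> z $ a < (if a = j then 1 else 0) + (if a \<in> insert i D then 2 ^ Suc k else 2 ^ k)"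
          using p assms by (auto split: if_splits)
      qed
    qed
  qed
  show "?A \<inter> ?B = {}"
  proof (rule equals0I)
    fix z assume "z \<in> ?A \<inter> ?B"
    hence "z \<in> corner_box j k D" "z - axis i (2 ^ k) \<in> corner_box j k D" using B by auto
    hence "z $ i < (if i = j then 1 else 0) + 2 ^ k" "(if i = j then 1 else 0) \<le> z $ i - 2 ^ k"
      using assms by (auto simp: corner_box_def axis_def split: if_splits)
    thus False by simp
  qed
qed

lemma card_corner_box_insert:
  assumes "i \<notin> D"
  shows "card (corner_box j k (insert i D)) = 2 * card (corner_box j k D)"
  unfolding corner_box_insert(1)[OF assms] using corner_box_insert(2)[OF assms] finite_corner_box
  by (subst card_Un_disjoint[OF finite_corner_box finite_imageI[OF finite_corner_box]]) (simp_all add: card_image inj_on_def)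

lemma card_corner_box: "card (corner_box j k D) = 2 ^ card D * 2 ^ (k * CARD('d))"
  for j :: "'d::finite"
proof (induction k arbitrary: D)
  have D: "card (corner_box j k D) = 2 ^ card D * card (corner_box j k {})" for k D
    using finite[of D] by (induction D rule: finite_induct) (auto simp: card_corner_box_insert)
  case 0
  show ?case using D[of 0 D] by (simp add: corner_box_0)
  case (Suc k)
  show ?case using Suc[of UNIV] D[of "Suc k" D] by (simp add: corner_box_Suc power_add)
qed

text \<open>Two points of a box with sides at most 2^(k+1) < N differ by less than N in every
  coordinate, so the box embeds in the torus.\<close>

lemma corner_box_diff_dvd_imp_eq:
  assumes "z \<in> corner_box j k D" "z' \<in> corner_box j k D" and dvd: "\<forall>i. int N dvd (z $ i - z' $ i)" and N: "2 ^ Suc k < N"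
  shows "z = z'"
proof -
  have NN: "2 * 2 ^ k < int N" using N by (metis of_nat_less_iff of_nat_numeral of_nat_power power_Suc)
  have "z $ i = z' $ i" for i
  proof (rule ccontr)
    assume ne: "z $ i \<noteq> z' $ i"
    have "\<bar>z $ i - z' $ i\<bar> < 2 * 2 ^ k"
    proof -
      have "(if i = j then 1 else 0) \<le> z $ i" "z $ i < (if i = j then 1 else 0) + (if i \<in> D then 2 ^ Suc k else 2 ^ k)"
        "(if i = j then 1 else 0) \<le> z' $ i" "z' $ i < (if i = j then 1 else 0) + (if i \<in> D then 2 ^ Suc k else 2 ^ k)"
        using assms(1,2) by (auto simp: corner_box_def)
      moreover have "(0 :: int) < 2 ^ k" by simp
      ultimately show ?thesis by (auto split: if_splits)
    qed
    moreover have "int N \<le> \<bar>z $ i - z' $ i\<bar>"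
      using dvd ne by (metis dvd_imp_le_int abs_of_nat right_minus_eq)
    ultimately show False using NN by simp
  qed
  thus ?thesis by (simp add: vec_eq_iff)
qed

text \<open>Keeps the doubling paths off the base point: along z + q e_i the coordinate
  \<open>j\<close> stays between 1 and 2^(k+1). For i = j this holds because direction
  \<open>i\<close> is not yet doubled. The value q = 2^k is included because a path ends
  there.\<close>

lemma not_dvd_corner_box:
  assumes z: "z \<in> corner_box j k D" and i: "i \<notin> D" and q: "0 \<le> q" "q \<le> 2 ^ k" and N: "2 ^ Suc k < N"
  shows "\<not> int N dvd (z + axis i q) $ j"
proof
  assume d: "int N dvd (z + axis i q) $ j"
  have NN: "2 * 2 ^ k < int N" using N by (metis of_nat_less_iff of_nat_numeral of_nat_power power_Suc)
  have "1 \<le> z $ j \<and> z $ j < 1 + (if j \<in> D then 2 ^ Suc k else 2 ^ k)"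
    using z unfolding corner_box_def mem_Collect_eq by (metis (full_types))
  moreover have "(0 :: int) < 2 ^ k" by simp
  ultimately have "1 \<le> (z + axis i q) $ j \<and> (z + axis i q) $ j \<le> 2 * 2 ^ k"
    using i q by (auto simp: axis_def split: if_splits)
  thus False using d NN by (smt (verit) zdvd_imp_le)
qed

section \<open>Gradients of the field under a positive law\<close>

locale entropy_setting = lattice_gas K N r
  for K N :: nat and r :: "'d::finite site \<Rightarrow> real" +
  fixes \<mu> :: "'d config \<Rightarrow> real" and c \<epsilon> vol :: real
  assumes c: "c > 0" and c_le: "\<And>x. x \<in> torus N \<Longrightarrow> c \<le> r x" "\<And>x. x \<in> torus N \<Longrightarrow> c \<le> real K - r x"
    and \<mu>_pos: "\<And>\<eta>. \<eta> \<in> \<Omega> \<Longrightarrow> 0 < \<mu> \<eta>" and \<mu>_sum: "(\<Sum>\<eta>\<in>\<Omega>. \<mu> \<eta>) = 1"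
    and \<nu>_sum: "(\<Sum>\<eta>\<in>\<Omega>. \<nu> \<eta>) = 1"
    and \<epsilon>: "\<And>x i. x \<in> torus N \<Longrightarrow> \<bar>r x - r (torus_add N x (axis i 1))\<bar> \<le> \<epsilon>"
    and vol_eq: "vol = real (card (torus N :: 'd site set))"
begin

abbreviation "E \<equiv> wmean \<Omega> \<mu>"

definition "f \<eta> = \<mu> \<eta> / \<nu> \<eta>"

definition "b = real K / c\<^sup>2"

text \<open>The first summand comes from integration by parts after division by a prefactor of at
  least \<open>K * c\<^sup>2\<close>, the second from Young's inequality for the quadratic remainder
  of the gradient.\<close>

definition "C\<^sub>0 = 3 / (2 * c ^ 4) + 1 / 2"

lemma b: "b > 0"
  using c K by (simp add: b_def)

lemma f_pos: "\<eta> \<in> \<Omega> \<Longrightarrow> 0 < f \<eta>"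
  using \<mu>_pos \<nu>_pos by (simp add: f_def)

lemma \<epsilon>_nonneg: "0 \<le> \<epsilon>"
proof -
  have "(0 :: 'd site) \<in> torus N" using N by (auto simp: torus_def)
  from \<epsilon>[OF this] show ?thesis by (meson abs_ge_zero order_trans)
qed

lemma om_le:
  assumes x: "x \<in> torus N" and k: "k \<le> K"
  shows "\<bar>om x k\<bar> \<le> b"
proof -
  have "\<bar>real k - r x\<bar> \<le> real K" using r_pos[OF x] r_less[OF x] k by linarith
  moreover have "c\<^sup>2 \<le> r x * (real K - r x)" unfolding power2_eq_square using c c_le[OF x] by (intro mult_mono) auto
  ultimately have "\<bar>real k - r x\<bar> / (r x * (real K - r x)) \<le> real K / c\<^sup>2" using c by (intro frac_le) auto
  moreover have "0 < r x * (real K - r x)" using r_pos[OF x] r_less[OF x] by simp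
  ultimately show ?thesis by (simp add: om_def b_def abs_divide)
qed

text \<open>The last constant is the square of 2 b, since the field and its conditional mean are
  both bounded by \<open>b\<close>.\<close>

lemma decomposition:
  obtains m where "decomposed_field N \<Omega> \<mu> (\<lambda>x \<eta>. om x (\<eta> x)) m (4 * b\<^sup>2 * kl \<Omega> \<mu> \<nu>) (4 * b\<^sup>2)"
proof -
  obtain m where m: "\<And>x \<eta>. x \<in> torus N \<Longrightarrow> \<eta> \<in> \<Omega> \<Longrightarrow> \<bar>m x \<eta>\<bar> \<le> b"
    "(\<Sum>x\<in>torus N. E (\<lambda>\<eta>. (m x \<eta>)\<^sup>2)) \<le> 4 * b\<^sup>2 * kl \<Omega> \<mu> \<nu>"
    "\<And>x. x \<in> torus N \<Longrightarrow> E (\<lambda>\<eta>. om x (\<eta> x) - m x \<eta>) = 0"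
    "\<And>x y. x \<in> torus N \<Longrightarrow> y \<in> torus N \<Longrightarrow> x \<noteq> y \<Longrightarrow> E (\<lambda>\<eta>. (om x (\<eta> x) - m x \<eta>) * (om y (\<eta> y) - m y \<eta>)) = 0"
    using martingale_decomposition[of \<mu> om b, OF \<mu>_pos \<mu>_sum \<nu>_sum om_centred om_le b] by blast
  show ?thesis
  proof (rule that, unfold_locales)
    fix x :: "'d site" assume x: "x \<in> torus N"
    have "E (\<lambda>\<eta>. (om x (\<eta> x) - m x \<eta>)\<^sup>2) \<le> E (\<lambda>\<eta>. 4 * b\<^sup>2)"
    proof (intro wmean_mono)
      fix \<eta> assume \<eta>: "\<eta> \<in> \<Omega>"
      show "0 \<le> \<mu> \<eta>" using \<mu>_pos[OF \<eta>] by simp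
      have "\<bar>om x (\<eta> x) - m x \<eta>\<bar> \<le> \<bar>2 * b\<bar>" using m(1)[OF x \<eta>] om_le[OF x \<Omega>_le[OF \<eta>], of x] by linarith
      hence "(om x (\<eta> x) - m x \<eta>)\<^sup>2 \<le> (2 * b)\<^sup>2" by (simp only: abs_le_square_iff)
      thus "(om x (\<eta> x) - m x \<eta>)\<^sup>2 \<le> 4 * b\<^sup>2" by (simp add: power_mult_distrib)
    qed
    thus "E (\<lambda>\<eta>. (om x (\<eta> x) - m x \<eta>)\<^sup>2) \<le> 4 * b\<^sup>2" using wmean_const[OF \<mu>_sum] by simp
  qed (use N \<mu>_pos \<mu>_sum m in \<open>auto simp: less_imp_le\<close>)
qed

text \<open>\<open>jump_antisym\<close>, divided by its prefactor \<open>s\<close>, expresses the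
  gradient of \<open>om\<close> through antisymmetric rates, to which integration by parts applies.
  What remains is a product of two \<open>om\<close> with the factor r x - r y, whose square is at
  most b^4 \<epsilon>^2.\<close>

lemma gradient_bound:
  assumes xy: "x \<in> torus N" "y \<in> torus N" "x \<noteq> y" and e: "\<bar>r x - r y\<bar> \<le> \<epsilon>"
    and h: "\<And>\<eta>. h (move \<eta> x y) = h \<eta>" "\<And>\<eta>. h (move \<eta> y x) = h \<eta>" and \<delta>: "\<delta> > 0"
  shows "E (\<lambda>\<eta>. h \<eta> * (om y (\<eta> y) - om x (\<eta> x)))
     \<le> \<delta> * dirichlet f x y + C\<^sub>0 / \<delta> * E (\<lambda>\<eta>. (h \<eta>)\<^sup>2) + b ^ 4 * \<epsilon>\<^sup>2 * \<delta> / 2"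
proof -
  have \<mu>f: "wmean \<Omega> (\<lambda>\<eta>. \<nu> \<eta> * f \<eta>) F = E F" for F
    unfolding wmean_def f_def using \<nu>_pos by (intro sum.cong refl) (auto simp: less_imp_neq[symmetric])
  define s where "s = real K * (r x * (real K - r y))"
  have sc: "real K * c\<^sup>2 \<le> s" unfolding s_def power2_eq_square using c c_le[OF xy(1)] c_le[OF xy(2)]
    by (intro mult_left_mono mult_mono) auto
  have s: "s > 0" using sc c K by (rule_tac less_le_trans) auto
  have Eh: "0 \<le> E (\<lambda>\<eta>. (h \<eta>)\<^sup>2)" using \<mu>_pos by (intro wmean_nonneg) (auto simp: less_imp_le)
  have "E (\<lambda>\<eta>. h \<eta> / s * (odds x y * jump y x \<eta> - jump x y \<eta>))
      \<le> \<delta> * dirichlet f x y + 3 * (real K)\<^sup>2 / (2 * \<delta>) * E (\<lambda>\<eta>. (h \<eta> / s)\<^sup>2)"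
    using integration_by_parts[of x y f "\<lambda>\<eta>. h \<eta> / s" \<delta>, OF xy _ _ _ \<delta>] h f_pos
    by (simp add: less_imp_le \<mu>f)
  also have "E (\<lambda>\<eta>. (h \<eta> / s)\<^sup>2) = 1 / s\<^sup>2 * E (\<lambda>\<eta>. (h \<eta>)\<^sup>2)"
    by (simp add: power_divide flip: wmean_cmult)
  also have "\<dots> \<le> 1 / (real K * c\<^sup>2)\<^sup>2 * E (\<lambda>\<eta>. (h \<eta>)\<^sup>2)"
    using sc c K s Eh by (intro mult_right_mono divide_left_mono power_mono mult_pos_pos) auto
  finally have 1: "E (\<lambda>\<eta>. h \<eta> / s * (odds x y * jump y x \<eta> - jump x y \<eta>))
      \<le> \<delta> * dirichlet f x y + 3 * (real K)\<^sup>2 / (2 * \<delta>) * (1 / (real K * c\<^sup>2)\<^sup>2 * E (\<lambda>\<eta>. (h \<eta>)\<^sup>2))"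
    using \<delta> by (simp add: mult_left_mono divide_right_mono)
  have 1: "E (\<lambda>\<eta>. h \<eta> / s * (odds x y * jump y x \<eta> - jump x y \<eta>))
      \<le> \<delta> * dirichlet f x y + 3 / (2 * c ^ 4) / \<delta> * E (\<lambda>\<eta>. (h \<eta>)\<^sup>2)"
  proof -
    have "3 * (real K)\<^sup>2 / (2 * \<delta>) * (1 / (real K * c\<^sup>2)\<^sup>2 * e) = 3 / (2 * c ^ 4) / \<delta> * e" for e
      using K c \<delta> by (simp add: field_simps power2_eq_square power4_eq_xxxx)
    thus ?thesis using 1 by simp
  qed
  have "E (\<lambda>\<eta>. h \<eta> * (om x (\<eta> x) * om y (\<eta> y) * (r x - r y))) \<le> E (\<lambda>\<eta>. 1 / (2 * \<delta>) * (h \<eta>)\<^sup>2 + b ^ 4 * \<epsilon>\<^sup>2 * \<delta> / 2)"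
  proof (rule wmean_mono)
    fix \<eta> assume \<eta>: "\<eta> \<in> \<Omega>"
    show "0 \<le> \<mu> \<eta>" using \<mu>_pos[OF \<eta>] by simp
    let ?u = "om x (\<eta> x) * om y (\<eta> y) * (r x - r y)"
    have "\<bar>?u\<bar> \<le> b * b * \<epsilon>" unfolding abs_mult using om_le xy \<Omega>_le[OF \<eta>] e b by (intro mult_mono) auto
    hence "?u\<^sup>2 \<le> (b * b * \<epsilon>)\<^sup>2" using b \<epsilon>_nonneg by (simp flip: abs_le_square_iff)
    also have "\<dots> = b ^ 4 * \<epsilon>\<^sup>2" by (simp add: power_mult_distrib power2_eq_square power4_eq_xxxx)
    finally have u: "\<delta> / 2 * ?u\<^sup>2 \<le> \<delta> / 2 * (b ^ 4 * \<epsilon>\<^sup>2)" using \<delta> by (intro mult_left_mono) auto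
    have "0 \<le> (h \<eta> - \<delta> * ?u)\<^sup>2 / (2 * \<delta>)" using \<delta> by simp
    also have "\<dots> = 1 / (2 * \<delta>) * (h \<eta>)\<^sup>2 + \<delta> / 2 * ?u\<^sup>2 - h \<eta> * ?u"
      using \<delta> by (simp add: field_simps power2_eq_square)
    finally show "h \<eta> * ?u \<le> 1 / (2 * \<delta>) * (h \<eta>)\<^sup>2 + b ^ 4 * \<epsilon>\<^sup>2 * \<delta> / 2" using u by (simp add: mult_ac)
  qed
  also have "\<dots> = 1 / (2 * \<delta>) * E (\<lambda>\<eta>. (h \<eta>)\<^sup>2) + b ^ 4 * \<epsilon>\<^sup>2 * \<delta> / 2"
    unfolding wmean_add wmean_cmult wmean_const[OF \<mu>_sum] ..
  finally have 2: "E (\<lambda>\<eta>. h \<eta> * (om x (\<eta> x) * om y (\<eta> y) * (r x - r y))) \<le> 1 / (2 * \<delta>) * E (\<lambda>\<eta>. (h \<eta>)\<^sup>2) + b ^ 4 * \<epsilon>\<^sup>2 * \<delta> / 2" .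
  have "E (\<lambda>\<eta>. h \<eta> * (om y (\<eta> y) - om x (\<eta> x))) =
    E (\<lambda>\<eta>. h \<eta> / s * (odds x y * jump y x \<eta> - jump x y \<eta>) + h \<eta> * (om x (\<eta> x) * om y (\<eta> y) * (r x - r y)))"
    unfolding jump_antisym[OF xy(1,2)] s_def[symmetric] using s by (intro wmean_cong) (simp add: algebra_simps)
  moreover have "C\<^sub>0 / \<delta> * e = 3 / (2 * c ^ 4) / \<delta> * e + 1 / (2 * \<delta>) * e" for e
    by (simp add: C\<^sub>0_def add_divide_distrib algebra_simps)
  ultimately show ?thesis using 1 2 by (simp add: wmean_add)
qed

definition total_dirichlet :: real where
  "total_dirichlet = (\<Sum>i\<in>UNIV. \<Sum>v\<in>torus N. dirichlet f v (torus_add N v (axis i 1)))"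

definition box_mean :: "'d site set \<Rightarrow> 'd site \<Rightarrow> 'd config \<Rightarrow> real" where
  "box_mean Q x \<eta> = (\<Sum>z\<in>Q. om (torus_add N x z) (\<eta> (torus_add N x z))) / real (card Q)"

lemma torus_add_axis_neq: "x \<in> torus N \<Longrightarrow> torus_add N x (axis i 1) \<noteq> x"
  using N torus_add_eq_self_iff[of N x "axis i 1"] by (auto simp: axis_def)

end

context entropy_setting
begin

text \<open>The two means differ by half the difference between the means over \<open>Q\<close> and
  over its translate by 2^k in direction \<open>i\<close>, and each point is joined to its translate
  by a straight path of 2^k bonds. Collecting for every bond the paths through it gives the flow
  \<open>hh\<close>. With q points in \<open>Q\<close> there are 2^k q path steps, of which at most
  2^k meet at a site; after the prefactor 1 / (2 q)^2 the variance is of order (2^k)^2 / q.\<close>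

lemma box_mean_step:
  fixes a :: "'d site \<Rightarrow> real" and j i :: 'd and k :: nat and D :: "'d set"
  assumes dec: "decomposed_field N \<Omega> \<mu> (\<lambda>x \<eta>. om x (\<eta> x)) m h B"
    and i: "i \<notin> D" and kN: "2 ^ Suc k < N" and A: "\<And>x. x \<in> torus N \<Longrightarrow> \<bar>a x\<bar> \<le> A" and \<delta>: "\<delta> > 0"
  defines "Q \<equiv> corner_box j k D" and "Q' \<equiv> corner_box j k (insert i D)"
  shows "E (\<lambda>\<eta>. \<Sum>x\<in>torus N. a x * om x (\<eta> x) * (box_mean Q x \<eta> - box_mean Q' x \<eta>))
     \<le> \<delta> * total_dirichlet + C\<^sub>0 / \<delta> * (A\<^sup>2 * ((2 ^ k)\<^sup>2 / 2 * h + (2 ^ k)\<^sup>2 / (2 * real (card Q)) * B * vol))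
        + vol * (b ^ 4 * \<epsilon>\<^sup>2 * \<delta> / 2)"
proof -
  interpret decomposed_field N \<Omega> \<mu> "\<lambda>x \<eta>. om x (\<eta> x)" m h B by (rule dec)
  have N0: "N > 0" using N by simp
  define s :: nat where "s = 2 ^ k"
  define q where "q = real (card Q)"
  define \<zeta> where "\<zeta> = (\<lambda>(z, l). z + axis i (int l) :: 'd site)"
  define J where "J = Q \<times> {..<s}"
  have finQ: "finite Q" unfolding Q_def by (rule finite_corner_box)
  have cQ: "card Q = 2 ^ card D * 2 ^ (k * CARD('d))" unfolding Q_def by (rule card_corner_box)
  have q: "q > 0" unfolding q_def cQ by simp
  have finJ: "finite J" unfolding J_def using finQ by simp
  have cJ: "real (card J) = q * real s" unfolding J_def q_def by (simp add: card_cartesian_product)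
  have cQ': "real (card Q') = 2 * q" unfolding Q'_def q_def Q_def card_corner_box_insert[OF i] by simp
  let ?e = "axis i 1 :: 'd site"
  define hh where "hh = (\<lambda>v \<eta>. \<Sum>t\<in>J. a (torus_add N v (- \<zeta> t)) * om (torus_add N v (- \<zeta> t)) (\<eta> (torus_add N v (- \<zeta> t))))"
  \<comment> \<open>A local prefactor, not the exponent of the time scale: its size is 1 / q - 1 /
    (2 q), its sign that of the telescoping sum.\<close>
  define \<kappa> where "\<kappa> = - 1 / (2 * q)"
  have axS: "axis i (int (Suc l)) = axis i (int l) + ?e" for l
    by (simp add: axis_def vec_eq_iff)
  have diff: "box_mean Q x \<eta> - box_mean Q' x \<eta>
      = \<kappa> * (\<Sum>t\<in>J. om (torus_add N x (\<zeta> t + ?e)) (\<eta> (torus_add N x (\<zeta> t + ?e))) - om (torus_add N x (\<zeta> t)) (\<eta> (torus_add N x (\<zeta> t))))" for x \<eta>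
  proof -
    define F where "F = (\<lambda>z. om (torus_add N x z) (\<eta> (torus_add N x z)))"
    have tel: "(\<Sum>l<s. F (z + axis i (int l) + ?e) - F (z + axis i (int l))) = F (z + axis i (2 ^ k)) - F z" for z
    proof -
      have "(\<Sum>l<s. F (z + axis i (int l) + ?e) - F (z + axis i (int l)))
          = (\<Sum>l<s. F (z + axis i (int (Suc l))) - F (z + axis i (int l)))"
        unfolding axS by (simp add: add.assoc)
      also have "\<dots> = F (z + axis i (int s)) - F (z + axis i (int 0))" by (rule sum_lessThan_telescope)
      finally show ?thesis by (simp add: s_def axis_def zero_vec_def[symmetric])
    qed
    have gen: "S / q - (S + S') / (2 * q) = - 1 / (2 * q) * (S' - S)" for S S'
      using q by (simp add: field_simps)
    have "(\<Sum>t\<in>J. F (\<zeta> t + ?e) - F (\<zeta> t)) = (\<Sum>z\<in>Q. F (z + axis i (2 ^ k))) - (\<Sum>z\<in>Q. F z)"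
      unfolding J_def \<zeta>_def sum_subtractf[symmetric] tel[symmetric] by (simp add: sum.cartesian_product case_prod_unfold)
    moreover have "(\<Sum>z\<in>Q'. F z) = (\<Sum>z\<in>Q. F z) + (\<Sum>z\<in>Q. F (z + axis i (2 ^ k)))"
      unfolding Q'_def corner_box_insert(1)[OF i] Q_def[symmetric]
      using corner_box_insert(2)[OF i, of j k] finQ unfolding Q_def[symmetric]
      by (subst sum.union_disjoint) (auto simp: sum.reindex inj_on_def)
    ultimately have "(\<Sum>z\<in>Q. F z) / q - (\<Sum>z\<in>Q'. F z) / (2 * q) = \<kappa> * (\<Sum>t\<in>J. F (\<zeta> t + ?e) - F (\<zeta> t))"
      by (simp only: \<kappa>_def gen)
    thus ?thesis unfolding F_def box_mean_def cQ' q_def[symmetric] .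
  qed
  \<comment> \<open>The substitution v = x + \<open>\<zeta> t\<close>, made separately for each path
    step \<open>t\<close>, regroups the sum by the bond from v to v + e_i.\<close>
  have ident: "(\<Sum>x\<in>torus N. a x * om x (\<eta> x) * (box_mean Q x \<eta> - box_mean Q' x \<eta>))
     = (\<Sum>v\<in>torus N. \<kappa> * hh v \<eta> * (om (torus_add N v ?e) (\<eta> (torus_add N v ?e)) - om v (\<eta> v)))" for \<eta>
  proof -
    let ?F = "\<lambda>v. om v (\<eta> v)"
    have "(\<Sum>x\<in>torus N. a x * ?F x * (box_mean Q x \<eta> - box_mean Q' x \<eta>))
       = (\<Sum>t\<in>J. \<Sum>x\<in>torus N. \<kappa> * (a x * ?F x) * (?F (torus_add N x (\<zeta> t + ?e)) - ?F (torus_add N x (\<zeta> t))))"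
      unfolding diff by (subst sum.swap) (simp add: sum_distrib_left mult_ac)
    also have "\<dots> = (\<Sum>t\<in>J. \<Sum>v\<in>torus N. \<kappa> * (a (torus_add N v (- \<zeta> t)) * ?F (torus_add N v (- \<zeta> t))) * (?F (torus_add N v ?e) - ?F v))"
    proof (rule sum.cong[OF refl])
      fix t
      show "(\<Sum>x\<in>torus N. \<kappa> * (a x * ?F x) * (?F (torus_add N x (\<zeta> t + ?e)) - ?F (torus_add N x (\<zeta> t))))
         = (\<Sum>v\<in>torus N. \<kappa> * (a (torus_add N v (- \<zeta> t)) * ?F (torus_add N v (- \<zeta> t))) * (?F (torus_add N v ?e) - ?F v))"
        by (subst sum_torus_shift[OF N0, where z = "\<zeta> t", symmetric]) (auto simp: torus_add_assoc intro!: sum.cong)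
    qed
    also have "\<dots> = (\<Sum>v\<in>torus N. \<kappa> * hh v \<eta> * (?F (torus_add N v ?e) - ?F v))"
      unfolding hh_def by (subst sum.swap) (simp add: sum_distrib_left sum_distrib_right mult_ac)
    finally show ?thesis .
  qed
  \<comment> \<open>Integration by parts is possible because the flow through a bond does not depend on the two sites of the bond.\<close>
  have inv: "hh v (move \<eta> x y) = hh v \<eta>" if v: "v \<in> torus N" and xy: "(x, y) \<in> {(v, torus_add N v ?e), (torus_add N v ?e, v)}" for v x y \<eta>
  proof -
    have "torus_add N v (- \<zeta> t) \<noteq> x \<and> torus_add N v (- \<zeta> t) \<noteq> y" if t: "t \<in> J" for t
    proof -
      obtain z l where zl: "t = (z, l)" "z \<in> Q" "l < s" using t by (auto simp: J_def)
      have l: "int l < 2 ^ k" using zl(3) unfolding s_def by (metis of_nat_less_iff of_nat_numeral of_nat_power)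
      hence l1: "int l + 1 \<le> 2 ^ k" by linarith
      have "\<not> int N dvd (z + axis i (int l)) $ j" "\<not> int N dvd (z + axis i (int l + 1)) $ j"
        using zl(2) l l1 unfolding Q_def by (intro not_dvd_corner_box[OF _ i _ _ kN]; simp)+
      moreover have "(- \<zeta> t - ?e) $ j = - ((z + axis i (int l + 1)) $ j)" "(- \<zeta> t) $ j = - ((z + axis i (int l)) $ j)"
        by (auto simp: \<zeta>_def zl axis_def)
      ultimately have n: "\<not> int N dvd (- \<zeta> t) $ j" "\<not> int N dvd (- \<zeta> t - ?e) $ j"
        by (metis dvd_minus_iff)+
      have "torus_add N v (- \<zeta> t) \<noteq> v" using n(1) torus_add_eq_self_iff[OF N0 v] by blast
      moreover have "torus_add N v (- \<zeta> t) \<noteq> torus_add N v ?e"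
        using n(2) unfolding torus_add_eq_iff[OF N0] vector_minus_component by blast
      ultimately show ?thesis using xy by auto
    qed
    moreover have "x \<noteq> y" using xy torus_add_axis_neq[OF v, of i] by auto
    ultimately show ?thesis unfolding hh_def by (intro sum.cong refl) (simp add: move_apply)
  qed
  have sq: "(\<Sum>v\<in>torus N. E (\<lambda>\<eta>. (hh v \<eta>)\<^sup>2)) \<le> 2 * A\<^sup>2 * (real (card J))\<^sup>2 * h + 2 * A\<^sup>2 * real (card J) * real s * B * vol"
    unfolding hh_def vol_eq
  proof (rule square_bound[OF finJ A])
    fix v t assume t: "t \<in> J"
    \<comment> \<open>The position \<open>l\<close> on a path and the site reached determine the
      starting point modulo N, and the box embeds in the torus; so a site is met at most once for
      each \<open>l\<close>.\<close>
    have "inj_on snd {t' \<in> J. torus_add N v (- \<zeta> t') = torus_add N v (- \<zeta> t)}"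
    proof (rule inj_onI)
      fix t1 t2 assume a: "t1 \<in> {t' \<in> J. torus_add N v (- \<zeta> t') = torus_add N v (- \<zeta> t)}"
        "t2 \<in> {t' \<in> J. torus_add N v (- \<zeta> t') = torus_add N v (- \<zeta> t)}" "snd t1 = snd t2"
      have "torus_add N v (- \<zeta> t1) = torus_add N v (- \<zeta> t2)" using a by simp
      hence d: "int N dvd (- \<zeta> t1) $ c - (- \<zeta> t2) $ c" for c unfolding torus_add_eq_iff[OF N0] by blast
      have "int N dvd (fst t2 $ c - fst t1 $ c)" for c
        using d[of c] a(3) by (simp add: \<zeta>_def case_prod_unfold)
      hence "fst t2 = fst t1" using a(1,2) unfolding J_def Q_def
        by (intro corner_box_diff_dvd_imp_eq[OF _ _ _ kN]) auto
      thus "t1 = t2" using a(3) by (simp add: prod_eq_iff)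
    qed
    moreover have "snd ` {t' \<in> J. torus_add N v (- \<zeta> t') = torus_add N v (- \<zeta> t)} \<subseteq> {..<s}" by (auto simp: J_def)
    ultimately have "card {t' \<in> J. torus_add N v (- \<zeta> t') = torus_add N v (- \<zeta> t)} \<le> card {..<s}"
      by (rule card_inj_on_le) simp
    thus "card {t' \<in> J. torus_add N v (- \<zeta> t') = torus_add N v (- \<zeta> t)} \<le> s" by simp
  qed
  have C0: "C\<^sub>0 > 0" unfolding C\<^sub>0_def using c by (intro add_pos_pos) auto
  have "E (\<lambda>\<eta>. \<Sum>x\<in>torus N. a x * om x (\<eta> x) * (box_mean Q x \<eta> - box_mean Q' x \<eta>))
     = (\<Sum>v\<in>torus N. E (\<lambda>\<eta>. \<kappa> * hh v \<eta> * (om (torus_add N v ?e) (\<eta> (torus_add N v ?e)) - om v (\<eta> v))))"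
    unfolding ident by (rule wmean_sum)
  also have "\<dots> \<le> (\<Sum>v\<in>torus N. \<delta> * dirichlet f v (torus_add N v ?e) + C\<^sub>0 / \<delta> * E (\<lambda>\<eta>. (\<kappa> * hh v \<eta>)\<^sup>2) + b ^ 4 * \<epsilon>\<^sup>2 * \<delta> / 2)"
  proof (rule sum_mono)
    fix v :: "'d site" assume v: "v \<in> torus N"
    show "E (\<lambda>\<eta>. \<kappa> * hh v \<eta> * (om (torus_add N v ?e) (\<eta> (torus_add N v ?e)) - om v (\<eta> v)))
       \<le> \<delta> * dirichlet f v (torus_add N v ?e) + C\<^sub>0 / \<delta> * E (\<lambda>\<eta>. (\<kappa> * hh v \<eta>)\<^sup>2) + b ^ 4 * \<epsilon>\<^sup>2 * \<delta> / 2"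
    proof (rule gradient_bound[OF v _ _ _ _ _ \<delta>])
      show "torus_add N v ?e \<in> torus N" using N0 by simp
      show "v \<noteq> torus_add N v ?e" using torus_add_axis_neq[OF v, of i] by metis
      show "\<bar>r v - r (torus_add N v ?e)\<bar> \<le> \<epsilon>" by (rule \<epsilon>[OF v])
      show "\<kappa> * hh v (move \<eta> v (torus_add N v ?e)) = \<kappa> * hh v \<eta>" for \<eta>
        by (subst inv[OF v]) auto
      show "\<kappa> * hh v (move \<eta> (torus_add N v ?e) v) = \<kappa> * hh v \<eta>" for \<eta>
        by (subst inv[OF v]) auto
    qed
  qed
  also have "\<dots> = \<delta> * (\<Sum>v\<in>torus N. dirichlet f v (torus_add N v ?e)) + C\<^sub>0 / \<delta> * (\<kappa>\<^sup>2 * (\<Sum>v\<in>torus N. E (\<lambda>\<eta>. (hh v \<eta>)\<^sup>2)))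
      + vol * (b ^ 4 * \<epsilon>\<^sup>2 * \<delta> / 2)"
    by (simp add: sum.distrib sum_distrib_left power_mult_distrib wmean_cmult vol_eq)
  also have "\<dots> \<le> \<delta> * total_dirichlet + C\<^sub>0 / \<delta> * (\<kappa>\<^sup>2 * (2 * A\<^sup>2 * (real (card J))\<^sup>2 * h + 2 * A\<^sup>2 * real (card J) * real s * B * vol))
      + vol * (b ^ 4 * \<epsilon>\<^sup>2 * \<delta> / 2)"
  proof (intro add_mono mult_left_mono sq order_refl)
    show "(\<Sum>v\<in>torus N. dirichlet f v (torus_add N v ?e)) \<le> total_dirichlet"
      unfolding total_dirichlet_def using dirichlet_nonneg
      by (intro member_le_sum[of i UNIV "\<lambda>i. \<Sum>v\<in>torus N. dirichlet f v (torus_add N v (axis i 1))"] sum_nonneg) auto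
  qed (use \<delta> C0 vol_eq in auto)
  also have "\<kappa>\<^sup>2 * (2 * A\<^sup>2 * (real (card J))\<^sup>2 * h + 2 * A\<^sup>2 * real (card J) * real s * B * vol)
     = A\<^sup>2 * ((2 ^ k)\<^sup>2 / 2 * h + (2 ^ k)\<^sup>2 / (2 * q) * B * vol)"
  proof -
    have "real s = 2 ^ k" by (simp add: s_def)
    thus ?thesis unfolding cJ \<kappa>_def using q by (simp add: field_simps power2_eq_square)
  qed
  finally show ?thesis unfolding q_def .
qed

text \<open>The scales k < n are traversed, and at each scale the d directions, starting from the
  one-point box at e_j. \<open>G\<close> bounds (2^k)^2 divided by the number of points in the box,
  that is 2^(k (2 - d)), so large scales increase the variance only for d = 1. The last box mean is
  left to \<open>quadratic_bound\<close>.\<close>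

lemma product_bound:
  fixes a :: "'d site \<Rightarrow> real" and j :: 'd
  assumes dec: "decomposed_field N \<Omega> \<mu> (\<lambda>x \<eta>. om x (\<eta> x)) m h B"
    and nN: "2 ^ n < N" and A: "\<And>x. x \<in> torus N \<Longrightarrow> \<bar>a x\<bar> \<le> A" and \<delta>: "\<delta> > 0"
    and G: "\<And>k. k < n \<Longrightarrow> (2 ^ k)\<^sup>2 \<le> G * 2 ^ (k * CARD('d))"
  shows "E (\<lambda>\<eta>. \<Sum>x\<in>torus N. a x * om x (\<eta> x) * om (torus_add N x (axis j 1)) (\<eta> (torus_add N x (axis j 1))))
     \<le> real (n * CARD('d)) * (\<delta> * total_dirichlet + C\<^sub>0 / \<delta> * (A\<^sup>2 * ((2 ^ n)\<^sup>2 * h + G * B * vol)) + vol * (b ^ 4 * \<epsilon>\<^sup>2 * \<delta> / 2))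
        + ((1 + A\<^sup>2) * h + 2 * A\<^sup>2 * B * vol / 2 ^ (n * CARD('d)))"
    (is "?L \<le> _ * ?R + _")
proof -
  interpret decomposed_field N \<Omega> \<mu> "\<lambda>x \<eta>. om x (\<eta> x)" m h B by (rule dec)
  have N0: "N > 0" using N by simp
  have C0: "C\<^sub>0 > 0" unfolding C\<^sub>0_def using c by (intro add_pos_pos) auto
  define R where "R = ?R"
  define V where "V = (\<lambda>k D. E (\<lambda>\<eta>. \<Sum>x\<in>torus N. a x * om x (\<eta> x) * box_mean (corner_box j k D) x \<eta>))"
  have step: "V k D \<le> R + V k (insert i D)" if k: "k < n" and i: "i \<notin> D" for k i D
  proof -
    have "2 ^ Suc k \<le> (2::nat) ^ n" using k by (intro power_increasing) auto
    hence kN: "2 ^ Suc k < N" using nN by simp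
    have "V k D - V k (insert i D) = E (\<lambda>\<eta>. \<Sum>x\<in>torus N. a x * om x (\<eta> x) * (box_mean (corner_box j k D) x \<eta> - box_mean (corner_box j k (insert i D)) x \<eta>))"
      unfolding V_def by (simp add: right_diff_distrib sum_subtractf wmean_diff)
    also have "\<dots> \<le> \<delta> * total_dirichlet + C\<^sub>0 / \<delta> * (A\<^sup>2 * ((2 ^ k)\<^sup>2 / 2 * h + (2 ^ k)\<^sup>2 / (2 * real (card (corner_box j k D))) * B * vol))
        + vol * (b ^ 4 * \<epsilon>\<^sup>2 * \<delta> / 2)"
      by (rule box_mean_step[OF dec i kN A \<delta>])
    also have "\<dots> \<le> ?R"
    proof (intro add_mono mult_left_mono mult_right_mono order_refl h_nonneg B_nonneg)
      have "(2 ^ k)\<^sup>2 / 2 \<le> (2 ^ k :: real)\<^sup>2" by simp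
      also have "\<dots> \<le> (2 ^ n)\<^sup>2" using k by (intro power_mono power_increasing) auto
      finally show "(2 ^ k)\<^sup>2 / 2 \<le> (2 ^ n :: real)\<^sup>2" .
      have "(2 ^ k)\<^sup>2 \<le> G * 2 ^ (k * CARD('d))" by (rule G[OF k])
      moreover have "(0::real) \<le> (2 ^ k)\<^sup>2" by simp
      ultimately have Gp: "0 \<le> G * 2 ^ (k * CARD('d))" by linarith
      have "2 ^ (k * CARD('d)) \<le> 2 * real (card (corner_box j k D))"
        unfolding card_corner_box using one_le_power[of "2::real" "card D"] by (simp, linarith)
      hence "(2 ^ k)\<^sup>2 / (2 * real (card (corner_box j k D))) \<le> (2 ^ k)\<^sup>2 / 2 ^ (k * CARD('d))"
        by (intro divide_left_mono mult_pos_pos) (auto simp: card_corner_box)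
      also have "\<dots> \<le> G" using G[OF k] by (simp add: divide_le_eq)
      finally show "(2 ^ k)\<^sup>2 / (2 * real (card (corner_box j k D))) \<le> G" .
    qed (use \<delta> C0 vol_eq in auto)
    finally show ?thesis by (simp add: R_def)
  qed
  have D: "V k {} \<le> real (card D) * R + V k D" if "k < n" for k D
    using finite[of D]
  proof (induction D rule: finite_induct)
    case (insert i D)
    show ?case using step[OF that insert(2)] insert by (simp add: algebra_simps)
  qed simp
  have "V 0 {} \<le> real (k * CARD('d)) * R + V k {}" if "k \<le> n" for k
    using that
  proof (induction k)
    case (Suc k)
    have "V k {} \<le> real (CARD('d)) * R + V (Suc k) {}"
      using D[of k UNIV] Suc.prems unfolding V_def corner_box_Suc by simp
    thus ?case using Suc by (simp add: algebra_simps)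
  qed simp
  from this[of n] have "V 0 {} \<le> real (n * CARD('d)) * R + V n {}" by simp
  moreover have "?L = V 0 {}" unfolding V_def corner_box_0 box_mean_def by simp
  moreover have "V n {} \<le> (1 + A\<^sup>2) * h + 2 * A\<^sup>2 * B * vol / 2 ^ (n * CARD('d))"
  proof -
    let ?Q = "corner_box j n {}"
    have coord: "1 \<le> z $ j \<and> z $ j \<le> 2 ^ n" if "z \<in> ?Q" for z
      using that unfolding corner_box_def mem_Collect_eq by (auto dest: spec[of _ j])
    have nN': "2 ^ n < int N" using nN by (metis of_nat_less_iff of_nat_numeral of_nat_power)
    have "V n {} \<le> (1 + A\<^sup>2) * h + 2 * A\<^sup>2 * B * vol / real (card ?Q)"
      unfolding V_def box_mean_def vol_eq
    proof (rule quadratic_bound[OF finite_corner_box _ A])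
      show "?Q \<noteq> {}" using card_corner_box[of j n "{}"] by auto
      fix z assume z: "z \<in> ?Q"
      show "torus_add N x z \<noteq> x" if "x \<in> torus N" for x
        using torus_add_eq_self_iff[OF N0 that, of z] coord[OF z] nN' by (smt (verit) zdvd_imp_le)
      show "z = z'" if "z' \<in> ?Q" "\<forall>i. int N dvd (z $ i - z' $ i)" for z'
      \<comment> \<open>For positive \<open>n\<close> the box is read as the fully doubled box of
        scale n - 1; its embedding into the torus then asks exactly for 2^n < N.\<close>
      proof (cases n)
        case 0
        thus ?thesis using z that by (simp add: corner_box_0)
      next
        case (Suc k)
        show ?thesis using z that unfolding Suc corner_box_Suc[symmetric]
          by (intro corner_box_diff_dvd_imp_eq[of z j k UNIV z' N]) (use nN Suc in auto)
      qed
    qed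
    thus ?thesis by (simp add: card_corner_box)
  qed
  ultimately show ?thesis unfolding R_def by simp
qed

end

subsection \<open>Entropy production\<close>

text \<open>The tangent bound of the logarithm is applied to the square roots, with ln b - ln a = 2
  ln (sqrt b / sqrt a). Applied to \<open>a\<close> and \<open>b\<close> directly it would lose the
  square, which becomes the Dirichlet form.\<close>

lemma mult_ln_diff_le:
  fixes a b :: real
  assumes "a > 0" "b > 0"
  shows "a * (ln b - ln a) \<le> b - a - (sqrt b - sqrt a)\<^sup>2"
proof -
  define s t where "s = sqrt a" and "t = sqrt b"
  have st: "s > 0" "t > 0" "a = s\<^sup>2" "b = t\<^sup>2" using assms by (auto simp: s_def t_def)
  have "ln (t / s) \<le> t / s - 1" using st by (intro ln_le_minus_one) auto
  hence "s\<^sup>2 * (2 * ln (t / s)) \<le> s\<^sup>2 * (2 * (t / s - 1))" by (intro mult_left_mono) auto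
  also have "\<dots> = 2 * s * t - 2 * s\<^sup>2" using st by (simp add: field_simps power2_eq_square)
  also have "\<dots> = t\<^sup>2 - s\<^sup>2 - (t - s)\<^sup>2" by (simp add: power2_eq_square algebra_simps)
  also have "s\<^sup>2 * (2 * ln (t / s)) = s\<^sup>2 * (ln (t\<^sup>2) - ln (s\<^sup>2))" using st by (simp add: ln_div ln_realpow)
  finally show ?thesis using st by simp
qed

lemma torus_add_dir_neq:
  assumes "N > 1" "x \<in> torus N"
  shows "torus_add N x (dir i) \<noteq> x"
proof (cases i)
  case (Inl j)
  thus ?thesis using assms torus_add_eq_self_iff[of N x "axis j 1"] by (auto simp: axis_def)
next
  case (Inr j)
  thus ?thesis using assms torus_add_eq_self_iff[of N x "- axis j 1"] by (auto simp: axis_def)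
qed

text \<open>Mean net inflow at \<open>x\<close> under the product measure with profile
  \<open>r\<close>: different sites are independent, so the mean rate from x to y is p i times r x
  (K - r y).\<close>

definition current_divergence :: "nat \<Rightarrow> ('d::finite + 'd \<Rightarrow> real) \<Rightarrow> nat \<Rightarrow> ('d site \<Rightarrow> real) \<Rightarrow> 'd site \<Rightarrow> real" where
  "current_divergence K p N r x = (\<Sum>i\<in>UNIV. p i *
     (r (torus_add N x (- dir i)) * (real K - r x) - r x * (real K - r (torus_add N x (dir i)))))"

context lattice_gas
begin

text \<open>The left-hand side is the adjoint of the generator in L2 of the product measure, applied to
  the constant function 1.\<close>

lemma adjoint_one_expansion:
  "(\<Sum>i\<in>UNIV. \<Sum>x\<in>torus N. p i * (odds x (torus_add N x (dir i)) * jump (torus_add N x (dir i)) x \<eta> - jump x (torus_add N x (dir i)) \<eta>))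
   = (\<Sum>x\<in>torus N. real K * current_divergence K p N r x * om x (\<eta> x))
     + (\<Sum>j\<in>UNIV. \<Sum>x\<in>torus N. real K * (r (torus_add N x (axis j 1)) - r x) *
          (p (Inl j) * (r x * (real K - r (torus_add N x (axis j 1)))) - p (Inr j) * (r (torus_add N x (axis j 1)) * (real K - r x))) *
          om x (\<eta> x) * om (torus_add N x (axis j 1)) (\<eta> (torus_add N x (axis j 1))))"
proof -
  have N0: "N > 0" using N by simp
  let ?y = "\<lambda>x i. torus_add N x (dir i)"
  define F where "F = (\<lambda>x. om x (\<eta> x))"
  define T where "T = (\<lambda>i x. p i * real K * (r x * (real K - r (?y x i))))"
  have "(\<Sum>i\<in>UNIV. \<Sum>x\<in>torus N. p i * (odds x (?y x i) * jump (?y x i) x \<eta> - jump x (?y x i) \<eta>))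
     = (\<Sum>i\<in>UNIV. \<Sum>x\<in>torus N. T i x * (F (?y x i) - F x) + T i x * (r (?y x i) - r x) * F x * F (?y x i))"
  proof (intro sum.cong refl)
    fix i and x :: "'d site" assume x: "x \<in> torus N"
    have "?y x i \<in> torus N" using N0 by simp
    thus "p i * (odds x (?y x i) * jump (?y x i) x \<eta> - jump x (?y x i) \<eta>)
      = T i x * (F (?y x i) - F x) + T i x * (r (?y x i) - r x) * F x * F (?y x i)"
      unfolding jump_antisym[OF x \<open>?y x i \<in> torus N\<close>] T_def F_def by (simp add: algebra_simps)
  qed
  also have "\<dots> = (\<Sum>i\<in>UNIV. (\<Sum>x\<in>torus N. T i x * (F (?y x i) - F x)))
      + (\<Sum>i\<in>UNIV. \<Sum>x\<in>torus N. T i x * (r (?y x i) - r x) * F x * F (?y x i))"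
    by (simp add: sum.distrib)
  \<comment> \<open>Summation by parts moves the gradient from \<open>F\<close> to the coefficients,
    which turns the bond terms into a divergence.\<close>
  also have "(\<Sum>i\<in>UNIV. (\<Sum>x\<in>torus N. T i x * (F (?y x i) - F x))) = (\<Sum>x\<in>torus N. real K * current_divergence K p N r x * F x)"
  proof -
    have "(\<Sum>x\<in>torus N. T i x * (F (?y x i) - F x)) =
       (\<Sum>x\<in>torus N. real K * (p i * (r (torus_add N x (- dir i)) * (real K - r x) - r x * (real K - r (?y x i)))) * F x)" for i
    proof -
      have "(\<Sum>x\<in>torus N. T i x * F (?y x i)) = (\<Sum>x\<in>torus N. T i (torus_add N x (- dir i)) * F x)"
        by (subst (2) sum_torus_shift[OF N0, where z = "dir i", symmetric]) (auto simp: torus_add_assoc intro!: sum.cong)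
      also have "\<dots> = (\<Sum>x\<in>torus N. p i * real K * (r (torus_add N x (- dir i)) * (real K - r x)) * F x)"
        by (intro sum.cong refl) (simp add: T_def torus_add_assoc)
      finally show ?thesis by (simp add: right_diff_distrib sum_subtractf T_def) (simp add: algebra_simps flip: sum_subtractf)
    qed
    hence "(\<Sum>i\<in>UNIV. (\<Sum>x\<in>torus N. T i x * (F (?y x i) - F x))) = (\<Sum>i\<in>UNIV. \<Sum>x\<in>torus N. real K * (p i * (r (torus_add N x (- dir i)) * (real K - r x) - r x * (real K - r (?y x i)))) * F x)"
      by simp
    also have "\<dots> = (\<Sum>x\<in>torus N. real K * current_divergence K p N r x * F x)"
      unfolding current_divergence_def sum_distrib_left sum_distrib_right by (rule sum.swap)
    finally show ?thesis .
  qed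
  also have "(\<Sum>i\<in>UNIV. \<Sum>x\<in>torus N. T i x * (r (?y x i) - r x) * F x * F (?y x i))
    = (\<Sum>j\<in>UNIV. \<Sum>x\<in>torus N. real K * (r (torus_add N x (axis j 1)) - r x) *
          (p (Inl j) * (r x * (real K - r (torus_add N x (axis j 1)))) - p (Inr j) * (r (torus_add N x (axis j 1)) * (real K - r x))) *
          F x * F (torus_add N x (axis j 1)))"
  proof -
    \<comment> \<open>Shifting by e_j describes the jumps in direction - e_j from the same end of
      the bond, so that each bond occurs once, with both of its rates.\<close>
    have inr: "(\<Sum>x\<in>torus N. T (Inr j) x * (r (?y x (Inr j)) - r x) * F x * F (?y x (Inr j)))
      = (\<Sum>x\<in>torus N. p (Inr j) * real K * (r (torus_add N x (axis j 1)) * (real K - r x)) * (r x - r (torus_add N x (axis j 1))) * F (torus_add N x (axis j 1)) * F x)" for j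
      by (subst sum_torus_shift[OF N0, where z = "axis j 1", symmetric])
         (auto simp: torus_add_assoc T_def intro!: sum.cong)
    show ?thesis unfolding sum_UNIV_Plus inr sum.distrib[symmetric]
      by (intro sum.cong refl) (simp add: T_def algebra_simps)
  qed
  finally show ?thesis unfolding F_def .
qed

end

section \<open>The derivative of the entropy in time\<close>

context entropy_setting
begin

lemma \<mu>_eq: "\<eta> \<in> \<Omega> \<Longrightarrow> \<mu> \<eta> = \<nu> \<eta> * f \<eta>"
  using \<nu>_pos[of \<eta>] by (simp add: f_def)

text \<open>\<open>mult_ln_diff_le\<close> yields one Dirichlet form for each oriented bond,
  weighted by its rate. One of two opposite rates may vanish, but by \<open>dirichlet_swap\<close>
  either orientation controls the bond; the lower bound 1/2 on the odds explains the half in the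
  condition on \<open>c0\<close>.\<close>

lemma entropy_production:
  assumes p: "\<And>i. p i \<ge> 0" and c0: "\<And>j. c0 \<le> (p (Inl j) + p (Inr j)) / 2"
  shows "E (generator K p N (\<lambda>\<eta>. ln (f \<eta>)))
     \<le> E (\<lambda>\<eta>. \<Sum>i\<in>UNIV. \<Sum>x\<in>torus N. p i * (odds x (torus_add N x (dir i)) * jump (torus_add N x (dir i)) x \<eta> - jump x (torus_add N x (dir i)) \<eta>))
       - c0 * total_dirichlet"
proof -
  have N0: "N > 0" using N by simp
  let ?y = "\<lambda>x i. torus_add N x (dir i)"
  have y: "?y x i \<in> torus N" "x \<in> torus N \<Longrightarrow> x \<noteq> ?y x i" for x i
    using N0 torus_add_dir_neq[OF N, of x i] by auto
  have one: "E (\<lambda>\<eta>. jump x y \<eta> * (ln (f (move \<eta> x y)) - ln (f \<eta>)))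
     \<le> E (\<lambda>\<eta>. odds x y * jump y x \<eta> - jump x y \<eta>) - dirichlet f x y"
    if xy: "x \<in> torus N" "y \<in> torus N" "x \<noteq> y" for x y
  proof -
    have "E (\<lambda>\<eta>. jump x y \<eta> * (ln (f (move \<eta> x y)) - ln (f \<eta>)))
       \<le> (\<Sum>\<eta>\<in>\<Omega>. \<nu> \<eta> * (jump x y \<eta> * (f (move \<eta> x y) - f \<eta> - (sqrt (f (move \<eta> x y)) - sqrt (f \<eta>))\<^sup>2)))"
      unfolding wmean_def
    proof (rule sum_mono)
      fix \<eta> assume \<eta>: "\<eta> \<in> \<Omega>"
      show "\<mu> \<eta> * (jump x y \<eta> * (ln (f (move \<eta> x y)) - ln (f \<eta>)))
        \<le> \<nu> \<eta> * (jump x y \<eta> * (f (move \<eta> x y) - f \<eta> - (sqrt (f (move \<eta> x y)) - sqrt (f \<eta>))\<^sup>2))"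
      proof (cases "\<eta> x > 0 \<and> \<eta> y < K")
        case True
        have "\<nu> \<eta> * (jump x y \<eta> * (f \<eta> * (ln (f (move \<eta> x y)) - ln (f \<eta>))))
          \<le> \<nu> \<eta> * (jump x y \<eta> * (f (move \<eta> x y) - f \<eta> - (sqrt (f (move \<eta> x y)) - sqrt (f \<eta>))\<^sup>2))"
          using \<nu>_pos[OF \<eta>] jump_nonneg[OF \<eta>] f_pos[OF \<eta>] f_pos[OF move_in_\<Omega>[OF \<eta> xy]] True
          by (intro mult_left_mono mult_ln_diff_le) auto
        thus ?thesis by (simp add: \<mu>_eq[OF \<eta>] mult_ac)
      qed (simp add: jump_eq_0[OF \<eta>])
    qed
    also have "\<dots> = (\<Sum>\<eta>\<in>\<Omega>. \<nu> \<eta> * (jump x y \<eta> * f (move \<eta> x y))) - (\<Sum>\<eta>\<in>\<Omega>. \<nu> \<eta> * (jump x y \<eta> * f \<eta>)) - dirichlet f x y"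
      unfolding dirichlet_def by (simp add: algebra_simps flip: sum_subtractf sum.distrib)
    also have "(\<Sum>\<eta>\<in>\<Omega>. \<nu> \<eta> * (jump x y \<eta> * f (move \<eta> x y))) = (\<Sum>\<eta>\<in>\<Omega>. \<nu> \<eta> * (odds x y * jump y x \<eta> * f \<eta>))"
      by (rule change_of_variables[OF xy, of "\<lambda>\<eta> \<zeta>. f \<zeta>"])
    also have "\<dots> - (\<Sum>\<eta>\<in>\<Omega>. \<nu> \<eta> * (jump x y \<eta> * f \<eta>)) = E (\<lambda>\<eta>. odds x y * jump y x \<eta> - jump x y \<eta>)"
      unfolding wmean_def sum_subtractf[symmetric] by (intro sum.cong refl) (simp add: \<mu>_eq algebra_simps)
    finally show ?thesis .
  qed
  have "E (generator K p N (\<lambda>\<eta>. ln (f \<eta>))) = (\<Sum>i\<in>UNIV. \<Sum>x\<in>torus N. p i * E (\<lambda>\<eta>. jump x (?y x i) \<eta> * (ln (f (move \<eta> x (?y x i))) - ln (f \<eta>))))"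
    unfolding generator_def wmean_sum rate_def jump_def mult.assoc wmean_cmult ..
  also have "\<dots> \<le> (\<Sum>i\<in>UNIV. \<Sum>x\<in>torus N. p i * (E (\<lambda>\<eta>. odds x (?y x i) * jump (?y x i) x \<eta> - jump x (?y x i) \<eta>) - dirichlet f x (?y x i)))"
    by (intro sum_mono mult_left_mono one y p)
  also have "\<dots> = (\<Sum>i\<in>UNIV. \<Sum>x\<in>torus N. p i * E (\<lambda>\<eta>. odds x (?y x i) * jump (?y x i) x \<eta> - jump x (?y x i) \<eta>))
     - (\<Sum>i\<in>UNIV. \<Sum>x\<in>torus N. p i * dirichlet f x (?y x i))"
    by (simp add: right_diff_distrib sum_subtractf)
  also have "(\<Sum>i\<in>UNIV. \<Sum>x\<in>torus N. p i * E (\<lambda>\<eta>. odds x (?y x i) * jump (?y x i) x \<eta> - jump x (?y x i) \<eta>))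
     = E (\<lambda>\<eta>. \<Sum>i\<in>UNIV. \<Sum>x\<in>torus N. p i * (odds x (?y x i) * jump (?y x i) x \<eta> - jump x (?y x i) \<eta>))"
    unfolding wmean_sum wmean_cmult ..
  also have "E (\<lambda>\<eta>. \<Sum>i\<in>UNIV. \<Sum>x\<in>torus N. p i * (odds x (?y x i) * jump (?y x i) x \<eta> - jump x (?y x i) \<eta>)) - (\<Sum>i\<in>UNIV. \<Sum>x\<in>torus N. p i * dirichlet f x (?y x i))
    \<le> E (\<lambda>\<eta>. \<Sum>i\<in>UNIV. \<Sum>x\<in>torus N. p i * (odds x (?y x i) * jump (?y x i) x \<eta> - jump x (?y x i) \<eta>)) - c0 * total_dirichlet"
  proof (intro diff_mono order_refl)
    have inr: "(\<Sum>x\<in>torus N. p (Inr j) * dirichlet f x (?y x (Inr j)))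
       = (\<Sum>x\<in>torus N. p (Inr j) * dirichlet f (torus_add N x (axis j 1)) x)" for j
      by (subst sum_torus_shift[OF N0, where z = "axis j 1", symmetric]) (auto simp: torus_add_assoc intro!: sum.cong)
    have "c0 * total_dirichlet = (\<Sum>j\<in>UNIV. \<Sum>x\<in>torus N. c0 * dirichlet f x (torus_add N x (axis j 1)))"
      by (simp add: total_dirichlet_def sum_distrib_left)
    also have "\<dots> \<le> (\<Sum>j\<in>UNIV. \<Sum>x\<in>torus N. p (Inl j) * dirichlet f x (torus_add N x (axis j 1)) + p (Inr j) * dirichlet f (torus_add N x (axis j 1)) x)"
    proof (intro sum_mono)
      fix j and x :: "'d site" assume x: "x \<in> torus N"
      let ?z = "torus_add N x (axis j 1)"
      have z: "?z \<in> torus N" using N0 by simp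
      have "c0 * dirichlet f x ?z \<le> (p (Inl j) + p (Inr j)) / 2 * dirichlet f x ?z"
        using c0 dirichlet_nonneg by (intro mult_right_mono) auto
      also have "\<dots> \<le> (p (Inl j) + p (Inr j) * odds ?z x) * dirichlet f x ?z"
      proof (intro mult_right_mono dirichlet_nonneg)
        have "p (Inr j) * (1 / 2) \<le> p (Inr j) * odds ?z x" using odds_ge[OF z x] p by (intro mult_left_mono) auto
        thus "(p (Inl j) + p (Inr j)) / 2 \<le> p (Inl j) + p (Inr j) * odds ?z x" using p[of "Inl j"] by simp
      qed
      also have "\<dots> = p (Inl j) * dirichlet f x ?z + p (Inr j) * dirichlet f ?z x"
        using dirichlet_swap[OF x z, of f] torus_add_axis_neq[OF x, of j] by (simp add: algebra_simps eq_commute)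
      finally show "c0 * dirichlet f x ?z \<le> p (Inl j) * dirichlet f x ?z + p (Inr j) * dirichlet f ?z x" .
    qed
    also have "\<dots> = (\<Sum>i\<in>UNIV. \<Sum>x\<in>torus N. p i * dirichlet f x (?y x i))"
      unfolding sum_UNIV_Plus inr sum.distrib[symmetric] by simp
    finally show "c0 * total_dirichlet \<le> (\<Sum>i\<in>UNIV. \<Sum>x\<in>torus N. p i * dirichlet f x (?y x i))" .
  qed
  finally show ?thesis .
qed

text \<open>The subtracted mean comes from the motion of the reference measure, \<open>r'\<close>
  being the speed of the profile. It is paired with the divergence term of the expansion, so that
  only the defect \<open>\<beta>\<close> of the discrete hydrodynamic equation is left in front of
  \<open>om\<close>.\<close>

lemma entropy_rate_bound:
  fixes r' :: "'d site \<Rightarrow> real" and n :: nat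
  assumes p: "\<And>i. p i \<ge> 0" and c0: "c0 > 0" "\<And>j. c0 \<le> (p (Inl j) + p (Inr j)) / 2"
    and \<Gamma>: "\<Gamma> > 0"
    and \<beta>: "\<And>x. x \<in> torus N \<Longrightarrow> \<bar>real K * (\<Gamma> * current_divergence K p N r x - r' x)\<bar> \<le> \<beta>"
    and nN: "2 ^ n < N" and G0: "0 \<le> G" and G: "\<And>k. k < n \<Longrightarrow> (2 ^ k)\<^sup>2 \<le> G * 2 ^ (k * CARD('d))"
  defines "P \<equiv> \<Sum>i\<in>UNIV. p i" and "A \<equiv> (\<Sum>i\<in>UNIV. p i) * real K ^ 3 * \<epsilon> * \<Gamma>" and "H \<equiv> kl \<Omega> \<mu> \<nu>" and "nd \<equiv> real (n * CARD('d)) + 1"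
    and "d \<equiv> real CARD('d)"
  shows "\<Gamma> * E (generator K p N (\<lambda>\<eta>. ln (f \<eta>))) - E (\<lambda>\<eta>. \<Sum>x\<in>torus N. real K * r' x * om x (\<eta> x))
     \<le> (4 * b\<^sup>2) * H / 2 + vol * \<beta>\<^sup>2 / 2 
       + d * (nd * (C\<^sub>0 * (nd * d) / (\<Gamma> * c0) * (A\<^sup>2 * ((2 ^ n)\<^sup>2 * (4 * b\<^sup>2 * H) + G * (4 * b\<^sup>2) * vol)) + vol * (b ^ 4 * \<epsilon>\<^sup>2 * (\<Gamma> * c0 / (nd * d)) / 2))
           + ((1 + A\<^sup>2) * (4 * b\<^sup>2 * H) + 2 * A\<^sup>2 * (4 * b\<^sup>2) * vol / 2 ^ (n * CARD('d))))"
proof -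
  obtain m where dec: "decomposed_field N \<Omega> \<mu> (\<lambda>x \<eta>. om x (\<eta> x)) m (4 * b\<^sup>2 * kl \<Omega> \<mu> \<nu>) (4 * b\<^sup>2)"
    by (rule decomposition)
  interpret decomposed_field N \<Omega> \<mu> "\<lambda>x \<eta>. om x (\<eta> x)" m "4 * b\<^sup>2 * H" "4 * b\<^sup>2"
    unfolding H_def by (rule dec)
  have N0: "N > 0" using N by simp
  have C0: "C\<^sub>0 > 0" unfolding C\<^sub>0_def using c by (intro add_pos_pos) auto
  have d: "d > 0" unfolding d_def by simp
  have nd: "nd > 0" unfolding nd_def by (simp add: add_nonneg_pos)
  \<comment> \<open>Chosen so that the d quadratic sums, each charged with \<open>nd\<close>
    replacement steps, together spend exactly the available multiple \<open>\<Gamma> * c0\<close> of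
    the Dirichlet form. The 1 in \<open>nd\<close> keeps the denominator positive when n =
    0.\<close>
  define \<delta> where "\<delta> = \<Gamma> * c0 / (nd * d)"
  have \<delta>: "\<delta> > 0" unfolding \<delta>_def using \<Gamma> c0 d nd by simp
  define a where "a = (\<lambda>j x. \<Gamma> * (real K * (r (torus_add N x (axis j 1)) - r x) *
          (p (Inl j) * (r x * (real K - r (torus_add N x (axis j 1)))) - p (Inr j) * (r (torus_add N x (axis j 1)) * (real K - r x)))))"
  have aA: "\<bar>a j x\<bar> \<le> A" if x: "x \<in> torus N" for j x
  proof -
    let ?z = "torus_add N x (axis j 1)"
    have z: "?z \<in> torus N" using N0 by simp
    have b1: "r x * (real K - r ?z) \<le> real K * real K" "0 \<le> r x * (real K - r ?z)" "r ?z * (real K - r x) \<le> real K * real K" "0 \<le> r ?z * (real K - r x)"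
      using r_pos[OF x] r_pos[OF z] r_less[OF x] r_less[OF z] by (auto intro!: mult_mono mult_nonneg_nonneg)
    have "\<bar>p (Inl j) * (r x * (real K - r ?z)) - p (Inr j) * (r ?z * (real K - r x))\<bar>
       \<le> \<bar>p (Inl j) * (r x * (real K - r ?z))\<bar> + \<bar>p (Inr j) * (r ?z * (real K - r x))\<bar>" by (rule abs_triangle_ineq4)
    also have "\<dots> \<le> p (Inl j) * (real K * real K) + p (Inr j) * (real K * real K)"
      using b1 p by (intro add_mono) (auto simp: abs_mult intro!: mult_left_mono)
    also have "\<dots> = (p (Inl j) + p (Inr j)) * (real K * real K)" by (simp add: algebra_simps)
    also have "\<dots> \<le> P * (real K * real K)"
    proof (intro mult_right_mono)
      have "(\<Sum>i\<in>{Inl j, Inr j}. p i) \<le> P" unfolding P_def using p by (intro sum_mono2) auto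
      thus "p (Inl j) + p (Inr j) \<le> P" by simp
    qed simp
    finally have 1: "\<bar>p (Inl j) * (r x * (real K - r ?z)) - p (Inr j) * (r ?z * (real K - r x))\<bar> \<le> P * (real K * real K)" .
    have 2: "\<bar>r ?z - r x\<bar> \<le> \<epsilon>" using \<epsilon>[OF x, of j] by (simp add: abs_minus_commute)
    have "\<bar>a j x\<bar> \<le> \<Gamma> * ((real K * \<epsilon>) * (P * (real K * real K)))"
      unfolding a_def abs_mult using 1 2 \<Gamma> \<epsilon>_nonneg by (intro mult_mono mult_nonneg_nonneg) auto
    also have "\<dots> = A" unfolding A_def P_def by (simp add: power3_eq_cube algebra_simps)
    finally show ?thesis .
  qed
  define R where "R = C\<^sub>0 / \<delta> * (A\<^sup>2 * ((2 ^ n)\<^sup>2 * (4 * b\<^sup>2 * H) + G * (4 * b\<^sup>2) * vol)) + vol * (b ^ 4 * \<epsilon>\<^sup>2 * \<delta> / 2)"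
  define Y where "Y = (1 + A\<^sup>2) * (4 * b\<^sup>2 * H) + 2 * A\<^sup>2 * (4 * b\<^sup>2) * vol / 2 ^ (n * CARD('d))"
  have TD: "0 \<le> total_dirichlet" unfolding total_dirichlet_def using dirichlet_nonneg by (intro sum_nonneg)
  have R: "0 \<le> R"
  proof -
    have "0 \<le> G * (4 * b\<^sup>2) * vol" using G0 by (simp add: vol_eq)
    moreover have "0 \<le> H" using h_nonneg b by (simp add: zero_le_mult_iff)
    ultimately show ?thesis unfolding R_def using G0 C0 \<delta> h_nonneg vol_eq \<epsilon>_nonneg b
      by (intro add_nonneg_nonneg mult_nonneg_nonneg) auto
  qed
  have quad: "E (\<lambda>\<eta>. \<Sum>x\<in>torus N. a j x * om x (\<eta> x) * om (torus_add N x (axis j 1)) (\<eta> (torus_add N x (axis j 1))))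
     \<le> nd * (\<delta> * total_dirichlet + R) + Y" for j
  proof -
    have "E (\<lambda>\<eta>. \<Sum>x\<in>torus N. a j x * om x (\<eta> x) * om (torus_add N x (axis j 1)) (\<eta> (torus_add N x (axis j 1))))
      \<le> real (n * CARD('d)) * (\<delta> * total_dirichlet + R) + Y"
      using product_bound[OF dec nN aA \<delta> G] unfolding R_def Y_def H_def by (simp add: add.assoc)
    also have "\<dots> \<le> nd * (\<delta> * total_dirichlet + R) + Y"
      using \<delta> TD R by (intro add_right_mono mult_right_mono) (auto simp: nd_def)
    finally show ?thesis .
  qed
  have lin: "E (\<lambda>\<eta>. \<Sum>x\<in>torus N. real K * (\<Gamma> * current_divergence K p N r x - r' x) * om x (\<eta> x))
     \<le> 4 * b\<^sup>2 * H / 2 + vol * \<beta>\<^sup>2 / 2"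
  proof -
    have "(\<Sum>x\<in>torus N. (real K * (\<Gamma> * current_divergence K p N r x - r' x))\<^sup>2) \<le> (\<Sum>x\<in>(torus N :: 'd site set). \<beta>\<^sup>2)"
      using \<beta>[THEN order_trans[OF _ abs_ge_self]] by (intro sum_mono) (simp only: abs_le_square_iff)
    also have "\<dots> = vol * \<beta>\<^sup>2" by (simp add: vol_eq)
    finally show ?thesis using linear_bound[of "\<lambda>x. real K * (\<Gamma> * current_divergence K p N r x - r' x)"] by simp
  qed
  have "\<Gamma> * E (generator K p N (\<lambda>\<eta>. ln (f \<eta>))) - E (\<lambda>\<eta>. \<Sum>x\<in>torus N. real K * r' x * om x (\<eta> x))
     \<le> \<Gamma> * (E (\<lambda>\<eta>. (\<Sum>x\<in>torus N. real K * current_divergence K p N r x * om x (\<eta> x))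
     + (\<Sum>j\<in>UNIV. \<Sum>x\<in>torus N. real K * (r (torus_add N x (axis j 1)) - r x) *
          (p (Inl j) * (r x * (real K - r (torus_add N x (axis j 1)))) - p (Inr j) * (r (torus_add N x (axis j 1)) * (real K - r x))) *
          om x (\<eta> x) * om (torus_add N x (axis j 1)) (\<eta> (torus_add N x (axis j 1))))) - c0 * total_dirichlet)
      - E (\<lambda>\<eta>. \<Sum>x\<in>torus N. real K * r' x * om x (\<eta> x))"
    using entropy_production[OF p c0(2), unfolded adjoint_one_expansion] \<Gamma>
    by (intro diff_right_mono mult_left_mono) auto
  also have "\<dots> = E (\<lambda>\<eta>. \<Sum>x\<in>torus N. real K * (\<Gamma> * current_divergence K p N r x - r' x) * om x (\<eta> x))
     + (\<Sum>j\<in>UNIV. E (\<lambda>\<eta>. \<Sum>x\<in>torus N. a j x * om x (\<eta> x) * om (torus_add N x (axis j 1)) (\<eta> (torus_add N x (axis j 1)))))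
     - \<Gamma> * c0 * total_dirichlet"
  proof -
    have gen: "\<Gamma> * (E (\<lambda>\<eta>. U \<eta> + V \<eta>) - c0 * t) - E W = S + S' - \<Gamma> * c0 * t"
      if "E (\<lambda>\<eta>. \<Gamma> * U \<eta> - W \<eta>) = S" "E (\<lambda>\<eta>. \<Gamma> * V \<eta>) = S'" for U V W S S' t
      unfolding that[symmetric] by (simp add: wmean_add wmean_diff wmean_cmult algebra_simps)
    have S:  "E (\<lambda>\<eta>. \<Gamma> * (\<Sum>x\<in>torus N. real K * current_divergence K p N r x * om x (\<eta> x)) - (\<Sum>x\<in>torus N. real K * r' x * om x (\<eta> x)))
       = E (\<lambda>\<eta>. \<Sum>x\<in>torus N. real K * (\<Gamma> * current_divergence K p N r x - r' x) * om x (\<eta> x))"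
      by (simp add: sum_distrib_left algebra_simps flip: sum_subtractf)
    have S': "E (\<lambda>\<eta>. \<Gamma> * (\<Sum>j\<in>UNIV. \<Sum>x\<in>torus N. real K * (r (torus_add N x (axis j 1)) - r x) *
          (p (Inl j) * (r x * (real K - r (torus_add N x (axis j 1)))) - p (Inr j) * (r (torus_add N x (axis j 1)) * (real K - r x))) *
          om x (\<eta> x) * om (torus_add N x (axis j 1)) (\<eta> (torus_add N x (axis j 1)))))
       = (\<Sum>j\<in>UNIV. E (\<lambda>\<eta>. \<Sum>x\<in>torus N. a j x * om x (\<eta> x) * om (torus_add N x (axis j 1)) (\<eta> (torus_add N x (axis j 1)))))"
      unfolding wmean_sum[of _ _ _ UNIV, symmetric] a_def sum_distrib_left mult.assoc ..
    show ?thesis by (rule gen[OF S S'])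
  qed
  also have "\<dots> \<le> (4 * b\<^sup>2 * H / 2 + vol * \<beta>\<^sup>2 / 2) + (\<Sum>j\<in>(UNIV :: 'd set). nd * (\<delta> * total_dirichlet + R) + Y) - \<Gamma> * c0 * total_dirichlet"
    by (intro diff_right_mono add_mono sum_mono lin quad)
  also have "(\<Sum>j\<in>(UNIV :: 'd set). nd * (\<delta> * total_dirichlet + R) + Y) = \<Gamma> * c0 * total_dirichlet + d * (nd * R + Y)"
  proof -
    have "d * (nd * (\<delta> * total_dirichlet)) = \<Gamma> * c0 * total_dirichlet" using d nd by (simp add: \<delta>_def)
    moreover have "(\<Sum>j\<in>(UNIV :: 'd set). nd * (\<delta> * total_dirichlet + R) + Y) = d * (nd * (\<delta> * total_dirichlet + R) + Y)"
      unfolding d_def by simp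
    ultimately show ?thesis by (simp add: algebra_simps)
  qed
  finally show ?thesis unfolding R_def Y_def \<delta>_def using d nd by (simp add: field_simps)
qed

end

subsection \<open>Forward equation\<close>

text \<open>A matrix on the finite set \<open>S\<close> in disguise, with entries
  \<open>L (indicator {\<zeta>}) \<eta>\<close>. Functions live on an infinite type, hence the
  congruence assumption: values outside \<open>S\<close> must not influence values inside.\<close>

locale finite_generator =
  fixes S :: "'s set" and L :: "('s \<Rightarrow> real) \<Rightarrow> 's \<Rightarrow> real"
  assumes finite_S: "finite S"
    and L_cong: "\<And>u v \<eta>. (\<And>\<zeta>. \<zeta> \<in> S \<Longrightarrow> u \<zeta> = v \<zeta>) \<Longrightarrow> \<eta> \<in> S \<Longrightarrow> L u \<eta> = L v \<eta>"
    and L_add: "\<And>u v \<eta>. L (\<lambda>\<zeta>. u \<zeta> + v \<zeta>) \<eta> = L u \<eta> + L v \<eta>"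
    and L_scale: "\<And>a u \<eta>. L (\<lambda>\<zeta>. a * u \<zeta>) \<eta> = a * L u \<eta>"
begin

lemma L_sum: "finite I \<Longrightarrow> L (\<lambda>\<zeta>. \<Sum>i\<in>I. u i \<zeta>) \<eta> = (\<Sum>i\<in>I. L (u i) \<eta>)"
proof (induction I rule: finite_induct)
  case empty
  show ?case using L_scale[of 0 "\<lambda>_. 0" \<eta>] by simp
qed (simp add: L_add)

lemma L_expand:
  assumes "\<eta> \<in> S"
  shows "L u \<eta> = (\<Sum>\<zeta>\<in>S. u \<zeta> * L (indicator {\<zeta>}) \<eta>)"
proof -
  have "L u \<eta> = L (\<lambda>\<xi>. \<Sum>\<zeta>\<in>S. u \<zeta> * indicator {\<zeta>} \<xi>) \<eta>"
    using finite_S assms by (intro L_cong) (simp_all add: indicator_def sum.delta if_distrib cong: if_cong)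
  also have "\<dots> = (\<Sum>\<zeta>\<in>S. u \<zeta> * L (indicator {\<zeta>}) \<eta>)"
    unfolding L_sum[OF finite_S] L_scale ..
  finally show ?thesis .
qed

definition "L_bound = (\<Sum>\<eta>\<in>S. \<Sum>\<zeta>\<in>S. \<bar>L (indicator {\<zeta>}) \<eta>\<bar>)"

lemma L_bound_nonneg: "0 \<le> L_bound"
  unfolding L_bound_def by (intro sum_nonneg) auto

lemma L_power_bound:
  assumes "\<And>\<eta>. \<eta> \<in> S \<Longrightarrow> \<bar>u \<eta>\<bar> \<le> a" "a \<ge> 0" "\<eta> \<in> S"
  shows "\<bar>(L ^^ n) u \<eta>\<bar> \<le> L_bound ^ n * a"
  using assms(3)
proof (induction n arbitrary: \<eta>)
  case (Suc n)
  have "(L ^^ Suc n) u \<eta> = (\<Sum>\<zeta>\<in>S. (L ^^ n) u \<zeta> * L (indicator {\<zeta>}) \<eta>)"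
    using L_expand[OF Suc.prems, of "(L ^^ n) u"] by simp
  hence "\<bar>(L ^^ Suc n) u \<eta>\<bar> \<le> (\<Sum>\<zeta>\<in>S. \<bar>(L ^^ n) u \<zeta> * L (indicator {\<zeta>}) \<eta>\<bar>)"
    by (simp only: sum_abs)
  also have "\<dots> = (\<Sum>\<zeta>\<in>S. \<bar>(L ^^ n) u \<zeta>\<bar> * \<bar>L (indicator {\<zeta>}) \<eta>\<bar>)" by (simp only: abs_mult)
  also have "\<dots> \<le> (\<Sum>\<zeta>\<in>S. (L_bound ^ n * a) * \<bar>L (indicator {\<zeta>}) \<eta>\<bar>)"
    using Suc by (intro sum_mono mult_right_mono) auto
  also have "\<dots> = (L_bound ^ n * a) * (\<Sum>\<zeta>\<in>S. \<bar>L (indicator {\<zeta>}) \<eta>\<bar>)" by (simp add: sum_distrib_left)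
  also have "\<dots> \<le> (L_bound ^ n * a) * L_bound"
    unfolding L_bound_def[symmetric] using L_bound_nonneg assms(2) finite_S Suc.prems
    by (intro mult_left_mono) (auto simp: L_bound_def intro!: member_le_sum[of \<eta> S "\<lambda>\<eta>. \<Sum>\<zeta>\<in>S. \<bar>L (indicator {\<zeta>}) \<eta>\<bar>"] sum_nonneg)
  finally show ?case by (simp add: mult_ac)
qed (use assms(1) in simp)

lemma exp_semigroup_summable:
  assumes "\<eta> \<in> S"
  shows "summable (\<lambda>n. (L ^^ n) u \<eta> / fact n * t ^ n)"
proof (rule summable_comparison_test')
  define a where "a = (\<Sum>\<zeta>\<in>S. \<bar>u \<zeta>\<bar>)"
  have a: "\<bar>u \<zeta>\<bar> \<le> a" if "\<zeta> \<in> S" for \<zeta>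
    unfolding a_def using finite_S that by (intro member_le_sum[of \<zeta> S "\<lambda>\<zeta>. \<bar>u \<zeta>\<bar>"]) auto
  have a0: "a \<ge> 0" unfolding a_def by (intro sum_nonneg) auto
  show "summable (\<lambda>n. a * (inverse (fact n) * (L_bound * \<bar>t\<bar>) ^ n))"
    by (intro summable_mult summable_exp)
  fix n
  have "norm ((L ^^ n) u \<eta> / fact n * t ^ n) = \<bar>(L ^^ n) u \<eta>\<bar> * (inverse (fact n) * \<bar>t\<bar> ^ n)"
    by (simp add: abs_mult power_abs divide_inverse)
  also have "\<dots> \<le> (L_bound ^ n * a) * (inverse (fact n) * \<bar>t\<bar> ^ n)"
    by (intro mult_right_mono L_power_bound a a0 assms) auto
  finally show "norm ((L ^^ n) u \<eta> / fact n * t ^ n) \<le> a * (inverse (fact n) * (L_bound * \<bar>t\<bar>) ^ n)"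
    by (simp add: power_mult_distrib mult_ac)
qed

text \<open>Termwise differentiation of a power series that converges for all \<open>t\<close>; the
  shift of the coefficients by one power of \<open>L\<close> puts \<open>L u\<close> in place of
  \<open>u\<close>.\<close>

lemma exp_semigroup_deriv:
  assumes "\<eta> \<in> S"
  shows "((\<lambda>t. exp_semigroup L t u \<eta>) has_real_derivative exp_semigroup L t (L u) \<eta>) (at t)"
proof -
  have "((\<lambda>t. \<Sum>n. (L ^^ n) u \<eta> / fact n * t ^ n) has_field_derivative (\<Sum>n. diffs (\<lambda>n. (L ^^ n) u \<eta> / fact n) n * t ^ n)) (at t)"
    by (rule termdiffs_strong_converges_everywhere[OF exp_semigroup_summable[OF assms]])
  moreover have "diffs (\<lambda>n. (L ^^ n) u \<eta> / fact n) n = (L ^^ n) (L u) \<eta> / fact n" for n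
    by (simp add: diffs_def funpow_swap1 field_simps del: of_nat_Suc)
  ultimately show ?thesis unfolding exp_semigroup_def by (simp add: mult_ac)
qed

section \<open>Laws of the Markov process\<close>

context
  fixes M :: "'w measure" and X :: "real \<Rightarrow> 'w \<Rightarrow> 's"
  assumes markov: "markov_process M X S L"
begin

lemma integral_eq_law:
  assumes "t \<ge> 0"
  shows "integrable M (\<lambda>\<omega>. g (X t \<omega>) :: real)" "(\<integral>\<omega>. g (X t \<omega>) \<partial>M) = (\<Sum>\<eta>\<in>S. law M X t \<eta> * g \<eta>)"
proof -
  interpret prob_space M using markov by (simp add: markov_process_def)
  have X: "X t \<in> measurable M (count_space S)" using markov assms by (simp add: markov_process_def)
  have XS: "X t \<omega> \<in> S" if "\<omega> \<in> space M" for \<omega> using measurable_space[OF X that] by simp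
  have set: "{\<omega> \<in> space M. X t \<omega> = \<eta>} \<in> sets M" if "\<eta> \<in> S" for \<eta>
  proof -
    have "X t -` {\<eta>} \<inter> space M \<in> sets M" using X that by (intro measurable_sets[OF X]) auto
    moreover have "X t -` {\<eta>} \<inter> space M = {\<omega> \<in> space M. X t \<omega> = \<eta>}" by auto
    ultimately show ?thesis by simp
  qed
  let ?h = "\<lambda>\<omega>. \<Sum>\<eta>\<in>S. g \<eta> * indicator {\<omega> \<in> space M. X t \<omega> = \<eta>} \<omega>"
  have eq: "g (X t \<omega>) = ?h \<omega>" if \<omega>: "\<omega> \<in> space M" for \<omega>
  proof -
    have "?h \<omega> = (\<Sum>\<eta>\<in>S. if X t \<omega> = \<eta> then g \<eta> else 0)"
      using \<omega> by (intro sum.cong) (auto simp: indicator_def)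
    thus ?thesis using XS[OF \<omega>] finite_S by simp
  qed
  have int: "integrable M (\<lambda>\<omega>. g \<eta> * indicator {\<omega> \<in> space M. X t \<omega> = \<eta>} \<omega>)" if "\<eta> \<in> S" for \<eta>
    using set[OF that] by (intro integrable_mult_right integrable_real_indicator) (auto simp: emeasure_eq_measure)
  have "integrable M ?h" by (intro Bochner_Integration.integrable_sum int)
  thus "integrable M (\<lambda>\<omega>. g (X t \<omega>))" by (subst Bochner_Integration.integrable_cong[OF refl eq])
  have "(\<integral>\<omega>. g (X t \<omega>) \<partial>M) = (\<integral>\<omega>. ?h \<omega> \<partial>M)" by (intro Bochner_Integration.integral_cong eq refl)
  also have "\<dots> = (\<Sum>\<eta>\<in>S. \<integral>\<omega>. g \<eta> * indicator {\<omega> \<in> space M. X t \<omega> = \<eta>} \<omega> \<partial>M)"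
    by (rule Bochner_Integration.integral_sum[OF int])
  also have "\<dots> = (\<Sum>\<eta>\<in>S. law M X t \<eta> * g \<eta>)"
  proof (intro sum.cong refl)
    fix \<eta>
    have "{\<omega> \<in> space M. X t \<omega> = \<eta>} \<inter> space M = {\<omega> \<in> space M. X t \<omega> = \<eta>}" by auto
    thus "(\<integral>\<omega>. g \<eta> * indicator {\<omega> \<in> space M. X t \<omega> = \<eta>} \<omega> \<partial>M) = law M X t \<eta> * g \<eta>"
      by (simp add: law_def)
  qed
  finally show "(\<integral>\<omega>. g (X t \<omega>) \<partial>M) = (\<Sum>\<eta>\<in>S. law M X t \<eta> * g \<eta>)" .
qed

lemma law_sum: "t \<ge> 0 \<Longrightarrow> (\<Sum>\<eta>\<in>S. law M X t \<eta>) = 1"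
  using integral_eq_law(2)[of t "\<lambda>_. 1"] markov by (simp add: markov_process_def prob_space.prob_space)

lemma law_nonneg: "0 \<le> law M X t \<eta>"
  by (simp add: law_def)

text \<open>The Markov property at time 0, integrated: a function and its conditional expectation
  have the same integral.\<close>

lemma law_evolution:
  assumes t: "t \<ge> 0"
  shows "(\<Sum>\<eta>\<in>S. law M X t \<eta> * u \<eta>) = (\<Sum>\<eta>\<in>S. law M X 0 \<eta> * exp_semigroup L t u \<eta>)"
proof -
  interpret prob_space M using markov by (simp add: markov_process_def)
  let ?F = "natural_filtration M X 0"
  have X0: "X 0 \<in> measurable M (count_space S)" using markov by (simp add: markov_process_def)
  \<comment> \<open>The sets \<open>A\<close> range over the whole state type, whereas measurability
    of \<open>X 0\<close> is into \<open>S\<close>; intersecting with \<open>S\<close> does not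
    change the preimage.\<close>
  have sub: "{X r -` A \<inter> space M |r A. 0 \<le> r \<and> r \<le> 0} \<subseteq> sets M"
  proof safe
    fix r :: real and A assume "0 \<le> r" "r \<le> 0"
    hence "r = 0" by simp
    moreover have "X 0 -` A \<inter> space M = X 0 -` (A \<inter> S) \<inter> space M" using measurable_space[OF X0] by auto
    moreover have "X 0 -` (A \<inter> S) \<inter> space M \<in> sets M" by (rule measurable_sets[OF X0]) simp
    ultimately show "X r -` A \<inter> space M \<in> sets M" by simp
  qed
  have "subalgebra M ?F"
    unfolding subalgebra_def natural_filtration_def using sets.sigma_sets_subset[OF sub]
    by (auto simp: space_measure_of_conv sets_measure_of_conv)
  then interpret finite_measure_subalgebra M ?F by unfold_locales
  have "(\<Sum>\<eta>\<in>S. law M X t \<eta> * u \<eta>) = (\<integral>\<omega>. u (X t \<omega>) \<partial>M)" using integral_eq_law(2)[OF t] by simp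
  also have "\<dots> = (\<integral>\<omega>. real_cond_exp M ?F (\<lambda>\<omega>. u (X t \<omega>)) \<omega> \<partial>M)"
    using real_cond_exp_int(2)[OF integral_eq_law(1)[OF t, of u]] by simp
  also have "\<dots> = (\<integral>\<omega>. exp_semigroup L t u (X 0 \<omega>) \<partial>M)"
  proof (rule integral_cong_AE)
    show "(\<lambda>\<omega>. exp_semigroup L t u (X 0 \<omega>)) \<in> borel_measurable M"
      using integral_eq_law(1)[of 0 "exp_semigroup L t u"] by simp
    show "AE \<omega> in M. real_cond_exp M ?F (\<lambda>\<omega>. u (X t \<omega>)) \<omega> = exp_semigroup L t u (X 0 \<omega>)"
    proof -
      have "\<forall>f s t. 0 \<le> s \<and> s \<le> t \<longrightarrow> (AE \<omega> in M. real_cond_exp M (natural_filtration M X s) (\<lambda>\<omega>'. f (X t \<omega>')) \<omega> =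
          exp_semigroup L (t - s) f (X s \<omega>))"
        using markov unfolding markov_process_def by blast
      from this[rule_format, of 0 t u] t show ?thesis by simp
    qed
  qed simp
  also have "\<dots> = (\<Sum>\<eta>\<in>S. law M X 0 \<eta> * exp_semigroup L t u \<eta>)" by (rule integral_eq_law(2)) simp
  finally show ?thesis .
qed

text \<open>The law is written as the initial law tested against the semigroup, which is
  differentiable on the whole line; \<open>law_evolution\<close> for the function
  \<open>L (indicator {\<zeta>})\<close> then brings back the law at time t. At 0 the derivative is
  one-sided since the process starts there.\<close>

lemma forward_equation:
  assumes t: "t \<ge> 0" and \<zeta>: "\<zeta> \<in> S"
  shows "((\<lambda>t. law M X t \<zeta>) has_real_derivative (\<Sum>\<eta>\<in>S. law M X t \<eta> * L (indicator {\<zeta>}) \<eta>)) (at t within {0..})"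
proof (rule has_field_derivative_transform_within[of _ _ _ _ 1])
  show "t \<in> {0..}" using t by simp
  show "(\<Sum>\<eta>\<in>S. law M X 0 \<eta> * exp_semigroup L s (indicator {\<zeta>}) \<eta>) = law M X s \<zeta>" if "s \<in> {0..}" for s
    using law_evolution[of s "indicator {\<zeta>}"] that \<zeta> finite_S by (simp add: indicator_def if_distrib cong: if_cong)
  have "((\<lambda>t. \<Sum>\<eta>\<in>S. law M X 0 \<eta> * exp_semigroup L t (indicator {\<zeta>}) \<eta>) has_real_derivative
      (\<Sum>\<eta>\<in>S. law M X 0 \<eta> * exp_semigroup L t (L (indicator {\<zeta>})) \<eta>)) (at t)"
    by (intro DERIV_sum DERIV_cmult exp_semigroup_deriv)
  thus "((\<lambda>t. \<Sum>\<eta>\<in>S. law M X 0 \<eta> * exp_semigroup L t (indicator {\<zeta>}) \<eta>) has_real_derivative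
      (\<Sum>\<eta>\<in>S. law M X t \<eta> * L (indicator {\<zeta>}) \<eta>)) (at t within {0..})"
    unfolding law_evolution[OF t] by (rule has_field_derivative_at_within)
qed simp

end

end

text \<open>\<open>g\<close> is the logarithmic derivative of the reference weights. Differentiating
  the logarithm of \<open>\<mu>\<close> itself contributes the sum of \<open>\<mu>'\<close>, which
  vanishes by conservation of mass.\<close>

lemma kl_has_derivative:
  fixes \<mu> \<nu> :: "real \<Rightarrow> 'c \<Rightarrow> real"
  assumes S: "finite S" and pos: "\<And>\<eta>. \<eta> \<in> S \<Longrightarrow> 0 < \<mu> t \<eta>" "\<And>\<eta>. \<eta> \<in> S \<Longrightarrow> 0 < \<nu> t \<eta>"
    and d\<mu>: "\<And>\<eta>. \<eta> \<in> S \<Longrightarrow> ((\<lambda>s. \<mu> s \<eta>) has_real_derivative \<mu>' \<eta>) (at t within A)"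
    and d\<nu>: "\<And>\<eta>. \<eta> \<in> S \<Longrightarrow> ((\<lambda>s. \<nu> s \<eta>) has_real_derivative \<nu> t \<eta> * g \<eta>) (at t within A)"
    and zero: "(\<Sum>\<eta>\<in>S. \<mu>' \<eta>) = 0" and t: "t \<in> A"
    and posA: "\<And>s \<eta>. s \<in> A \<Longrightarrow> \<eta> \<in> S \<Longrightarrow> 0 < \<mu> s \<eta> \<and> 0 < \<nu> s \<eta>"
  shows "((\<lambda>s. kl S (\<mu> s) (\<nu> s)) has_real_derivative
     (\<Sum>\<eta>\<in>S. \<mu>' \<eta> * ln (\<mu> t \<eta> / \<nu> t \<eta>)) - wmean S (\<mu> t) g) (at t within A)"
proof -
  have "((\<lambda>s. \<Sum>\<eta>\<in>S. \<mu> s \<eta> * (ln (\<mu> s \<eta>) - ln (\<nu> s \<eta>))) has_real_derivative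
     (\<Sum>\<eta>\<in>S. \<mu>' \<eta> * (ln (\<mu> t \<eta>) - ln (\<nu> t \<eta>)) + (\<mu>' \<eta> - \<mu> t \<eta> * g \<eta>))) (at t within A)"
  proof (rule DERIV_sum)
    fix \<eta> assume \<eta>: "\<eta> \<in> S"
    show "((\<lambda>s. \<mu> s \<eta> * (ln (\<mu> s \<eta>) - ln (\<nu> s \<eta>))) has_real_derivative
      \<mu>' \<eta> * (ln (\<mu> t \<eta>) - ln (\<nu> t \<eta>)) + (\<mu>' \<eta> - \<mu> t \<eta> * g \<eta>)) (at t within A)"
      by (rule derivative_eq_intros refl d\<mu>[OF \<eta>] d\<nu>[OF \<eta>] pos[OF \<eta>])+
         (use pos[OF \<eta>] in \<open>simp add: field_simps\<close>)
  qed
  moreover have "(\<Sum>\<eta>\<in>S. \<mu>' \<eta> * (ln (\<mu> t \<eta>) - ln (\<nu> t \<eta>)) + (\<mu>' \<eta> - \<mu> t \<eta> * g \<eta>))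
     = (\<Sum>\<eta>\<in>S. \<mu>' \<eta> * ln (\<mu> t \<eta> / \<nu> t \<eta>)) - wmean S (\<mu> t) g"
  proof -
    have "(\<Sum>\<eta>\<in>S. \<mu>' \<eta> * (ln (\<mu> t \<eta>) - ln (\<nu> t \<eta>))) = (\<Sum>\<eta>\<in>S. \<mu>' \<eta> * ln (\<mu> t \<eta> / \<nu> t \<eta>))"
      using pos by (intro sum.cong refl) (simp add: ln_div less_imp_neq[symmetric])
    thus ?thesis unfolding sum.distrib sum_subtractf zero by (simp add: wmean_def)
  qed
  moreover have eq: "(\<Sum>\<eta>\<in>S. \<mu> s \<eta> * (ln (\<mu> s \<eta>) - ln (\<nu> s \<eta>))) = kl S (\<mu> s) (\<nu> s)" if "s \<in> A" for s
    unfolding kl_def using posA[OF that] by (intro sum.cong refl) (simp add: ln_div less_imp_neq[symmetric])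
  ultimately have D: "((\<lambda>s. \<Sum>\<eta>\<in>S. \<mu> s \<eta> * (ln (\<mu> s \<eta>) - ln (\<nu> s \<eta>))) has_real_derivative
     (\<Sum>\<eta>\<in>S. \<mu>' \<eta> * ln (\<mu> t \<eta> / \<nu> t \<eta>)) - wmean S (\<mu> t) g) (at t within A)" by simp
  show ?thesis by (rule has_field_derivative_transform_within[OF D zero_less_one t]) (rule eq)
qed

text \<open>The function exp(- a s) H s - B s is nonincreasing: multiplying the inequality by exp(-
  a s) only decreases the nonnegative \<open>B\<close>.\<close>

lemma gronwall:
  fixes H H' :: "real \<Rightarrow> real"
  assumes deriv: "\<And>s. s \<in> {0..T} \<Longrightarrow> (H has_real_derivative H' s) (at s within {0..T})"
    and le: "\<And>s. s \<in> {0..T} \<Longrightarrow> H' s \<le> a * H s + B" and a: "a \<ge> 0" and B: "B \<ge> 0" and t: "t \<in> {0..T}"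
    and H0: "H 0 \<ge> 0"
  shows "H t \<le> exp (a * T) * (H 0 + B * T)"
proof -
  define G where "G = (\<lambda>s. exp (- a * s) * H s - B * s)"
  have dG: "(G has_real_derivative exp (- a * s) * (H' s - a * H s) - B) (at s within {0..T})" if "s \<in> {0..T}" for s
    proof -
    have "((\<lambda>s. exp (- a * s)) has_real_derivative - a * exp (- a * s)) (at s within {0..T})"
      by (auto intro!: derivative_eq_intros)
    from DERIV_diff[OF DERIV_mult[OF this deriv[OF that]] DERIV_cmult_Id[of B]]
    show ?thesis unfolding G_def by (simp add: algebra_simps)
  qed
  have "G t \<le> G 0"
  proof (rule DERIV_nonpos_imp_decreasing_open[of 0 t G])
    show "0 \<le> t" using t by simp
    have "continuous_on {0..T} G" by (rule DERIV_continuous_on) (rule dG)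
    thus "continuous_on {0..t} G" by (rule continuous_on_subset) (use t in auto)
    fix s assume s: "0 < s" "s < t"
    have "at s within {0..T} = at s" using s t by (intro at_within_interior) auto
    hence "DERIV G s :> exp (- a * s) * (H' s - a * H s) - B" using dG[of s] s t by simp
    have "exp (- a * s) * (H' s - a * H s) \<le> exp (- a * s) * B"
      using le[of s] s t by (intro mult_left_mono) auto
    moreover have "exp (- a * s) * B \<le> 1 * B" using a s B by (intro mult_right_mono) auto
    ultimately have "exp (- a * s) * (H' s - a * H s) - B \<le> 0" by linarith
    with \<open>DERIV G s :> _\<close> show "\<exists>y. DERIV G s :> y \<and> y \<le> 0" by blast
  qed
  hence "exp (- a * t) * H t \<le> H 0 + B * t" by (simp add: G_def)
  hence "exp (a * t) * (exp (- a * t) * H t) \<le> exp (a * t) * (H 0 + B * t)" by (intro mult_left_mono) auto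
  moreover have "exp (a * t) * (exp (- a * t) * H t) = H t"
    by (simp flip: mult.assoc exp_add)
  ultimately have "H t \<le> exp (a * t) * (H 0 + B * t)" by (simp only:)
  also have "\<dots> \<le> exp (a * T) * (H 0 + B * T)"
    using t a B H0 by (intro mult_mono add_mono) (auto intro: mult_left_mono)
  finally show ?thesis .
qed

text \<open>Both bounds tend to 0 with x and so squeeze x ln x there; the lower one is the tangent
  bound of the logarithm at 1 / sqrt x.\<close>

lemma xlnx_bounds:
  fixes x :: real
  assumes "x \<ge> 0"
  shows "2 * x - 2 * sqrt x \<le> x * ln x" "x * ln x \<le> x\<^sup>2 - x"
proof -
  show "x * ln x \<le> x\<^sup>2 - x"
  proof (cases "x = 0")
    case False
    hence "x * ln x \<le> x * (x - 1)" using assms by (intro mult_left_mono ln_le_minus_one) auto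
    thus ?thesis by (simp add: power2_eq_square right_diff_distrib)
  qed simp
  show "2 * x - 2 * sqrt x \<le> x * ln x"
  proof (cases "x = 0")
    case False
    hence x: "x > 0" using assms by simp
    have "ln (1 / sqrt x) \<le> 1 / sqrt x - 1" using x by (intro ln_le_minus_one) auto
    hence "1 - 1 / sqrt x \<le> ln x / 2" using x by (simp add: ln_div ln_sqrt)
    hence "(2 * x) * (1 - 1 / sqrt x) \<le> (2 * x) * (ln x / 2)" using x by (intro mult_left_mono) auto
    moreover have "(2 * x) * (1 - 1 / sqrt x) = 2 * x - 2 * (x / sqrt x)" by (simp add: right_diff_distrib)
    ultimately show ?thesis using x by (simp add: real_div_sqrt)
  qed simp
qed

text \<open>Continuity is delicate only at states without mass, where x ln x tends to 0; elsewhere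
  the logarithm is continuous at the limit.\<close>

lemma kl_mixture_tendsto:
  fixes \<mu> \<pi> \<nu> :: "'c \<Rightarrow> real"
  assumes "finite S" "\<And>\<eta>. \<eta> \<in> S \<Longrightarrow> 0 \<le> \<mu> \<eta>" "\<And>\<eta>. \<eta> \<in> S \<Longrightarrow> 0 < \<pi> \<eta>" "\<And>\<eta>. \<eta> \<in> S \<Longrightarrow> 0 < \<nu> \<eta>"
  shows "((\<lambda>e. kl S (\<lambda>\<eta>. (1 - e) * \<mu> \<eta> + e * \<pi> \<eta>) \<nu>) \<longlongrightarrow> kl S \<mu> \<nu>) (at_right 0)"
  unfolding kl_def
proof (rule tendsto_sum)
  fix \<eta> assume \<eta>: "\<eta> \<in> S"
  let ?x = "\<lambda>e. (1 - e) * \<mu> \<eta> + e * \<pi> \<eta>"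
  have lim: "(?x \<longlongrightarrow> \<mu> \<eta>) (at_right 0)" by (rule tendsto_eq_intros refl | simp)+
  show "((\<lambda>e. ?x e * ln (?x e / \<nu> \<eta>)) \<longlongrightarrow> \<mu> \<eta> * ln (\<mu> \<eta> / \<nu> \<eta>)) (at_right 0)"
  proof (cases "\<mu> \<eta> = 0")
    case False
    thus ?thesis using assms(2,4)[OF \<eta>] by (intro tendsto_intros lim) auto
  next
    case True
    let ?y = "\<lambda>e. ?x e / \<nu> \<eta>"
    have y: "(?y \<longlongrightarrow> 0) (at_right 0)" using tendsto_divide[OF lim tendsto_const, of "\<nu> \<eta>"] assms(4)[OF \<eta>] True by simp
    have ev: "eventually (\<lambda>e. 0 \<le> ?y e) (at_right 0)"
      using assms(3,4)[OF \<eta>] True by (auto simp: eventually_at_right_field intro!: exI[of _ 1])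
    have "((\<lambda>e. ?y e * ln (?y e)) \<longlongrightarrow> 0) (at_right 0)"
    proof (rule tendsto_sandwich)
      show "eventually (\<lambda>e. 2 * ?y e - 2 * sqrt (?y e) \<le> ?y e * ln (?y e)) (at_right 0)"
        using ev by eventually_elim (rule xlnx_bounds)
      show "eventually (\<lambda>e. ?y e * ln (?y e) \<le> (?y e)\<^sup>2 - ?y e) (at_right 0)"
        using ev by eventually_elim (rule xlnx_bounds)
      show "((\<lambda>e. 2 * ?y e - 2 * sqrt (?y e)) \<longlongrightarrow> 0) (at_right 0)"
        by (rule tendsto_eq_intros y refl | simp)+
      show "((\<lambda>e. (?y e)\<^sup>2 - ?y e) \<longlongrightarrow> 0) (at_right 0)"
        by (rule tendsto_eq_intros y refl | simp)+
    qed
    hence "((\<lambda>e. \<nu> \<eta> * (?y e * ln (?y e))) \<longlongrightarrow> \<nu> \<eta> * 0) (at_right 0)" by (intro tendsto_intros)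
    thus ?thesis using assms(4)[OF \<eta>] True by simp
  qed
qed

subsection \<open>Growth of the relative entropy for fixed N\<close>

definition binomial_product :: "nat \<Rightarrow> nat \<Rightarrow> ('d::finite site \<Rightarrow> real) \<Rightarrow> 'd config pmf" where
  "binomial_product K N r = Pi_pmf (torus N) 0 (\<lambda>x. binomial_pmf K (r x / real K))"

lemma kl_nonneg:
  assumes "\<And>\<eta>. \<eta> \<in> S \<Longrightarrow> 0 < \<mu> \<eta>" "\<And>\<eta>. \<eta> \<in> S \<Longrightarrow> 0 < \<nu> \<eta>" "(\<Sum>\<eta>\<in>S. \<mu> \<eta>) = 1" "(\<Sum>\<eta>\<in>S. \<nu> \<eta>) = 1"
  shows "0 \<le> kl S \<mu> \<nu>"
  using gibbs_variational[OF assms(1,2,3), where G = "\<lambda>_. 0"] assms(4) by (simp add: wmean_def)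

lemma kl_cong: "(\<And>\<eta>. \<eta> \<in> S \<Longrightarrow> \<mu> \<eta> = \<mu>' \<eta>) \<Longrightarrow> (\<And>\<eta>. \<eta> \<in> S \<Longrightarrow> \<nu> \<eta> = \<nu>' \<eta>) \<Longrightarrow> kl S \<mu> \<nu> = kl S \<mu>' \<nu>'"
  by (simp add: kl_def)

lemma DERIV_prod_log:
  fixes g :: "'a \<Rightarrow> real \<Rightarrow> real"
  assumes "finite I" "\<And>x. x \<in> I \<Longrightarrow> (g x has_real_derivative g x t * h x) (at t within A)"
  shows "((\<lambda>s. \<Prod>x\<in>I. g x s) has_real_derivative (\<Prod>x\<in>I. g x t) * (\<Sum>x\<in>I. h x)) (at t within A)"
  using assms
proof (induction I rule: finite_induct)
  case (insert x I)
  have 1: "(g x has_real_derivative g x t * h x) (at t within A)" using insert by simp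
  have 2: "((\<lambda>s. \<Prod>x\<in>I. g x s) has_real_derivative (\<Prod>x\<in>I. g x t) * (\<Sum>x\<in>I. h x)) (at t within A)"
    using insert by simp
  show ?case using DERIV_mult[OF 1 2] insert(1,2) by (simp add: algebra_simps)
qed simp

context lattice_gas
begin

lemma \<nu>_eq_pmf:
  assumes "\<eta> \<in> \<Omega>"
  shows "pmf (binomial_product K N r) \<eta> = \<nu> \<eta>"
proof -
  have "pmf (binomial_product K N r) \<eta> = (\<Prod>x\<in>torus N. pmf (binomial_pmf K (r x / real K)) (\<eta> x))"
    using assms unfolding binomial_product_def by (intro pmf_Pi') (auto simp: \<Omega>_def PiE_dflt_def)
  also have "\<dots> = \<nu> \<eta>"
    unfolding \<nu>_def using r_pos r_less K
    by (intro prod.cong refl, subst pmf_binomial) (auto simp: site_weight_def Bernstein_def less_imp_le)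
  finally show ?thesis .
qed

lemma \<nu>_sum_1: "(\<Sum>\<eta>\<in>\<Omega>. \<nu> \<eta>) = 1"
proof -
  have "set_pmf (binomial_product K N r) \<subseteq> PiE_dflt (torus N) 0 (set_pmf \<circ> (\<lambda>x. binomial_pmf K (r x / real K)))"
    unfolding binomial_product_def by (rule set_Pi_pmf_subset') simp
  also have "\<dots> \<subseteq> \<Omega>"
    using r_pos r_less K by (fastforce simp: \<Omega>_def PiE_dflt_def)
  finally have "(\<Sum>\<eta>\<in>\<Omega>. pmf (binomial_product K N r) \<eta>) = 1"
    using sum_pmf_eq_1[OF finite_\<Omega>] by blast
  thus ?thesis using \<nu>_eq_pmf by simp
qed

text \<open>A jump that would leave the state space has rate zero, so values outside it never
  enter.\<close>

lemma finite_generator: "finite_generator \<Omega> (\<lambda>u \<eta>. \<Gamma> * generator K p N u \<eta>)"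
proof
  fix u v :: "'d config \<Rightarrow> real" and \<eta> assume uv: "\<And>\<zeta>. \<zeta> \<in> \<Omega> \<Longrightarrow> u \<zeta> = v \<zeta>" and \<eta>: "\<eta> \<in> \<Omega>"
  have "rate K p N x i \<eta> * (u (move \<eta> x (torus_add N x (dir i))) - u \<eta>) = rate K p N x i \<eta> * (v (move \<eta> x (torus_add N x (dir i))) - v \<eta>)"
    if x: "x \<in> torus N" for x i
  proof (cases "\<eta> x > 0 \<and> \<eta> (torus_add N x (dir i)) < K")
    case True
    have "move \<eta> x (torus_add N x (dir i)) \<in> \<Omega>"
      using True N torus_add_dir_neq[OF N x, of i] x by (intro move_in_\<Omega>[OF \<eta>]) auto
    thus ?thesis using uv \<eta> by simp
  next
    case False
    hence "\<eta> x = 0 \<or> \<eta> (torus_add N x (dir i)) = K" using \<Omega>_le[OF \<eta>, of "torus_add N x (dir i)"] by auto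
    thus ?thesis by (auto simp: rate_def)
  qed
  thus "\<Gamma> * generator K p N u \<eta> = \<Gamma> * generator K p N v \<eta>"
    unfolding generator_def by (intro arg_cong[where f = "\<lambda>a. \<Gamma> * a"] sum.cong refl) auto
next
  fix u v :: "'d config \<Rightarrow> real" and \<eta>
  show "\<Gamma> * generator K p N (\<lambda>\<zeta>. u \<zeta> + v \<zeta>) \<eta> = \<Gamma> * generator K p N u \<eta> + \<Gamma> * generator K p N v \<eta>"
    unfolding generator_def distrib_left[symmetric] sum.distrib[symmetric]
    by (intro arg_cong[where f = "\<lambda>a. \<Gamma> * a"] sum.cong refl) (simp add: algebra_simps)
next
  fix a :: real and u :: "'d config \<Rightarrow> real" and \<eta>
  have "generator K p N (\<lambda>\<zeta>. a * u \<zeta>) \<eta> = a * generator K p N u \<eta>"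
    unfolding generator_def sum_distrib_left by (intro sum.cong refl) (simp add: algebra_simps)
  thus "\<Gamma> * generator K p N (\<lambda>\<zeta>. a * u \<zeta>) \<eta> = a * (\<Gamma> * generator K p N u \<eta>)" by simp
qed (rule finite_\<Omega>)

text \<open>For a constant profile every divergence and every difference r y - r x in
  \<open>adjoint_one_expansion\<close> vanishes. The adjoint applied to 1 is therefore zero although
  the dynamics is asymmetric and not reversible.\<close>

lemma constant_density_invariant:
  assumes const: "\<And>x. r x = a"
  shows "(\<Sum>\<eta>\<in>\<Omega>. \<nu> \<eta> * generator K p N u \<eta>) = 0"
proof -
  let ?y = "\<lambda>x i. torus_add N x (dir i)"
  have "(\<Sum>\<eta>\<in>\<Omega>. \<nu> \<eta> * generator K p N u \<eta>) = wmean \<Omega> \<nu> (\<lambda>\<eta>. \<Sum>i\<in>UNIV. \<Sum>x\<in>torus N. p i * (jump x (?y x i) \<eta> * (u (move \<eta> x (?y x i)) - u \<eta>)))"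
    by (simp add: wmean_def generator_def rate_def jump_def mult.assoc)
  also have "\<dots> = (\<Sum>i\<in>UNIV. \<Sum>x\<in>torus N. p i * wmean \<Omega> \<nu> (\<lambda>\<eta>. (odds x (?y x i) * jump (?y x i) x \<eta> - jump x (?y x i) \<eta>) * u \<eta>))"
    unfolding wmean_sum wmean_cmult
  proof (intro sum.cong refl arg_cong2[where f = "(*)"])
    fix i and x :: "'d site" assume x: "x \<in> torus N"
    have "x \<noteq> ?y x i" "?y x i \<in> torus N" using torus_add_dir_neq[OF N x, of i] N by auto
    thus "wmean \<Omega> \<nu> (\<lambda>\<eta>. jump x (?y x i) \<eta> * (u (move \<eta> x (?y x i)) - u \<eta>))
      = wmean \<Omega> \<nu> (\<lambda>\<eta>. (odds x (?y x i) * jump (?y x i) x \<eta> - jump x (?y x i) \<eta>) * u \<eta>)"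
      using change_of_variables[OF x, of "?y x i" "\<lambda>\<eta> \<zeta>. u \<zeta>"]
      by (simp add: wmean_def algebra_simps sum_subtractf)
  qed
  also have "\<dots> = wmean \<Omega> \<nu> (\<lambda>\<eta>. u \<eta> * (\<Sum>i\<in>UNIV. \<Sum>x\<in>torus N. p i * (odds x (?y x i) * jump (?y x i) x \<eta> - jump x (?y x i) \<eta>)))"
    unfolding wmean_cmult[symmetric] wmean_sum[symmetric] sum_distrib_left by (simp add: mult_ac)
  also have "\<dots> = 0"
    unfolding adjoint_one_expansion by (simp add: const current_divergence_def wmean_def mult.commute)
  finally show ?thesis .
qed

lemma site_weight_log_deriv:
  assumes x: "x \<in> torus N" and k: "k \<le> K" and d: "((\<lambda>s. R s x) has_real_derivative r' x) (at t within A)" and R: "R t = r"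
  shows "((\<lambda>s. site_weight K (R s) x k) has_real_derivative site_weight K r x k * (real K * r' x * om x k)) (at t within A)"
proof -
  have pos: "r x > 0" "real K - r x > 0" using r_pos[OF x] r_less[OF x] by auto
  let ?q = "r x / real K"
  have q: "0 < ?q" "0 < 1 - ?q" using pos K by (auto simp: field_simps)
  have e: "real k * (1 - ?q) - real (K - k) * ?q = real k - r x"
    using k K by (simp add: of_nat_diff field_simps)
  have dq: "((\<lambda>s. R s x / real K) has_real_derivative r' x / real K) (at t within A)"
    by (rule DERIV_cdivide[OF d])
  have a: "((\<lambda>s. (R s x / real K) ^ k) has_real_derivative ?q ^ k * (real k * (r' x / real K) / ?q)) (at t within A)"
  \<comment> \<open>The derivative is stated as a multiple of the power itself, a form that the
    power rule gives only for a positive exponent.\<close>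
  proof (cases k)
    case 0 thus ?thesis by simp
  next
    case (Suc l)
    have e: "real k * (r' x / real K * ?q ^ (k - Suc 0)) = ?q ^ k * (real k * (r' x / real K) / ?q)"
      using pos K Suc by simp
    show ?thesis using DERIV_power[OF dq, of k] unfolding R e .
  qed
  have b: "((\<lambda>s. (1 - R s x / real K) ^ (K - k)) has_real_derivative (1 - ?q) ^ (K - k) * (- real (K - k) * (r' x / real K) / (1 - ?q))) (at t within A)"
  proof (cases "K - k")
    case 0 thus ?thesis by simp
  next
    case (Suc l)
    have e': "real (K - k) * (- (r' x / real K) * (1 - ?q) ^ (K - k - Suc 0)) = (1 - ?q) ^ (K - k) * (- real (K - k) * (r' x / real K) / (1 - ?q))"
      using q(2) Suc K by (simp, simp add: field_simps)
    have "((\<lambda>s. 1 - R s x / real K) has_real_derivative - (r' x / real K)) (at t within A)"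
      using DERIV_diff[OF DERIV_const[of 1] dq] by simp
    from DERIV_power[OF this, of "K - k"] show ?thesis unfolding R e' .
  qed
  have "((\<lambda>s. real (K choose k) * ((R s x / real K) ^ k * (1 - R s x / real K) ^ (K - k))) has_real_derivative
     real (K choose k) * (?q ^ k * (1 - ?q) ^ (K - k) * (real k * (r' x / real K) / ?q - real (K - k) * (r' x / real K) / (1 - ?q)))) (at t within A)"
    using DERIV_cmult[OF DERIV_mult[OF a b], of "real (K choose k)"] R by (simp add: algebra_simps)
  moreover have "real k * (r' x / real K) / ?q - real (K - k) * (r' x / real K) / (1 - ?q) = real K * r' x * om x k"
  proof -
    have "real k * (r' x / real K) / ?q - real (K - k) * (r' x / real K) / (1 - ?q)
       = (r' x / real K) * (real k * (1 - ?q) - real (K - k) * ?q) / (?q * (1 - ?q))"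
    proof -
      have "k' * u / v - j * u / w = u * (k' * w - j * v) / (v * w)" if "v \<noteq> 0" "w \<noteq> 0" for k' u v j w :: real
        using that by (simp add: field_simps)
      thus ?thesis using q by (simp only: less_imp_neq[symmetric] not_False_eq_True)
    qed
    also have "\<dots> = real K * r' x * om x k"
      unfolding e om_def using pos K by (simp add: field_simps)
    finally show ?thesis .
  qed
  ultimately show ?thesis by (simp add: site_weight_def Bernstein_def mult.assoc)
qed

end

text \<open>The constants \<open>a\<close> and \<open>B\<close> are free of the mixing weight
  \<open>e\<close> introduced in the proof, so Gronwall's inequality passes to the limit as
  \<open>e\<close> tends to 0; only the entropies at times 0 and \<open>t\<close> have to
  converge.\<close>

lemma entropy_growth:
  fixes r r' :: "real \<Rightarrow> 'd::finite site \<Rightarrow> real" and M :: "'w measure" and n :: nat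
  assumes gas: "\<And>t. t \<in> {0..T} \<Longrightarrow> lattice_gas K N (r t)"
    and \<rho>: "0 < \<rho>" "\<rho> < real K" and c: "c > 0"
    and c_le: "\<And>t x. t \<in> {0..T} \<Longrightarrow> x \<in> torus N \<Longrightarrow> c \<le> r t x \<and> c \<le> real K - r t x"
    and dr: "\<And>t x. t \<in> {0..T} \<Longrightarrow> x \<in> torus N \<Longrightarrow> ((\<lambda>s. r s x) has_real_derivative r' t x) (at t within {0..T})"
    and \<epsilon>: "\<And>t x i. t \<in> {0..T} \<Longrightarrow> x \<in> torus N \<Longrightarrow> \<bar>r t x - r t (torus_add N x (axis i 1))\<bar> \<le> \<epsilon>"
    and p: "\<And>i. p i \<ge> 0" and c0: "c0 > 0" "\<And>j. c0 \<le> (p (Inl j) + p (Inr j)) / 2" and \<Gamma>: "\<Gamma> > 0"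
    and \<beta>: "\<And>t x. t \<in> {0..T} \<Longrightarrow> x \<in> torus N \<Longrightarrow> \<bar>real K * (\<Gamma> * current_divergence K p N (r t) x - r' t x)\<bar> \<le> \<beta>"
    and nN: "2 ^ n < N" and G0: "0 \<le> G" and G: "\<And>k. k < n \<Longrightarrow> (2 ^ k)\<^sup>2 \<le> G * 2 ^ (k * CARD('d))"
    and markov: "markov_process M X (Config K N) (\<lambda>f \<eta>. \<Gamma> * generator K p N f \<eta>)"
    and t: "t \<in> {0..T}"
  defines "b \<equiv> real K / c\<^sup>2" and "C \<equiv> 3 / (2 * c ^ 4) + 1 / 2"
    and "A \<equiv> (\<Sum>i\<in>UNIV. p i) * real K ^ 3 * \<epsilon> * \<Gamma>" and "nd \<equiv> real (n * CARD('d)) + 1"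
    and "d \<equiv> real CARD('d)" and "vol \<equiv> real (card (torus N :: 'd site set))"
  defines "a \<equiv> 2 * b\<^sup>2 + d * (nd * (C * (nd * d) / (\<Gamma> * c0) * (A\<^sup>2 * ((2 ^ n)\<^sup>2 * (4 * b\<^sup>2)))) + (1 + A\<^sup>2) * (4 * b\<^sup>2))"
    and "B \<equiv> vol * \<beta>\<^sup>2 / 2 + d * (nd * (C * (nd * d) / (\<Gamma> * c0) * (A\<^sup>2 * (G * (4 * b\<^sup>2) * vol)) + vol * (b ^ 4 * \<epsilon>\<^sup>2 * (\<Gamma> * c0 / (nd * d)) / 2))
           + 2 * A\<^sup>2 * (4 * b\<^sup>2) * vol / 2 ^ (n * CARD('d)))"
  shows "0 \<le> kl (Config K N) (law M X t) (pmf (binomial_product K N (r t)))"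
    and "kl (Config K N) (law M X t) (pmf (binomial_product K N (r t)))
      \<le> exp (a * T) * (kl (Config K N) (law M X 0) (pmf (binomial_product K N (r 0))) + B * T)"
proof -
  have K: "K > 0" and N: "N > 1" using lattice_gas.K[OF gas[OF t]] lattice_gas.N[OF gas[OF t]] by auto
  have T: "0 \<in> {0..T}" using t by auto
  have gas_const: "lattice_gas K N (\<lambda>_ :: 'd site. \<rho>)"
    by unfold_locales (use K N \<rho> in auto)
  let ?L = "\<lambda>f \<eta>. \<Gamma> * generator K p N f \<eta>" and ?S = "Config K N :: 'd config set"
  define \<nu> where "\<nu> = (\<lambda>t. pmf (binomial_product K N (r t)))"
  define \<pi> where "\<pi> = pmf (binomial_product K N (\<lambda>_ :: 'd site. \<rho>))"
  interpret fg: finite_generator ?S ?L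
    using lattice_gas.finite_generator[OF gas_const] lattice_gas.\<Omega>_eq[OF gas_const] by simp
  have finS: "finite ?S" by (rule fg.finite_S)
  have \<pi>: "\<And>\<eta>. \<eta> \<in> ?S \<Longrightarrow> 0 < \<pi> \<eta>" "(\<Sum>\<eta>\<in>?S. \<pi> \<eta>) = 1" "\<And>u. (\<Sum>\<eta>\<in>?S. \<pi> \<eta> * ?L u \<eta>) = 0"
  proof -
    interpret lg: lattice_gas K N "\<lambda>_ :: 'd site. \<rho>" by (rule gas_const)
    have eq: "\<pi> \<eta> = lg.\<nu> \<eta>" if "\<eta> \<in> lg.\<Omega>" for \<eta> unfolding \<pi>_def by (rule lg.\<nu>_eq_pmf[OF that])
    show "0 < \<pi> \<eta>" if "\<eta> \<in> ?S" for \<eta> using that eq lg.\<nu>_pos unfolding lg.\<Omega>_eq[symmetric] by simp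
    show "(\<Sum>\<eta>\<in>?S. \<pi> \<eta>) = 1" using eq lg.\<nu>_sum_1 unfolding lg.\<Omega>_eq[symmetric] by simp
    show "(\<Sum>\<eta>\<in>?S. \<pi> \<eta> * ?L u \<eta>) = 0" for u
      using lg.constant_density_invariant[of \<rho> p u] eq unfolding lg.\<Omega>_eq[symmetric]
      by (simp add: mult.left_commute flip: sum_distrib_left)
  qed
  have \<nu>: "\<And>\<eta>. \<eta> \<in> ?S \<Longrightarrow> 0 < \<nu> s \<eta>" "(\<Sum>\<eta>\<in>?S. \<nu> s \<eta>) = 1" if s: "s \<in> {0..T}" for s
  proof -
    interpret lg: lattice_gas K N "r s" by (rule gas[OF s])
    have eq: "\<nu> s \<eta> = lg.\<nu> \<eta>" if "\<eta> \<in> lg.\<Omega>" for \<eta> unfolding \<nu>_def by (rule lg.\<nu>_eq_pmf[OF that])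
    show "0 < \<nu> s \<eta>" if "\<eta> \<in> ?S" for \<eta> using that eq lg.\<nu>_pos unfolding lg.\<Omega>_eq[symmetric] by simp
    show "(\<Sum>\<eta>\<in>?S. \<nu> s \<eta>) = 1" using eq lg.\<nu>_sum_1 unfolding lg.\<Omega>_eq[symmetric] by simp
  qed
  \<comment> \<open>Mixing with the invariant law makes the density positive, so that the entropy is differentiable.\<close>
  define \<mu> where "\<mu> = (\<lambda>e s \<eta>. (1 - e) * law M X s \<eta> + e * \<pi> \<eta>)"
  have main: "0 \<le> kl ?S (\<mu> e t) (\<nu> t) \<and> kl ?S (\<mu> e t) (\<nu> t) \<le> exp (a * T) * (kl ?S (\<mu> e 0) (\<nu> 0) + B * T)"
    if e: "0 < e" "e < 1" for e
  proof -
    have \<mu>_pos: "0 < \<mu> e s \<eta>" if "\<eta> \<in> ?S" for s \<eta>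
      unfolding \<mu>_def using e \<pi>(1)[OF that] fg.law_nonneg[OF markov, of s \<eta>] by (intro add_nonneg_pos) auto
    have \<mu>_sum: "(\<Sum>\<eta>\<in>?S. \<mu> e s \<eta>) = 1" if "s \<in> {0..T}" for s
      using fg.law_sum[OF markov, of s] that \<pi>(2) by (simp add: \<mu>_def sum.distrib flip: sum_distrib_left)
    define \<mu>' where "\<mu>' = (\<lambda>s \<zeta>. \<Sum>\<eta>\<in>?S. \<mu> e s \<eta> * ?L (indicator {\<zeta>}) \<eta>)"
    have d\<mu>: "((\<lambda>s. \<mu> e s \<zeta>) has_real_derivative \<mu>' s \<zeta>) (at s within {0..T})" if s: "s \<in> {0..T}" and \<zeta>: "\<zeta> \<in> ?S" for s \<zeta>
    proof -
      have "((\<lambda>s. law M X s \<zeta>) has_real_derivative (\<Sum>\<eta>\<in>?S. law M X s \<eta> * ?L (indicator {\<zeta>}) \<eta>)) (at s within {0..T})"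
        by (rule has_field_derivative_subset[OF fg.forward_equation[OF markov _ \<zeta>]]) (use s in auto)
      \<comment> \<open>By invariance the zero derivative of the constant part equals the generator
        tested against \<open>\<pi>\<close>, so the mixture solves the same forward
        equation.\<close>
      from DERIV_add[OF DERIV_cmult[OF this, of "1 - e"] DERIV_const[of "e * \<pi> \<zeta>"]]
      have "((\<lambda>s. \<mu> e s \<zeta>) has_real_derivative (1 - e) * (\<Sum>\<eta>\<in>?S. law M X s \<eta> * ?L (indicator {\<zeta>}) \<eta>) + e * 0) (at s within {0..T})"
        unfolding \<mu>_def by simp
      also have "(1 - e) * (\<Sum>\<eta>\<in>?S. law M X s \<eta> * ?L (indicator {\<zeta>}) \<eta>) + e * 0 = \<mu>' s \<zeta>"
        unfolding \<pi>(3)[of "indicator {\<zeta>}", symmetric] \<mu>'_def \<mu>_def sum_distrib_left sum.distrib[symmetric]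
        by (intro sum.cong refl) (simp add: algebra_simps)
      finally show ?thesis .
    qed
    \<comment> \<open>Expanding \<open>?L u\<close> in indicators moves the generator from the law
      to the test function, which here will be the logarithm of the density.\<close>
    have dual: "(\<Sum>\<zeta>\<in>?S. \<mu>' s \<zeta> * u \<zeta>) = wmean ?S (\<mu> e s) (?L u)" for s u
    proof -
      have "(\<Sum>\<zeta>\<in>?S. \<mu>' s \<zeta> * u \<zeta>) = (\<Sum>\<eta>\<in>?S. \<Sum>\<zeta>\<in>?S. \<mu> e s \<eta> * (u \<zeta> * ?L (indicator {\<zeta>}) \<eta>))"
        unfolding \<mu>'_def sum_distrib_right by (subst sum.swap) (simp add: mult_ac)
      also have "\<dots> = wmean ?S (\<mu> e s) (?L u)"
        unfolding wmean_def sum_distrib_left[symmetric] by (intro sum.cong refl) (simp only: fg.L_expand[of _ u])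
      finally show ?thesis .
    qed
    define g where "g = (\<lambda>s (\<eta> :: 'd config). \<Sum>x\<in>torus N. real K * r' s x * lattice_gas.om K (r s) x (\<eta> x))"
    have d\<nu>: "((\<lambda>s. \<nu> s \<eta>) has_real_derivative \<nu> s \<eta> * g s \<eta>) (at s within {0..T})" if s: "s \<in> {0..T}" and \<eta>: "\<eta> \<in> ?S" for s \<eta>
    proof -
      interpret lg: lattice_gas K N "r s" by (rule gas[OF s])
      have eq: "\<nu> u \<eta> = (\<Prod>x\<in>torus N. site_weight K (r u) x (\<eta> x))" if u: "u \<in> {0..T}" for u
      proof -
        interpret lgu: lattice_gas K N "r u" by (rule gas[OF u])
        show ?thesis using lgu.\<nu>_eq_pmf[of \<eta>] \<eta> unfolding lgu.\<Omega>_eq \<nu>_def lgu.\<nu>_def by simp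
      qed
      have le: "\<eta> x \<le> K" for x using lg.\<Omega>_le[of \<eta> x] \<eta> unfolding lg.\<Omega>_eq by simp
      have "((\<lambda>u. \<Prod>x\<in>torus N. site_weight K (r u) x (\<eta> x)) has_real_derivative
         (\<Prod>x\<in>torus N. site_weight K (r s) x (\<eta> x)) * (\<Sum>x\<in>torus N. real K * r' s x * lg.om x (\<eta> x))) (at s within {0..T})"
        by (intro DERIV_prod_log lg.site_weight_log_deriv dr[OF s] le) auto
      hence "((\<lambda>u. \<Prod>x\<in>torus N. site_weight K (r u) x (\<eta> x)) has_real_derivative \<nu> s \<eta> * g s \<eta>) (at s within {0..T})"
        unfolding eq[OF s] g_def .
      thus ?thesis by (rule has_field_derivative_transform_within[OF _ zero_less_one s]) (simp add: eq)
    qed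
    define H where "H = (\<lambda>s. kl ?S (\<mu> e s) (\<nu> s))"
    define H' where "H' = (\<lambda>s. \<Gamma> * wmean ?S (\<mu> e s) (generator K p N (\<lambda>\<eta>. ln (\<mu> e s \<eta> / \<nu> s \<eta>))) - wmean ?S (\<mu> e s) (g s))"
    have dH: "(H has_real_derivative H' s) (at s within {0..T})" if s: "s \<in> {0..T}" for s
    proof -
      have "?L (\<lambda>_. 1) = (\<lambda>_. 0)" by (simp add: generator_def)
      hence z: "(\<Sum>\<zeta>\<in>?S. \<mu>' s \<zeta>) = 0" using dual[of s "\<lambda>_. 1"] by (simp add: wmean_def)
      have "(H has_real_derivative (\<Sum>\<eta>\<in>?S. \<mu>' s \<eta> * ln (\<mu> e s \<eta> / \<nu> s \<eta>)) - wmean ?S (\<mu> e s) (g s)) (at s within {0..T})"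
        unfolding H_def by (rule kl_has_derivative) (use finS \<mu>_pos \<nu> d\<mu> d\<nu> z s in auto)
      thus ?thesis unfolding dual H'_def by (simp add: wmean_cmult)
    qed
    have nonneg: "0 \<le> H s" if s: "s \<in> {0..T}" for s
      unfolding H_def by (rule kl_nonneg) (use \<mu>_pos \<nu>[OF s] \<mu>_sum[OF s] in auto)
    have rate: "H' s \<le> a * H s + B" if s: "s \<in> {0..T}" for s
    proof -
      interpret lg: lattice_gas K N "r s" by (rule gas[OF s])
      have eq: "\<nu> s \<eta> = lg.\<nu> \<eta>" if "\<eta> \<in> lg.\<Omega>" for \<eta> unfolding \<nu>_def by (rule lg.\<nu>_eq_pmf[OF that])
      interpret es: entropy_setting K N "r s" "\<mu> e s" c \<epsilon> vol
        by unfold_locales (use c c_le[OF s] \<mu>_pos \<mu>_sum[OF s] \<epsilon>[OF s] lg.\<nu>_sum_1 in \<open>auto simp: lg.\<Omega>_eq vol_def\<close>)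
      have Heq: "kl lg.\<Omega> (\<mu> e s) lg.\<nu> = H s" unfolding H_def lg.\<Omega>_eq[symmetric] by (rule kl_cong) (simp_all add: eq)
      have feq: "wmean ?S (\<mu> e s) (generator K p N (\<lambda>\<eta>. ln (\<mu> e s \<eta> / \<nu> s \<eta>))) = wmean lg.\<Omega> (\<mu> e s) (generator K p N (\<lambda>\<eta>. ln (es.f \<eta>)))"
      proof -
        have "?L (\<lambda>\<eta>. ln (\<mu> e s \<eta> / \<nu> s \<eta>)) \<eta> = ?L (\<lambda>\<eta>. ln (es.f \<eta>)) \<eta>" if "\<eta> \<in> ?S" for \<eta>
          by (rule fg.L_cong[OF _ that]) (simp add: es.f_def eq lg.\<Omega>_eq)
        thus ?thesis unfolding lg.\<Omega>_eq using \<Gamma> by (intro wmean_cong) simp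
      qed
      have "H' s \<le> (4 * es.b\<^sup>2) * H s / 2 + vol * \<beta>\<^sup>2 / 2 
       + d * (nd * (es.C\<^sub>0 * (nd * d) / (\<Gamma> * c0) * (A\<^sup>2 * ((2 ^ n)\<^sup>2 * (4 * es.b\<^sup>2 * H s) + G * (4 * es.b\<^sup>2) * vol)) + vol * (es.b ^ 4 * \<epsilon>\<^sup>2 * (\<Gamma> * c0 / (nd * d)) / 2))
           + ((1 + A\<^sup>2) * (4 * es.b\<^sup>2 * H s) + 2 * A\<^sup>2 * (4 * es.b\<^sup>2) * vol / 2 ^ (n * CARD('d))))"
        using es.entropy_rate_bound[OF p c0 \<Gamma> \<beta>[OF s] nN G0 G]
        unfolding H'_def unfolding feq unfolding g_def A_def nd_def d_def Heq lg.\<Omega>_eq[symmetric] by simp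
      also have "\<dots> = a * H s + B"
        unfolding a_def B_def es.b_def es.C\<^sub>0_def b_def[symmetric] C_def[symmetric] by (simp add: algebra_simps add_divide_distrib)
      finally show ?thesis .
    qed
    have a: "a \<ge> 0" and B: "B \<ge> 0"
    proof -
      have "C > 0" unfolding C_def using c by (intro add_pos_pos) auto
      moreover have "nd \<ge> 0" "d \<ge> 0" "vol \<ge> 0" unfolding nd_def d_def vol_def by auto
      moreover have "0 \<le> \<epsilon>" using \<epsilon>[OF T, of 0] N by (force simp: torus_def intro: order_trans[OF abs_ge_zero])
      moreover have "b \<ge> 0" unfolding b_def by simp
      ultimately show "a \<ge> 0" "B \<ge> 0" unfolding a_def B_def using \<Gamma> c0 G0 by (auto intro!: add_nonneg_nonneg mult_nonneg_nonneg divide_nonneg_nonneg)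
    qed
    show ?thesis using gronwall[OF dH rate a B t nonneg[OF T]] nonneg[OF t] unfolding H_def by simp
  qed
  have ev: "eventually (\<lambda>e. 0 < e \<and> e < 1) (at_right (0::real))" by (auto simp: eventually_at_right_field intro!: exI[of _ 1])
  have lim: "((\<lambda>e. kl ?S (\<mu> e s) (\<nu> s)) \<longlongrightarrow> kl ?S (law M X s) (\<nu> s)) (at_right 0)" if s: "s \<in> {0..T}" for s
    unfolding \<mu>_def using finS fg.law_nonneg[OF markov] \<pi>(1) \<nu>(1)[OF s] by (intro kl_mixture_tendsto)
  have "0 \<le> kl ?S (law M X t) (\<nu> t)"
    by (rule tendsto_lowerbound[OF lim[OF t]]) (use ev main in \<open>auto elim: eventually_mono\<close>)
  thus "0 \<le> kl ?S (law M X t) (pmf (binomial_product K N (r t)))" unfolding \<nu>_def .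
  have "kl ?S (law M X t) (\<nu> t) \<le> exp (a * T) * (kl ?S (law M X 0) (\<nu> 0) + B * T)"
  proof (rule tendsto_le[OF trivial_limit_at_right_real _ lim[OF t]])
    show "((\<lambda>e. exp (a * T) * (kl ?S (\<mu> e 0) (\<nu> 0) + B * T)) \<longlongrightarrow> exp (a * T) * (kl ?S (law M X 0) (\<nu> 0) + B * T)) (at_right 0)"
      by (intro tendsto_intros lim[OF T])
  qed (use ev main in \<open>auto elim: eventually_mono\<close>)
  thus "kl ?S (law M X t) (pmf (binomial_product K N (r t)))
      \<le> exp (a * T) * (kl ?S (law M X 0) (pmf (binomial_product K N (r 0))) + B * T)"
    unfolding \<nu>_def .
qed

subsection \<open>Regularity of the profile\<close>

lemma periodic_int:
  fixes g :: "real ^ 'd::finite \<Rightarrow> real" and k :: "'d \<Rightarrow> int"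
  assumes "periodic g"
  shows "g (u + (\<chi> i. of_int (k i))) = g u"
proof -
  have nat1: "g (u + real n *\<^sub>R axis i 1) = g u" for n :: nat and i u
  proof (induction n)
    case (Suc n)
    have e: "u + real (Suc n) *\<^sub>R axis i 1 = (u + real n *\<^sub>R axis i 1) + axis i 1"
      by (simp add: algebra_simps)
    have "g ((u + real n *\<^sub>R axis i 1) + axis i 1) = g (u + real n *\<^sub>R axis i 1)"
      using assms unfolding periodic_def by blast
    thus ?case unfolding e using Suc by simp
  qed simp
  have int1: "g (u + of_int z *\<^sub>R axis i 1) = g u" for z :: int and i u
  proof (cases "z \<ge> 0")
    case True
    thus ?thesis using nat1[of u "nat z" i] by simp
  next
    case False
    thus ?thesis using nat1[of "u + of_int z *\<^sub>R axis i 1" "nat (- z)" i] by (simp add: algebra_simps)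
  qed
  have "g (u + (\<Sum>i\<in>I. of_int (k i) *\<^sub>R axis i 1)) = g u" for I u
    using finite[of I]
  proof (induction I arbitrary: u rule: finite_induct)
    case (insert i I)
    have e: "u + (\<Sum>i\<in>insert i I. of_int (k i) *\<^sub>R axis i 1) = (u + of_int (k i) *\<^sub>R axis i 1) + (\<Sum>i\<in>I. of_int (k i) *\<^sub>R axis i 1)"
      using insert(1,2) by (simp add: add.assoc)
    show ?case unfolding e insert(3) int1 ..
  qed simp
  note sum = this
  have vec: "(\<Sum>i\<in>UNIV. of_int (k i) *\<^sub>R axis i 1) = (\<chi> i. (of_int (k i) :: real))"
    by (simp add: vec_eq_iff axis_def if_distrib cong: if_cong)
  show ?thesis unfolding vec[symmetric] by (rule sum)
qed

text \<open>A time interval times a fundamental cell is compact; every point is brought into the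
  cell by subtracting integer parts.\<close>

lemma periodic_bounded:
  fixes h :: "real \<times> (real ^ 'd::finite) \<Rightarrow> real"
  assumes cont: "continuous_on ({0..\<tau>} \<times> UNIV) h" and per: "\<And>s. s \<in> {0..\<tau>} \<Longrightarrow> periodic (\<lambda>u. h (s, u))"
  obtains C where "C > 0" "\<And>s u. s \<in> {0..\<tau>} \<Longrightarrow> \<bar>h (s, u)\<bar> \<le> C"
proof -
  let ?Q = "{0..\<tau>} \<times> cbox (0 :: real ^ 'd) 1"
  have "compact ?Q" by (intro compact_Times compact_cbox compact_Icc)
  hence "compact (h ` ?Q)" by (rule compact_continuous_image[rotated]) (rule continuous_on_subset[OF cont], auto)
  then obtain C where C: "C > 0" "\<And>z. z \<in> ?Q \<Longrightarrow> \<bar>h z\<bar> \<le> C"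
    by (auto dest!: compact_imp_bounded simp: bounded_pos)
  show ?thesis
  proof (rule that[OF C(1)])
    fix s and u :: "real ^ 'd" assume s: "s \<in> {0..\<tau>}"
    let ?v = "u + (\<chi> i. of_int (- \<lfloor>u $ i\<rfloor>))"
    have "?v \<in> cbox 0 1" by (auto simp: mem_box_cart) linarith+
    hence "\<bar>h (s, ?v)\<bar> \<le> C" using C(2)[of "(s, ?v)"] s by simp
    thus "\<bar>h (s, u)\<bar> \<le> C" using periodic_int[OF per[OF s], of u "\<lambda>i. - \<lfloor>u $ i\<rfloor>"] by simp
  qed
qed

lemma has_derivative_translation:
  assumes "(f has_derivative F) (at (z + v) within S)" "z \<in> S"
    and S: "\<And>y. y \<in> S \<Longrightarrow> y + v \<in> S" and f: "\<And>y. y \<in> S \<Longrightarrow> f (y + v) = f y"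
  shows "(f has_derivative F) (at z within S)"
proof -
  have "((\<lambda>y. y + v) has_derivative (\<lambda>y. y)) (at z within S)" by (auto intro!: derivative_eq_intros)
  moreover have "(f has_derivative F) (at ((\<lambda>y. y + v) z) within (\<lambda>y. y + v) ` S)"
    by (rule has_derivative_subset[OF _]) (use assms(1) S in auto)
  ultimately have "((\<lambda>y. f (y + v)) has_derivative (\<lambda>y. F y)) (at z within S)"
    using has_derivative_in_compose by blast
  thus ?thesis by (rule has_derivative_transform[OF assms(2), rotated]) (simp add: f)
qed

text \<open>\<open>frechet_derivative\<close> is a choice among all derivatives at a point.
  Translation by a unit vector preserves both the domain and \<open>h\<close>, so the candidates at
  the two points are the same and so is the choice.\<close>

lemma frechet_derivative_periodic:
  fixes h :: "real \<times> (real ^ 'd::finite) \<Rightarrow> real"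
  assumes per: "\<And>s. s \<in> {0..\<tau>} \<Longrightarrow> periodic (\<lambda>u. h (s, u))" and s: "s \<in> {0..\<tau>}"
  shows "periodic (\<lambda>u. frechet_derivative h (at (s, u) within {0..\<tau>} \<times> UNIV) b)"
  unfolding periodic_def
proof (intro allI)
  fix u and i :: 'd
  let ?S = "{0..\<tau>} \<times> (UNIV :: (real ^ 'd) set)" and ?v = "(0, axis i 1) :: real \<times> (real ^ 'd)"
  have shift: "h (y + ?v) = h y" "h (y + (- ?v)) = h y" if y: "y \<in> ?S" for y
  proof -
    obtain a w where aw: "y = (a, w)" "a \<in> {0..\<tau>}" using y by auto
    show "h (y + ?v) = h y" using per[OF aw(2)] unfolding periodic_def aw by simp
    have "h (a, (w - axis i 1) + axis i 1) = h (a, w - axis i 1)" using per[OF aw(2)] unfolding periodic_def by blast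
    thus "h (y + (- ?v)) = h y" unfolding aw by simp
  qed
  have e: "(s, u + axis i 1) = (s, u) + ?v" "((s, u) + ?v) + (- ?v) = (s, u)" by simp_all
  have "(h has_derivative F) (at (s, u + axis i 1) within ?S) \<longleftrightarrow> (h has_derivative F) (at (s, u) within ?S)" for F
  proof
    assume "(h has_derivative F) (at (s, u + axis i 1) within ?S)"
    thus "(h has_derivative F) (at (s, u) within ?S)" unfolding e(1)
      by (rule has_derivative_translation) (use s shift in auto)
  next
    assume "(h has_derivative F) (at (s, u) within ?S)"
    hence "(h has_derivative F) (at (((s, u) + ?v) + (- ?v)) within ?S)" unfolding e(2) .
    thus "(h has_derivative F) (at (s, u + axis i 1) within ?S)" unfolding e(1)
      by (rule has_derivative_translation) (use s shift in auto)
  qed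
  thus "frechet_derivative h (at (s, u + axis i 1) within ?S) b = frechet_derivative h (at (s, u) within ?S) b"
    unfolding frechet_derivative_def by simp
qed

text \<open>The mean value inequality twice, without the factor 1/2 of Taylor's formula.\<close>

lemma taylor_second_order:
  fixes \<phi> \<phi>' \<phi>'' :: "real \<Rightarrow> real"
  assumes 1: "\<And>x. (\<phi> has_real_derivative \<phi>' x) (at x)" and 2: "\<And>x. (\<phi>' has_real_derivative \<phi>'' x) (at x)"
    and C: "\<And>x. \<bar>\<phi>'' x\<bar> \<le> C"
  shows "\<bar>\<phi> h - \<phi> 0 - h * \<phi>' 0\<bar> \<le> C * h\<^sup>2"
proof -
  have C0: "0 \<le> C" using C[of 0] by linarith
  have d: "\<bar>\<phi>' x - \<phi>' 0\<bar> \<le> C * \<bar>x\<bar>" for x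
    using field_differentiable_bound[of UNIV \<phi>' \<phi>'' C x 0] 2 C by simp
  have "norm ((\<lambda>x. \<phi> x - x * \<phi>' 0) h - (\<lambda>x. \<phi> x - x * \<phi>' 0) 0) \<le> (C * \<bar>h\<bar>) * norm (h - 0)"
  proof (rule field_differentiable_bound[of "{- \<bar>h\<bar>..\<bar>h\<bar>}"])
    fix z assume z: "z \<in> {- \<bar>h\<bar>..\<bar>h\<bar>}"
    show "((\<lambda>x. \<phi> x - x * \<phi>' 0) has_real_derivative (\<phi>' z - \<phi>' 0)) (at z within {- \<bar>h\<bar>..\<bar>h\<bar>})"
      by (rule has_field_derivative_at_within) (auto intro!: derivative_eq_intros 1)
    have "C * \<bar>z\<bar> \<le> C * \<bar>h\<bar>" using z C0 by (intro mult_left_mono) auto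
    thus "norm (\<phi>' z - \<phi>' 0) \<le> C * \<bar>h\<bar>" using d[of z] by simp
  qed auto
  thus ?thesis by (simp add: power2_eq_square mult.assoc algebra_simps flip: abs_mult)
qed

text \<open>Moving in space at fixed \<open>s\<close> never leaves the slab, so the derivative is
  two-sided even at the boundary times 0 and \<open>\<tau>\<close>.\<close>

lemma directional_derivative:
  fixes h :: "real \<times> (real ^ 'd::finite) \<Rightarrow> real"
  assumes "h differentiable_on {0..\<tau>} \<times> UNIV" "s \<in> {0..\<tau>}"
  shows "((\<lambda>x. h (s, u + x *\<^sub>R axis i 1)) has_real_derivative
      frechet_derivative h (at (s, u + x *\<^sub>R axis i 1) within {0..\<tau>} \<times> UNIV) (0, axis i 1)) (at x)"
proof -
  let ?S = "{0..\<tau>} \<times> (UNIV :: (real ^ 'd) set)" and ?z = "(s, u + x *\<^sub>R axis i 1)"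
  let ?F = "frechet_derivative h (at ?z within ?S)"
  have F: "(h has_derivative ?F) (at ?z within ?S)"
    using assms by (auto simp: differentiable_on_def frechet_derivative_works[symmetric])
  have "((\<lambda>x. (s, u + x *\<^sub>R axis i 1)) has_derivative (\<lambda>y. (0, y *\<^sub>R axis i 1))) (at x)"
    by (auto intro!: derivative_eq_intros)
  hence "((\<lambda>x. h (s, u + x *\<^sub>R axis i 1)) has_derivative (\<lambda>y. ?F (0, y *\<^sub>R axis i 1))) (at x)"
    by (rule has_derivative_in_compose[where g = h and f = "\<lambda>x. (s, u + x *\<^sub>R axis i 1)"])
       (rule has_derivative_subset[OF F], use assms in auto)
  moreover have "?F (0, y *\<^sub>R axis i 1) = ?F (0, axis i 1) * y" for y
    using linear_scale[OF has_derivative_linear[OF F], of y "(0, axis i 1)"] by simp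
  ultimately show ?thesis by (simp add: has_field_derivative_def)
qed

text \<open>\<open>D i\<close> is the i-th space derivative, and periodicity makes all bounds
  uniform. The last clause is the chain rule in a frame that moves with velocity b m while time is
  scaled by \<open>a\<close>; the equation replaces the time derivative by 2 \<rho> times the
  derivative of \<rho> along m.\<close>

lemma burgers_regularity:
  fixes m :: "real ^ 'd::finite"
  assumes \<tau>: "\<tau> > 0" and sol: "burgers_solution m \<rho>ini \<tau> \<rho>"
  obtains C and D :: "'d \<Rightarrow> real \<Rightarrow> real ^ 'd \<Rightarrow> real" where "C > 0"
    and "\<And>s u. s \<in> {0..\<tau>} \<Longrightarrow> \<bar>\<rho> s u\<bar> \<le> C" and "\<And>i s u. s \<in> {0..\<tau>} \<Longrightarrow> \<bar>D i s u\<bar> \<le> C"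
    and "\<And>i s u h. s \<in> {0..\<tau>} \<Longrightarrow> \<bar>\<rho> s (u + h *\<^sub>R axis i 1) - \<rho> s u - h * D i s u\<bar> \<le> C * h\<^sup>2"
    and "\<And>a b T t u. (\<And>t. t \<in> {0..T} \<Longrightarrow> a * t \<in> {0..\<tau>}) \<Longrightarrow> t \<in> {0..T} \<Longrightarrow>
       ((\<lambda>t. \<rho> (a * t) (u - (b * t) *\<^sub>R m)) has_real_derivative
         (2 * a * \<rho> (a * t) (u - (b * t) *\<^sub>R m) - b) * (\<Sum>i\<in>UNIV. m $ i * D i (a * t) (u - (b * t) *\<^sub>R m))) (at t within {0..T})"
proof -
  let ?S = "{0..\<tau>} \<times> (UNIV :: (real ^ 'd) set)"
  define f where "f = (\<lambda>(s, u). \<rho> s u)"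
  have sm: "Ck_on k ?S f" for k using sol unfolding burgers_solution_def smooth_on_def f_def by blast
  have per: "periodic (\<lambda>u. f (s, u))" if "s \<in> {0..\<tau>}" for s using sol that unfolding burgers_solution_def f_def by simp
  define g where "g = (\<lambda>b z. frechet_derivative f (at z within ?S) b)"
  define gg where "gg = (\<lambda>b z. frechet_derivative (g b) (at z within ?S) b)"
  let ?e = "\<lambda>i :: 'd. (0, axis i 1) :: real \<times> (real ^ 'd)"
  have eB: "?e i \<in> Basis" for i by (auto simp: Basis_prod_def axis_in_Basis_iff)
  have fd: "f differentiable_on ?S" using sm[of "Suc 0"] by simp
  have fc: "continuous_on ?S f" using sm[of 0] by simp
  have gd: "g (?e i) differentiable_on ?S" and ggc: "continuous_on ?S (gg (?e i))" for i
    using sm[of "Suc (Suc 0)"] eB[of i] unfolding g_def gg_def by auto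
  have gc: "continuous_on ?S (g (?e i))" for i using gd by (rule differentiable_imp_continuous_on)
  have gper: "periodic (\<lambda>u. g b (s, u))" if "s \<in> {0..\<tau>}" for s b
    unfolding g_def using frechet_derivative_periodic[OF per that] .
  have ggper: "periodic (\<lambda>u. gg b (s, u))" if "s \<in> {0..\<tau>}" for s b
    unfolding gg_def using frechet_derivative_periodic[OF gper that] .
  obtain C1 where C1: "C1 > 0" "\<And>s u. s \<in> {0..\<tau>} \<Longrightarrow> \<bar>f (s, u)\<bar> \<le> C1" using periodic_bounded[OF fc per] by blast
  have "\<exists>C>0. \<forall>s\<in>{0..\<tau>}. \<forall>u. \<bar>g (?e i) (s, u)\<bar> \<le> C" for i using periodic_bounded[OF gc gper] by metis
  then obtain C2 where C2: "\<And>i. C2 i > 0" "\<And>i s u. s \<in> {0..\<tau>} \<Longrightarrow> \<bar>g (?e i) (s, u)\<bar> \<le> C2 i" by metis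
  have "\<exists>C>0. \<forall>s\<in>{0..\<tau>}. \<forall>u. \<bar>gg (?e i) (s, u)\<bar> \<le> C" for i using periodic_bounded[OF ggc ggper] by metis
  then obtain C3 where C3: "\<And>i. C3 i > 0" "\<And>i s u. s \<in> {0..\<tau>} \<Longrightarrow> \<bar>gg (?e i) (s, u)\<bar> \<le> C3 i" by metis
  define C where "C = C1 + (\<Sum>i\<in>UNIV. C2 i) + (\<Sum>i\<in>UNIV. C3 i)"
  have s23: "C2 i \<le> (\<Sum>i\<in>UNIV. C2 i)" "C3 i \<le> (\<Sum>i\<in>UNIV. C3 i)" for i
    using C2(1) C3(1) member_le_sum[of i UNIV C2] member_le_sum[of i UNIV C3] by (auto simp: less_imp_le)
  have C: "C1 \<le> C" "C2 i \<le> C" "C3 i \<le> C" for i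
    using s23[of i] C1(1) C2(1)[of i] C3(1)[of i] unfolding C_def by linarith+
  show ?thesis
  proof (rule that[of C "\<lambda>i s u. g (?e i) (s, u)"])
    show "C > 0" using C(1) C1(1) by linarith
    fix s u assume s: "s \<in> {0..\<tau>}"
    show "\<bar>\<rho> s u\<bar> \<le> C" using C1(2)[OF s, of u] C(1) by (simp add: f_def)
    fix i
    show "\<bar>g (?e i) (s, u)\<bar> \<le> C" using C2(2)[OF s, of i u] C(2)[of i] by simp
    fix h
    show "\<bar>\<rho> s (u + h *\<^sub>R axis i 1) - \<rho> s u - h * g (?e i) (s, u)\<bar> \<le> C * h\<^sup>2"
    proof -
      have 1: "((\<lambda>x. f (s, u + x *\<^sub>R axis i 1)) has_real_derivative g (?e i) (s, u + x *\<^sub>R axis i 1)) (at x)" for x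
        unfolding g_def by (rule directional_derivative[OF fd s])
      have 2: "((\<lambda>x. g (?e i) (s, u + x *\<^sub>R axis i 1)) has_real_derivative gg (?e i) (s, u + x *\<^sub>R axis i 1)) (at x)" for x
        unfolding gg_def by (rule directional_derivative[OF gd s])
      have 3: "\<bar>gg (?e i) (s, u + x *\<^sub>R axis i 1)\<bar> \<le> C" for x
        using C3(2)[OF s] C(3) by (rule order_trans)
      show ?thesis using taylor_second_order[OF 1 2 3, of h] by (simp add: f_def)
    qed
  next
    fix a b T t :: real and u :: "real ^ 'd"
    assume aT: "\<And>t. t \<in> {0..T} \<Longrightarrow> a * t \<in> {0..\<tau>}" and t: "t \<in> {0..T}"
    let ?p = "\<lambda>t. (a * t, u - (b * t) *\<^sub>R m)"
    define s v where "s = a * t" and "v = u - (b * t) *\<^sub>R m"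
    have s: "s \<in> {0..\<tau>}" using aT[OF t] by (simp add: s_def)
    define F where "F = frechet_derivative f (at (s, v) within ?S)"
    have F: "(f has_derivative F) (at (s, v) within ?S)"
      unfolding F_def using fd s by (auto simp: differentiable_on_def frechet_derivative_works[symmetric])
    have linF: "linear F" by (rule has_derivative_linear[OF F])
    have "(?p has_derivative (\<lambda>y. (a * y, - (b * y) *\<^sub>R m))) (at t within {0..T})"
      by (auto intro!: derivative_eq_intros)
    hence dF: "((\<lambda>t. f (?p t)) has_derivative (\<lambda>y. F (a * y, - (b * y) *\<^sub>R m))) (at t within {0..T})"
      by (rule has_derivative_in_compose[where g = f and f = ?p])
         (rule has_derivative_subset[OF F[unfolded s_def v_def]], use aT in auto)
    have FF: "F (a * y, - (b * y) *\<^sub>R m) = (a * F (1, 0) - b * (\<Sum>i\<in>UNIV. m $ i * F (?e i))) * y" for y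
    proof -
      have mm: "m = (\<Sum>i\<in>UNIV. m $ i *\<^sub>R axis i 1)" by (simp add: vec_eq_iff axis_def if_distrib cong: if_cong)
      have zm: "(0, m) = (\<Sum>i\<in>UNIV. m $ i *\<^sub>R ?e i)"
      proof -
        have "(\<Sum>i\<in>UNIV. m $ i *\<^sub>R ?e i) = (0, \<Sum>i\<in>UNIV. m $ i *\<^sub>R axis i 1)"
          by (simp add: prod_eq_iff fst_sum snd_sum)
        also have "\<dots> = (0, m)" by (rule arg_cong[OF mm[symmetric]])
        finally show ?thesis by (rule sym)
      qed
      have "F (a * y, - (b * y) *\<^sub>R m) = F ((a * y) *\<^sub>R (1, 0) + (- (b * y)) *\<^sub>R (0, m))" by simp
      also have "\<dots> = (a * y) * F (1, 0) + (- (b * y)) * F (0, m)"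
        by (simp only: linear_add[OF linF] linear_scale[OF linF] real_scaleR_def)
      also have "F (0, m) = F (\<Sum>i\<in>UNIV. m $ i *\<^sub>R ?e i)" by (rule arg_cong[OF zm])
      also have "\<dots> = (\<Sum>i\<in>UNIV. m $ i * F (?e i))"
        by (simp only: linear_sum[OF linF] linear_scale[OF linF] real_scaleR_def o_def)
      finally have "F (a * y, - (b * y) *\<^sub>R m) = (a * y) * F (1, 0) + (- (b * y)) * (\<Sum>i\<in>UNIV. m $ i * F (?e i))" .
      thus ?thesis by (simp add: algebra_simps)
    qed
    \<comment> \<open>The solution concept speaks of a one-sided time derivative and of the gradient
      of the square. Both are identified with values of the joint derivative \<open>F\<close>, the
      first by uniqueness of derivatives on an interval of positive length.\<close>
    have F10: "F (1, 0) = 2 * f (s, v) * (\<Sum>i\<in>UNIV. m $ i * F (?e i))"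
    proof -
      obtain Dt gr where Dt: "((\<lambda>r. \<rho> r v) has_real_derivative Dt) (at s within {0..\<tau>})"
        and gr: "GDERIV (\<lambda>w. (\<rho> s w)\<^sup>2) v :> gr" and eq: "Dt - m \<bullet> gr = 0"
        using sol s unfolding burgers_solution_def by blast
      have "((\<lambda>r. (r, v)) has_derivative (\<lambda>y. (y, 0))) (at s within {0..\<tau>})" by (auto intro!: derivative_eq_intros)
      hence "((\<lambda>r. f (r, v)) has_derivative (\<lambda>y. F (y, 0))) (at s within {0..\<tau>})"
        by (rule has_derivative_in_compose[where g = f and f = "\<lambda>r. (r, v)"]) (rule has_derivative_subset[OF F], auto)
      moreover have "(\<lambda>y. F (y, 0)) = (\<lambda>y. F (1, 0) * y)"
      proof
        fix y show "F (y, 0) = F (1, 0) * y" using linear_scale[OF linF, of y "(1, 0)"] by simp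
      qed
      ultimately have "((\<lambda>r. f (r, v)) has_real_derivative F (1, 0)) (at s within {0..\<tau>})"
        unfolding has_field_derivative_def by (simp only:)
      hence "((\<lambda>r. \<rho> r v) has_real_derivative F (1, 0)) (at s within {0..\<tau>})" by (simp add: f_def)
      moreover have "at s within {0..\<tau>} \<noteq> bot"
        using s \<tau> by (auto simp: trivial_limit_within islimpt_Icc)
      ultimately have DtF: "Dt = F (1, 0)" using Dt has_field_derivative_unique by blast
      have "gr $ i = 2 * f (s, v) * F (?e i)" for i
      proof -
        have "((\<lambda>w. (\<rho> s w)\<^sup>2) has_derivative (\<lambda>h. h \<bullet> gr)) (at v)" using gr by (simp add: gderiv_def)
        moreover have "((\<lambda>x. v + x *\<^sub>R axis i 1) has_derivative (\<lambda>y. y *\<^sub>R axis i 1)) (at 0)" by (auto intro!: derivative_eq_intros)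
        ultimately have "((\<lambda>x. (\<rho> s (v + x *\<^sub>R axis i 1))\<^sup>2) has_derivative (\<lambda>y. (y *\<^sub>R axis i 1) \<bullet> gr)) (at 0)"
          using has_derivative_compose[of "\<lambda>x. v + x *\<^sub>R axis i 1" "\<lambda>y. y *\<^sub>R axis i 1" 0 UNIV "\<lambda>w. (\<rho> s w)\<^sup>2" "\<lambda>h. h \<bullet> gr"] by simp
        moreover have "(\<lambda>y. (y *\<^sub>R axis i 1) \<bullet> gr) = (\<lambda>y. gr $ i * y)" by (simp add: fun_eq_iff inner_axis')
        ultimately have "((\<lambda>x. (\<rho> s (v + x *\<^sub>R axis i 1))\<^sup>2) has_real_derivative gr $ i) (at 0)"
          unfolding has_field_derivative_def by (simp only:)
        moreover have "((\<lambda>x. (\<rho> s (v + x *\<^sub>R axis i 1))\<^sup>2) has_real_derivative 2 * f (s, v) * F (?e i)) (at 0)"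
        proof -
          have "((\<lambda>x. \<rho> s (v + x *\<^sub>R axis i 1)) has_real_derivative F (?e i)) (at 0)"
            using directional_derivative[OF fd s, of v i 0] by (simp add: F_def f_def)
          from DERIV_power[OF this, of 2] show ?thesis by (simp add: f_def mult_ac)
        qed
        ultimately show ?thesis by (rule DERIV_unique)
      qed
      hence "m \<bullet> gr = 2 * f (s, v) * (\<Sum>i\<in>UNIV. m $ i * F (?e i))"
        by (simp add: inner_vec_def sum_distrib_left mult_ac)
      thus ?thesis using eq DtF by simp
    qed
    have "(\<lambda>y. F (a * y, - (b * y) *\<^sub>R m)) = (\<lambda>y. (2 * a * f (s, v) - b) * (\<Sum>i\<in>UNIV. m $ i * F (?e i)) * y)"
      unfolding FF F10 by (simp add: fun_eq_iff algebra_simps)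
    hence "((\<lambda>t. f (?p t)) has_real_derivative (2 * a * f (s, v) - b) * (\<Sum>i\<in>UNIV. m $ i * F (?e i))) (at t within {0..T})"
      using dF unfolding has_field_derivative_def by (simp only:)
    thus "((\<lambda>t. \<rho> (a * t) (u - (b * t) *\<^sub>R m)) has_real_derivative
         (2 * a * \<rho> (a * t) (u - (b * t) *\<^sub>R m) - b) * (\<Sum>i\<in>UNIV. m $ i * g (?e i) (a * t, u - (b * t) *\<^sub>R m))) (at t within {0..T})"
      unfolding g_def F_def s_def v_def f_def case_prod_conv .
  qed
qed

section \<open>The profile on the lattice\<close>

lemma embed_site_torus_add:
  assumes "periodic g" "N > 0"
  shows "g (embed_site N (torus_add N x y) - w) = g (embed_site N x + embed_site N y - w)"
proof -
  have "embed_site N (torus_add N x y) - w = (embed_site N x + embed_site N y - w) + (\<chi> i. of_int (- ((x $ i + y $ i) div int N)))"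
  proof -
    have "real_of_int ((x $ i + y $ i) mod int N) / real N = (real_of_int (x $ i) + real_of_int (y $ i)) / real N - real_of_int ((x $ i + y $ i) div int N)" for i
    proof -
      have "real_of_int ((x $ i + y $ i) mod int N) = real_of_int (x $ i + y $ i - (x $ i + y $ i) div int N * int N)"
        by (simp only: minus_div_mult_eq_mod)
      thus ?thesis using assms(2) by (simp add: diff_divide_distrib)
    qed
    thus ?thesis by (simp add: embed_site_def torus_add_def vec_eq_iff add_divide_distrib)
  qed
  thus ?thesis using periodic_int[OF assms(1)] by metis
qed

lemma embed_site_axis:
  "embed_site N (axis i 1) = (1 / real N) *\<^sub>R axis i 1"
  "embed_site N (- axis i 1) = (- 1 / real N) *\<^sub>R axis i 1"
  by (auto simp: embed_site_def axis_def vec_eq_iff)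

text \<open>For fixed \<open>r\<close> the currents are affine in the neighbouring values
  \<open>r1\<close> and \<open>r2\<close>, so the first order in the gradient \<open>g\<close> is
  exact and only the Taylor errors remain. The factor K - 2 r is the derivative of the flux r (K -
  r).\<close>

lemma bond_current_expansion:
  fixes p q r r1 r2 K e g :: real
  assumes pq: "p \<ge> 0" "q \<ge> 0" and r: "0 \<le> r" "r \<le> K" and 1: "\<bar>r1 - r - g\<bar> \<le> e" and 2: "\<bar>r2 - r + g\<bar> \<le> e"
  shows "\<bar>p * (r2 * (K - r) - r * (K - r1)) + q * (r1 * (K - r) - r * (K - r2)) + (p - q) * g * (K - 2 * r)\<bar> \<le> (p + q) * (K * e)"
proof -
  define x y where "x = r1 - r - g" and "y = r2 - r + g"
  have xy: "\<bar>x\<bar> \<le> e" "\<bar>y\<bar> \<le> e" using 1 2 by (auto simp: x_def y_def)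
  have b: "\<bar>u * (K - r) + r * v\<bar> \<le> K * e" if "\<bar>u\<bar> \<le> e" "\<bar>v\<bar> \<le> e" for u v
  proof -
    have "\<bar>u * (K - r) + r * v\<bar> \<le> \<bar>u\<bar> * (K - r) + r * \<bar>v\<bar>"
      using r abs_triangle_ineq[of "u * (K - r)" "r * v"] by (simp add: abs_mult)
    also have "\<dots> \<le> e * (K - r) + r * e" using that r by (intro add_mono mult_right_mono mult_left_mono) auto
    finally show ?thesis by (simp add: algebra_simps)
  qed
  have "p * (r2 * (K - r) - r * (K - r1)) + q * (r1 * (K - r) - r * (K - r2)) + (p - q) * g * (K - 2 * r)
      = p * (y * (K - r) + r * x) + q * (x * (K - r) + r * y)" by (simp add: x_def y_def algebra_simps)
  also have "\<bar>\<dots>\<bar> \<le> p * \<bar>y * (K - r) + r * x\<bar> + q * \<bar>x * (K - r) + r * y\<bar>"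
    using pq abs_triangle_ineq[of "p * (y * (K - r) + r * x)" "q * (x * (K - r) + r * y)"] by (simp add: abs_mult)
  also have "\<dots> \<le> p * (K * e) + q * (K * e)" using pq b xy by (intro add_mono mult_left_mono) auto
  finally show ?thesis by (simp add: algebra_simps)
qed

text \<open>The speed of the profile and the leading term of the accelerated current divergence
  agree exactly: this is the Burgers equation seen in the moving frame. The defect is the second
  order Taylor error N^(- \<alpha>) N^(- 2) times N^(1 + \<kappa>).\<close>

lemma profile_estimates:
  fixes p :: "'d::finite + 'd \<Rightarrow> real" and D :: "'d \<Rightarrow> real \<Rightarrow> real ^ 'd \<Rightarrow> real"
  assumes N: "N > 1" and K: "K > 0" and p: "\<And>i. p i \<ge> 0" and \<rho>star: "0 < \<rho>star" "\<rho>star < real K"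
    and C: "C > 0" and \<rho>C: "\<And>s u. s \<in> {0..\<tau>} \<Longrightarrow> \<bar>\<rho> s u\<bar> \<le> C" and DC: "\<And>i s u. s \<in> {0..\<tau>} \<Longrightarrow> \<bar>D i s u\<bar> \<le> C"
    and taylor: "\<And>i s u h. s \<in> {0..\<tau>} \<Longrightarrow> \<bar>\<rho> s (u + h *\<^sub>R axis i 1) - \<rho> s u - h * D i s u\<bar> \<le> C * h\<^sup>2"
    and time: "\<And>a b T t u. (\<And>t. t \<in> {0..T} \<Longrightarrow> a * t \<in> {0..\<tau>}) \<Longrightarrow> t \<in> {0..T} \<Longrightarrow>
       ((\<lambda>t. \<rho> (a * t) (u - (b * t) *\<^sub>R drift p)) has_real_derivative
         (2 * a * \<rho> (a * t) (u - (b * t) *\<^sub>R drift p) - b) * (\<Sum>i\<in>UNIV. drift p $ i * D i (a * t) (u - (b * t) *\<^sub>R drift p))) (at t within {0..T})"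
    and per: "\<And>s. s \<in> {0..\<tau>} \<Longrightarrow> periodic (\<rho> s)"
    and aT: "\<And>t. t \<in> {0..T} \<Longrightarrow> real N powr (\<kappa> - \<alpha>) * t \<in> {0..\<tau>}"
    and small: "real N powr (- \<alpha>) * C \<le> \<delta>" and \<delta>: "8 * \<delta> \<le> \<rho>star" "8 * \<delta> \<le> real K - \<rho>star"
  defines "r \<equiv> \<lambda>t x. profile K p \<rho>star \<alpha> \<kappa> \<rho> N t (embed_site N x)"
  obtains r' where "\<And>t. t \<in> {0..T} \<Longrightarrow> lattice_gas K N (r t)"
    and "\<And>t x. t \<in> {0..T} \<Longrightarrow> \<rho>star / 2 \<le> r t x \<and> (real K - \<rho>star) / 2 \<le> real K - r t x"
    and "\<And>t x. t \<in> {0..T} \<Longrightarrow> ((\<lambda>s. r s x) has_real_derivative r' t x) (at t within {0..T})"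
    and "\<And>t x i. t \<in> {0..T} \<Longrightarrow> \<bar>r t x - r t (torus_add N x (axis i 1))\<bar> \<le> 2 * C * real N powr (- 1 - \<alpha>)"
    and "\<And>t x. t \<in> {0..T} \<Longrightarrow> \<bar>real K * (real N powr (1 + \<kappa>) * current_divergence K p N (r t) x - r' t x)\<bar>
       \<le> (real K)\<^sup>2 * (\<Sum>i\<in>UNIV. p i) * C * real N powr (\<kappa> - 1 - \<alpha>)"
proof -
  define \<theta> h a b where "\<theta> = real N powr (- \<alpha>)" and "h = 1 / real N" and "a = real N powr (\<kappa> - \<alpha>)"
    and "b = real N powr \<kappa> * (real K - 2 * \<rho>star)"
  define m where "m = drift p"
  define V where "V = (\<lambda>t x. embed_site N x - (b * t) *\<^sub>R m)"
  define mD where "mD = (\<lambda>t x. \<Sum>i\<in>UNIV. m $ i * D i (a * t) (V t x))"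
  have N0: "real N > 0" "N > 0" using N by auto
  have \<theta>: "\<theta> > 0" unfolding \<theta>_def using N0 by simp
  have h: "0 < h" "h \<le> 1" unfolding h_def using N by auto
  have r: "r t x = \<rho>star + \<theta> * \<rho> (a * t) (V t x)" for t x
    by (simp add: r_def profile_def Let_def \<theta>_def a_def b_def V_def m_def)
  have s: "a * t \<in> {0..\<tau>}" if "t \<in> {0..T}" for t using aT[OF that] by (simp add: a_def)
  have close: "\<bar>r t x - \<rho>star\<bar> \<le> \<delta>" if "t \<in> {0..T}" for t x
  proof -
    have "\<bar>r t x - \<rho>star\<bar> = \<theta> * \<bar>\<rho> (a * t) (V t x)\<bar>" unfolding r using \<theta> by (simp add: abs_mult)
    also have "\<dots> \<le> \<theta> * C" using \<theta> \<rho>C[OF s[OF that]] by (intro mult_left_mono) auto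
    finally show ?thesis using small by (simp add: \<theta>_def)
  qed
  define \<kappa>' where "\<kappa>' = real K - \<rho>star"
  have \<kappa>': "\<kappa>' > 0" "8 * \<delta> \<le> \<kappa>'" using \<rho>star \<delta> by (auto simp: \<kappa>'_def)
  \<comment> \<open>A relative deviation of 1/8 suffices for the odds bound of the lattice gas,
    because (9/8)^2 \<le> 2 (7/8)^2.\<close>
  have range: "7 / 8 * \<rho>star \<le> r t x" "r t x \<le> 9 / 8 * \<rho>star" "7 / 8 * \<kappa>' \<le> real K - r t x" "real K - r t x \<le> 9 / 8 * \<kappa>'" if "t \<in> {0..T}" for t x
  proof -
    have "r t x - \<rho>star \<le> \<delta>" "\<rho>star - r t x \<le> \<delta>" using close[OF that, of x] by (simp_all add: abs_le_iff)
    thus "7 / 8 * \<rho>star \<le> r t x" "r t x \<le> 9 / 8 * \<rho>star" "7 / 8 * \<kappa>' \<le> real K - r t x" "real K - r t x \<le> 9 / 8 * \<kappa>'"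
      using \<delta> by (simp_all add: \<kappa>'_def field_simps)
  qed
  have pos: "0 < r t x" "0 < real K - r t x" if "t \<in> {0..T}" for t x
    using range[OF that, of x] \<rho>star \<kappa>'(1) by linarith+
  have plus: "r t (torus_add N x (axis i 1)) = \<rho>star + \<theta> * \<rho> (a * t) (V t x + h *\<^sub>R axis i 1)"
    and minus: "r t (torus_add N x (- axis i 1)) = \<rho>star + \<theta> * \<rho> (a * t) (V t x + (- h) *\<^sub>R axis i 1)" if t: "t \<in> {0..T}" for t x i
    unfolding r V_def using embed_site_torus_add[OF per[OF s[OF t]] N0(2), of x _ "(b * t) *\<^sub>R m"]
    by (simp_all add: embed_site_axis h_def algebra_simps)
  have E: "\<bar>r t (torus_add N x (axis i 1)) - r t x - \<theta> * h * D i (a * t) (V t x)\<bar> \<le> \<theta> * (C * h\<^sup>2)"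
    "\<bar>r t (torus_add N x (- axis i 1)) - r t x + \<theta> * h * D i (a * t) (V t x)\<bar> \<le> \<theta> * (C * h\<^sup>2)" if t: "t \<in> {0..T}" for t x i
  proof -
    have e: "\<bar>\<theta> * y\<bar> \<le> \<theta> * (C * h\<^sup>2)" if "\<bar>y\<bar> \<le> C * h\<^sup>2" for y
      using that \<theta> by (simp add: abs_mult)
    show "\<bar>r t (torus_add N x (axis i 1)) - r t x - \<theta> * h * D i (a * t) (V t x)\<bar> \<le> \<theta> * (C * h\<^sup>2)"
      unfolding plus[OF t] r[of t x] using e[OF taylor[OF s[OF t], of "V t x" h i]] by (simp add: algebra_simps)
    show "\<bar>r t (torus_add N x (- axis i 1)) - r t x + \<theta> * h * D i (a * t) (V t x)\<bar> \<le> \<theta> * (C * h\<^sup>2)"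
      unfolding minus[OF t] r[of t x] using e[of "\<rho> (a * t) (V t x + (- h) *\<^sub>R axis i 1) - \<rho> (a * t) (V t x) - (- h) * D i (a * t) (V t x)"] taylor[OF s[OF t], of "V t x" "- h" i]
      by (simp add: algebra_simps)
  qed
  define r' where "r' = (\<lambda>t x. \<theta> * ((2 * a * \<rho> (a * t) (V t x) - b) * mD t x))"
  have powr: "real N powr x * real N powr y = real N powr (x + y)" for x y by (simp add: powr_add)
  have hp: "h = real N powr (- 1)" unfolding h_def using N0 by (simp add: powr_minus_divide)
  show ?thesis
  proof (rule that[of r'])
    fix t assume t: "t \<in> {0..T}"
    show "lattice_gas K N (r t)"
    proof
      show "K > 0" "N > 1" by fact+
      fix x :: "'d site"
      show "0 < r t x" "r t x < real K" using pos[OF t, of x] by auto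
      fix y :: "'d site"
      have "r t x * (real K - r t y) \<le> (9 / 8 * \<rho>star) * (9 / 8 * \<kappa>')"
        using range[OF t] pos[OF t] \<rho>star by (intro mult_mono) (auto simp: less_imp_le)
      also have "\<dots> \<le> 2 * ((7 / 8 * \<rho>star) * (7 / 8 * \<kappa>'))" using \<rho>star \<kappa>'(1) by simp
      also have "\<dots> \<le> 2 * (r t y * (real K - r t x))"
        using range[OF t] pos[OF t] \<rho>star \<kappa>'(1) by (intro mult_left_mono mult_mono) (auto simp: less_imp_le)
      finally show "r t x * (real K - r t y) \<le> 2 * (r t y * (real K - r t x))" .
    qed
    fix x :: "'d site"
    show "\<rho>star / 2 \<le> r t x \<and> (real K - \<rho>star) / 2 \<le> real K - r t x"
      using range[OF t, of x] \<rho>star \<kappa>'(1) unfolding \<kappa>'_def by linarith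
    have "((\<lambda>s. \<rho>star + \<theta> * \<rho> (a * s) (V s x)) has_real_derivative 0 + r' t x) (at t within {0..T})"
      unfolding r'_def mD_def V_def m_def by (intro DERIV_add DERIV_const DERIV_cmult time s t)
    thus "((\<lambda>s. r s x) has_real_derivative r' t x) (at t within {0..T})" unfolding r by simp
    show "\<bar>r t x - r t (torus_add N x (axis i 1))\<bar> \<le> 2 * C * real N powr (- 1 - \<alpha>)" for i
    proof -
      have "\<bar>\<theta> * h * D i (a * t) (V t x)\<bar> \<le> \<theta> * h * C"
        using \<theta> h DC[OF s[OF t]] by (simp add: abs_mult)
      moreover have "\<theta> * (C * h\<^sup>2) \<le> \<theta> * h * C"
        using \<theta> h C by (simp add: power2_eq_square mult_left_le)
      ultimately have "\<bar>r t x - r t (torus_add N x (axis i 1))\<bar> \<le> 2 * (\<theta> * h * C)" using E(1)[OF t, of x i] by linarith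
      also have "\<theta> * h = real N powr (- 1 - \<alpha>)" unfolding \<theta>_def hp powr by (simp add: add.commute)
      finally show ?thesis by (simp add: mult_ac)
    qed
    have cd: "\<bar>current_divergence K p N (r t) x + \<theta> * h * (real K - 2 * r t x) * mD t x\<bar> \<le> (\<Sum>i\<in>UNIV. p i) * (real K * (\<theta> * (C * h\<^sup>2)))"
    proof -
      let ?T = "\<lambda>j. p (Inl j) * (r t (torus_add N x (- axis j 1)) * (real K - r t x) - r t x * (real K - r t (torus_add N x (axis j 1))))
         + p (Inr j) * (r t (torus_add N x (axis j 1)) * (real K - r t x) - r t x * (real K - r t (torus_add N x (- axis j 1))))"
      have "current_divergence K p N (r t) x = (\<Sum>j\<in>UNIV. ?T j)"
        unfolding current_divergence_def sum_UNIV_Plus by (simp add: sum.distrib)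
      moreover have "\<theta> * h * (real K - 2 * r t x) * mD t x = (\<Sum>j\<in>UNIV. (p (Inl j) - p (Inr j)) * (\<theta> * h * D j (a * t) (V t x)) * (real K - 2 * r t x))"
        unfolding mD_def sum_distrib_left m_def drift_def by (intro sum.cong refl) simp
      ultimately have "\<bar>current_divergence K p N (r t) x + \<theta> * h * (real K - 2 * r t x) * mD t x\<bar>
         = \<bar>\<Sum>j\<in>UNIV. ?T j + (p (Inl j) - p (Inr j)) * (\<theta> * h * D j (a * t) (V t x)) * (real K - 2 * r t x)\<bar>"
        by (simp only: sum.distrib)
      also have "\<dots> \<le> (\<Sum>j\<in>UNIV. (p (Inl j) + p (Inr j)) * (real K * (\<theta> * (C * h\<^sup>2))))"
        using pos[OF t, of x] by (intro order_trans[OF sum_abs] sum_mono bond_current_expansion p E[OF t]) auto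
      also have "\<dots> = (\<Sum>i\<in>UNIV. p i) * (real K * (\<theta> * (C * h\<^sup>2)))"
        unfolding sum_UNIV_Plus by (simp add: sum.distrib flip: sum_distrib_right)
      finally show ?thesis .
    qed
    \<comment> \<open>Since 2 a \<rho> - b equals - N^\<kappa> (K - 2 \<open>\<rho>star\<close> - 2
      \<theta> \<rho>), the moving frame and the nonlinearity combine into the single factor K - 2
      r.\<close>
    have key: "r' t x = - (real N powr (1 + \<kappa>) * (\<theta> * h * (real K - 2 * r t x) * mD t x))"
    proof -
      have e1: "real N powr (1 + \<kappa>) * h = real N powr \<kappa>" unfolding hp powr by simp
      have e2: "a = real N powr \<kappa> * \<theta>" unfolding a_def \<theta>_def powr by simp
      have "real N powr (1 + \<kappa>) * (\<theta> * h * (real K - 2 * r t x) * mD t x) = real N powr \<kappa> * \<theta> * (real K - 2 * r t x) * mD t x"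
        unfolding e1[symmetric] by (simp add: mult_ac)
      also have "\<dots> = - r' t x"
        unfolding r'_def b_def e2 r[of t x] by (simp add: algebra_simps e2[symmetric])
      finally show ?thesis by simp
    qed
    have "\<bar>real K * (real N powr (1 + \<kappa>) * current_divergence K p N (r t) x - r' t x)\<bar>
       = real K * (real N powr (1 + \<kappa>) * \<bar>current_divergence K p N (r t) x + \<theta> * h * (real K - 2 * r t x) * mD t x\<bar>)"
    proof -
      have eq: "real K * (real N powr (1 + \<kappa>) * current_divergence K p N (r t) x - r' t x)
        = real K * (real N powr (1 + \<kappa>) * (current_divergence K p N (r t) x + \<theta> * h * (real K - 2 * r t x) * mD t x))"
        unfolding key by (simp add: algebra_simps)
      show ?thesis unfolding eq by (simp add: abs_mult)
    qed
    also have "\<dots> \<le> real K * (real N powr (1 + \<kappa>) * ((\<Sum>i\<in>UNIV. p i) * (real K * (\<theta> * (C * h\<^sup>2)))))"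
      by (intro mult_left_mono cd) auto
    also have "\<dots> = (real K)\<^sup>2 * (\<Sum>i\<in>UNIV. p i) * C * (real N powr (1 + \<kappa>) * \<theta> * (h * h))"
      by (simp add: power2_eq_square mult_ac)
    also have "real N powr (1 + \<kappa>) * \<theta> * (h * h) = real N powr (\<kappa> - 1 - \<alpha>)"
      unfolding \<theta>_def hp powr by (simp add: algebra_simps)
    finally show "\<bar>real K * (real N powr (1 + \<kappa>) * current_divergence K p N (r t) x - r' t x)\<bar>
       \<le> (real K)\<^sup>2 * (\<Sum>i\<in>UNIV. p i) * C * real N powr (\<kappa> - 1 - \<alpha>)" .
  qed
qed

subsection \<open>Asymptotics\<close>

text \<open>The number of doubling steps is of order log N and enters squared; half of the exponent
  absorbs each logarithm.\<close>

lemma log_square_powr_tendsto_0: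
  fixes e c :: real
  assumes "e < 0"
  shows "(\<lambda>N. (c * log 2 (real N) + 1)\<^sup>2 * real N powr e) \<longlonglongrightarrow> 0"
proof -
  have p: "(\<lambda>N. real N powr (e / 2)) \<longlonglongrightarrow> 0"
    using assms by (intro tendsto_neg_powr filterlim_real_sequentially) simp
  have "(\<lambda>N. ln (real N) / real N powr (- e / 2)) \<longlonglongrightarrow> 0" using assms by (intro lim_ln_over_power) simp
  moreover have "ln (real N) / real N powr (- e / 2) = ln (real N) * real N powr (e / 2)" for N
    unfolding divide_inverse[of "ln (real N)"] powr_minus[symmetric] by simp
  ultimately have l: "(\<lambda>N. ln (real N) * real N powr (e / 2)) \<longlonglongrightarrow> 0" by (simp only:)
  have lim: "(\<lambda>N. ((c / ln 2) * (ln (real N) * real N powr (e / 2)) + real N powr (e / 2))\<^sup>2) \<longlonglongrightarrow> ((c / ln 2) * 0 + 0)\<^sup>2"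
    by (intro tendsto_intros l p)
  have eq: "((c / ln 2) * (ln (real N) * real N powr (e / 2)) + real N powr (e / 2))\<^sup>2 = (c * log 2 (real N) + 1)\<^sup>2 * real N powr e" for N
  proof -
    have "real N powr e = (real N powr (e / 2))\<^sup>2" by (simp add: power2_eq_square flip: powr_add)
    thus ?thesis by (simp add: log_def power2_eq_square algebra_simps)
  qed
  show ?thesis using lim unfolding eq by simp
qed

text \<open>2^n is N^g rounded down to a power of two, at the loss of a factor of at most 2.\<close>

lemma block_exponent_bounds:
  fixes N :: nat and g :: real
  assumes N: "N > 1" and g: "g > 0"
  defines "n \<equiv> nat \<lfloor>g * log 2 (real N)\<rfloor>"
  shows "real n \<le> g * log 2 (real N)" and "2 ^ n \<le> real N powr g" and "real N powr g / 2 \<le> 2 ^ n"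
proof -
  have l: "0 \<le> g * log 2 (real N)" using N g by simp
  have n: "real n \<le> g * log 2 (real N)" "g * log 2 (real N) - 1 \<le> real n"
    unfolding n_def using l by (auto simp: of_nat_nat)
  show "real n \<le> g * log 2 (real N)" by (rule n(1))
  have "2 powr (g * log 2 (real N)) = (2 powr log 2 (real N)) powr g" by (simp only: powr_powr mult.commute)
  hence e: "real N powr g = 2 powr (g * log 2 (real N))" using N by simp
  have p: "2 ^ n = (2::real) powr real n" by (simp add: powr_realpow)
  show "2 ^ n \<le> real N powr g" unfolding e p using n(1) by (intro powr_mono) auto
  have "2 powr (g * log 2 (real N)) / 2 = (2::real) powr (g * log 2 (real N) - 1)" by (simp add: powr_diff)
  also have "\<dots> \<le> 2 powr real n" using n(2) by (intro powr_mono) auto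
  finally show "real N powr g / 2 \<le> 2 ^ n" unfolding e p .
qed

text \<open>Bookkeeping of powers of N. In the rate only 2 g - 1 - \<kappa> is left, because
  \<kappa> \<le> \<alpha> keeps \<open>A\<close> bounded. In the source term N^(d - 2 \<alpha>) is
  taken out; what is left is 2 \<kappa> - 2 from the defect of the profile, \<kappa> - 1 + \<gamma>
  from the variance of the doubling steps, \<kappa> - 1 from the product remainder of the gradients
  and 2 \<kappa> - g d from the final block mean.\<close>

lemma growth_constants_bound:
  fixes N d :: nat and g \<gamma> \<alpha> \<kappa> c0 C' b cA cB cE :: real
  assumes N: "N > 1" and d: "d > 0" and g: "g > 0" and \<kappa>\<alpha>: "\<kappa> \<le> \<alpha>" and c0: "c0 > 0" and C': "C' > 0" and G0: "0 \<le> G" and G: "G \<le> real N powr \<gamma>"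
  defines "n \<equiv> nat \<lfloor>g * log 2 (real N)\<rfloor>" and "\<Gamma> \<equiv> real N powr (1 + \<kappa>)" and "A \<equiv> cA * real N powr (\<kappa> - \<alpha>)"
    and "\<beta> \<equiv> cB * real N powr (\<kappa> - 1 - \<alpha>)" and "\<epsilon> \<equiv> cE * real N powr (- 1 - \<alpha>)" and "vol \<equiv> real N powr real d"
    and "L \<equiv> (real d * g) * log 2 (real N) + 1"
  defines "nd \<equiv> real (n * d) + 1"
  shows "2 * b\<^sup>2 + real d * (nd * (C' * (nd * real d) / (\<Gamma> * c0) * (A\<^sup>2 * ((2 ^ n)\<^sup>2 * (4 * b\<^sup>2)))) + (1 + A\<^sup>2) * (4 * b\<^sup>2))
       \<le> 2 * b\<^sup>2 + real d * ((C' * real d / c0 * 4 * b\<^sup>2 * cA\<^sup>2) * (L\<^sup>2 * real N powr (2 * g - 1 - \<kappa>)) + (1 + cA\<^sup>2) * (4 * b\<^sup>2))" (is ?one)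
    and "vol * \<beta>\<^sup>2 / 2 + real d * (nd * (C' * (nd * real d) / (\<Gamma> * c0) * (A\<^sup>2 * (G * (4 * b\<^sup>2) * vol)) + vol * (b ^ 4 * \<epsilon>\<^sup>2 * (\<Gamma> * c0 / (nd * real d)) / 2))
           + 2 * A\<^sup>2 * (4 * b\<^sup>2) * vol / 2 ^ (n * d))
       \<le> real N powr (real d - 2 * \<alpha>) * (cB\<^sup>2 / 2 * real N powr (2 * \<kappa> - 2) + real d * ((C' * real d / c0 * 4 * b\<^sup>2 * cA\<^sup>2) * (L\<^sup>2 * real N powr (\<kappa> - 1 + \<gamma>))
           + b ^ 4 * cE\<^sup>2 * c0 / (2 * real d) * real N powr (\<kappa> - 1) + 8 * b\<^sup>2 * cA\<^sup>2 * 2 ^ d * real N powr (2 * \<kappa> - g * real d)))" (is ?two)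
proof -
  have powr: "real N powr x * real N powr y = real N powr (x + y)" for x y by (simp add: powr_add)
  have sq: "(real N powr x)\<^sup>2 = real N powr (2 * x)" for x by (simp add: power2_eq_square powr)
  have inv: "1 / real N powr x = real N powr (- x)" for x by (simp add: powr_minus_divide)
  have nd: "nd > 0" unfolding nd_def by (simp add: add_nonneg_pos)
  have "real n * real d \<le> (g * log 2 (real N)) * real d"
    using block_exponent_bounds(1)[OF N g] unfolding n_def by (intro mult_right_mono) auto
  hence ndL: "nd \<le> L" unfolding nd_def L_def by (simp add: mult_ac)
  hence nd2: "nd\<^sup>2 \<le> L\<^sup>2" using nd by (intro power_mono) auto
  have A2: "A\<^sup>2 = cA\<^sup>2 * real N powr (2 * \<kappa> - 2 * \<alpha>)" unfolding A_def power_mult_distrib sq by (simp add: algebra_simps)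
  have "real N powr (2 * \<kappa> - 2 * \<alpha>) \<le> real N powr 0" using \<kappa>\<alpha> N by (intro powr_mono) auto
  hence A2': "A\<^sup>2 \<le> cA\<^sup>2" unfolding A2 using N by (simp add: mult_left_le)
  have \<Gamma>: "\<Gamma> > 0" unfolding \<Gamma>_def using N by simp
  have n2: "(2 ^ n)\<^sup>2 \<le> real N powr (2 * g)"
    unfolding sq[symmetric] using block_exponent_bounds(2)[OF N g] unfolding n_def by (intro power_mono) auto
  let ?c = "C' * real d / c0 * 4 * b\<^sup>2"
  have c: "0 \<le> ?c" using C' c0 by simp
  show ?one
  proof (intro add_mono mult_left_mono mult_right_mono A2' order_refl)
    have "nd * (C' * (nd * real d) / (\<Gamma> * c0) * (A\<^sup>2 * ((2 ^ n)\<^sup>2 * (4 * b\<^sup>2)))) = ?c * (nd\<^sup>2 * (A\<^sup>2 * ((2 ^ n)\<^sup>2 * (1 / \<Gamma>))))"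
      by (simp add: power2_eq_square mult_ac)
    also have "\<dots> \<le> ?c * (L\<^sup>2 * (cA\<^sup>2 * (real N powr (2 * g) * (1 / \<Gamma>))))"
      using nd2 A2' n2 \<Gamma> by (intro mult_left_mono[OF _ c] mult_mono mult_nonneg_nonneg) auto
    also have "\<dots> = ?c * cA\<^sup>2 * (L\<^sup>2 * (real N powr (2 * g) * real N powr (- (1 + \<kappa>))))"
      unfolding \<Gamma>_def inv by (simp add: mult_ac)
    also have "real N powr (2 * g) * real N powr (- (1 + \<kappa>)) = real N powr (2 * g - 1 - \<kappa>)"
      unfolding powr by (simp add: algebra_simps)
    finally show "nd * (C' * (nd * real d) / (\<Gamma> * c0) * (A\<^sup>2 * ((2 ^ n)\<^sup>2 * (4 * b\<^sup>2)))) \<le> ?c * cA\<^sup>2 * (L\<^sup>2 * real N powr (2 * g - 1 - \<kappa>))" .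
  qed auto
  let ?g = "real N powr (real d - 2 * \<alpha>)"
  have B1: "vol * \<beta>\<^sup>2 / 2 = ?g * (cB\<^sup>2 / 2 * real N powr (2 * \<kappa> - 2))"
  proof -
    have "vol * \<beta>\<^sup>2 / 2 = cB\<^sup>2 / 2 * (real N powr real d * real N powr (2 * (\<kappa> - 1 - \<alpha>)))"
      unfolding vol_def \<beta>_def power_mult_distrib sq by simp
    also have "real N powr real d * real N powr (2 * (\<kappa> - 1 - \<alpha>)) = ?g * real N powr (2 * \<kappa> - 2)"
      unfolding powr by (simp add: algebra_simps)
    finally show ?thesis by (simp add: mult_ac)
  qed
  have B2: "nd * (C' * (nd * real d) / (\<Gamma> * c0) * (A\<^sup>2 * (G * (4 * b\<^sup>2) * vol))) \<le> ?g * (?c * cA\<^sup>2 * (L\<^sup>2 * real N powr (\<kappa> - 1 + \<gamma>)))"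
  proof -
    have "nd * (C' * (nd * real d) / (\<Gamma> * c0) * (A\<^sup>2 * (G * (4 * b\<^sup>2) * vol))) = (?c * A\<^sup>2 * vol * (1 / \<Gamma>)) * (nd\<^sup>2 * G)"
      by (simp add: power2_eq_square mult_ac)
    also have "\<dots> \<le> (?c * A\<^sup>2 * vol * (1 / \<Gamma>)) * (L\<^sup>2 * real N powr \<gamma>)"
    proof (intro mult_left_mono mult_mono nd2 G G0)
      show "0 \<le> ?c * A\<^sup>2 * vol * (1 / \<Gamma>)"
        using \<Gamma> unfolding vol_def by (intro mult_nonneg_nonneg[OF mult_nonneg_nonneg[OF mult_nonneg_nonneg[OF c]]]) auto
    qed auto
    also have "\<dots> = ?c * cA\<^sup>2 * L\<^sup>2 * (real N powr (2 * \<kappa> - 2 * \<alpha>) * real N powr real d * real N powr (- (1 + \<kappa>)) * real N powr \<gamma>)"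
      unfolding A2 vol_def \<Gamma>_def inv by (simp add: mult_ac)
    also have "real N powr (2 * \<kappa> - 2 * \<alpha>) * real N powr real d * real N powr (- (1 + \<kappa>)) * real N powr \<gamma> = ?g * real N powr (\<kappa> - 1 + \<gamma>)"
      unfolding powr by (simp add: algebra_simps)
    finally show ?thesis by (simp add: mult_ac)
  qed
  have B3: "nd * (vol * (b ^ 4 * \<epsilon>\<^sup>2 * (\<Gamma> * c0 / (nd * real d)) / 2)) = ?g * (b ^ 4 * cE\<^sup>2 * c0 / (2 * real d) * real N powr (\<kappa> - 1))"
  proof -
    have "nd * (vol * (b ^ 4 * \<epsilon>\<^sup>2 * (\<Gamma> * c0 / (nd * real d)) / 2)) = b ^ 4 * c0 / (2 * real d) * (vol * \<epsilon>\<^sup>2 * \<Gamma>)"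
      using nd d by (simp add: field_simps)
    also have "vol * \<epsilon>\<^sup>2 * \<Gamma> = cE\<^sup>2 * (real N powr real d * real N powr (2 * (- 1 - \<alpha>)) * real N powr (1 + \<kappa>))"
      unfolding vol_def \<epsilon>_def \<Gamma>_def power_mult_distrib sq by (simp add: mult_ac)
    also have "real N powr real d * real N powr (2 * (- 1 - \<alpha>)) * real N powr (1 + \<kappa>) = ?g * real N powr (\<kappa> - 1)"
      unfolding powr by (simp add: algebra_simps)
    finally show ?thesis by (simp add: mult_ac)
  qed
  have B4: "2 * A\<^sup>2 * (4 * b\<^sup>2) * vol / 2 ^ (n * d) \<le> ?g * (8 * b\<^sup>2 * cA\<^sup>2 * 2 ^ d * real N powr (2 * \<kappa> - g * real d))"
  proof -
    have "(real N powr g / 2) ^ d \<le> (2 ^ n) ^ d" using block_exponent_bounds(3)[OF N g] unfolding n_def by (intro power_mono) auto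
    hence l: "(real N powr g / 2) ^ d \<le> 2 ^ (n * d)" by (simp add: power_mult)
    have Ng: "real N powr g > 0" using N by simp
    have "2 * A\<^sup>2 * (4 * b\<^sup>2) * vol / 2 ^ (n * d) \<le> 2 * A\<^sup>2 * (4 * b\<^sup>2) * vol / (real N powr g / 2) ^ d"
      using l Ng unfolding vol_def by (intro divide_left_mono mult_pos_pos mult_nonneg_nonneg) auto
    also have "\<dots> = 8 * b\<^sup>2 * 2 ^ d * (A\<^sup>2 * vol * (1 / (real N powr g) ^ d))"
      using Ng by (simp add: power_divide)
    also have "(real N powr g) ^ d = real N powr (g * real d)"
      using Ng by (simp add: powr_powr flip: powr_realpow)
    also have "A\<^sup>2 * vol * (1 / real N powr (g * real d)) = cA\<^sup>2 * (real N powr (2 * \<kappa> - 2 * \<alpha>) * real N powr real d * real N powr (- (g * real d)))"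
      unfolding A2 vol_def inv by (simp add: mult_ac)
    also have "real N powr (2 * \<kappa> - 2 * \<alpha>) * real N powr real d * real N powr (- (g * real d)) = ?g * real N powr (2 * \<kappa> - g * real d)"
      unfolding powr by (simp add: algebra_simps)
    finally show ?thesis by (simp add: mult_ac)
  qed
  have "vol * \<beta>\<^sup>2 / 2 + real d * (nd * (C' * (nd * real d) / (\<Gamma> * c0) * (A\<^sup>2 * (G * (4 * b\<^sup>2) * vol)) + vol * (b ^ 4 * \<epsilon>\<^sup>2 * (\<Gamma> * c0 / (nd * real d)) / 2))
           + 2 * A\<^sup>2 * (4 * b\<^sup>2) * vol / 2 ^ (n * d))
     \<le> ?g * (cB\<^sup>2 / 2 * real N powr (2 * \<kappa> - 2)) + real d * ((?g * (?c * cA\<^sup>2 * (L\<^sup>2 * real N powr (\<kappa> - 1 + \<gamma>)))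
        + ?g * (b ^ 4 * cE\<^sup>2 * c0 / (2 * real d) * real N powr (\<kappa> - 1)))
        + ?g * (8 * b\<^sup>2 * cA\<^sup>2 * 2 ^ d * real N powr (2 * \<kappa> - g * real d)))"
    unfolding distrib_left[of nd] B1 B3 by (intro add_mono mult_left_mono B2 B4 order_refl) auto
  also have "\<dots> = ?g * (cB\<^sup>2 / 2 * real N powr (2 * \<kappa> - 2) + real d * (?c * cA\<^sup>2 * (L\<^sup>2 * real N powr (\<kappa> - 1 + \<gamma>))
           + b ^ 4 * cE\<^sup>2 * c0 / (2 * real d) * real N powr (\<kappa> - 1) + 8 * b\<^sup>2 * cA\<^sup>2 * 2 ^ d * real N powr (2 * \<kappa> - g * real d)))"
    by (simp only: distrib_left mult_ac add_ac)
  finally show ?two .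
qed

section \<open>Conclusion for an admissible block exponent\<close>

lemma entropy_H_eq_kl:
  assumes "lattice_gas K N (\<lambda>x. profile K p \<rho>star \<alpha> \<kappa> \<rho> N t (embed_site N x))"
  shows "entropy_H K p \<rho>star \<alpha> \<kappa> \<rho> M X N t
    = kl (Config K N) (law (M N) (X N) t) (pmf (binomial_product K N (\<lambda>x. profile K p \<rho>star \<alpha> \<kappa> \<rho> N t (embed_site N x))))"
proof -
  interpret lattice_gas K N "\<lambda>x. profile K p \<rho>star \<alpha> \<kappa> \<rho> N t (embed_site N x)" by (rule assms)
  have "pmf (binomial_product K N (\<lambda>x. profile K p \<rho>star \<alpha> \<kappa> \<rho> N t (embed_site N x))) \<eta> > 0" if "\<eta> \<in> Config K N" for \<eta>
    using that \<nu>_eq_pmf[of \<eta>] \<nu>_pos[of \<eta>] by (simp add: \<Omega>_eq)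
  thus ?thesis unfolding entropy_H_def rel_entropy_def kl_def product_law_def binomial_product_def Let_def
    by (intro sum.cong refl) (simp add: less_imp_neq[symmetric])
qed

text \<open>\<open>g\<close> stays a parameter so that one argument serves all dimensions. The
  conditions on \<open>g\<close> and \<open>\<gamma>\<close>, together with \<kappa> < 1, make every
  exponent in \<open>growth_constants_bound\<close> negative and, through g < 1, let the block fit
  into the torus.\<close>

lemma entropy_H_smallo:
  fixes K :: nat and p :: "'d::finite + 'd \<Rightarrow> real" and \<rho>star \<alpha> \<kappa> T \<tau> g \<gamma> :: real
    and \<rho> :: "real \<Rightarrow> real ^ 'd \<Rightarrow> real" and M :: "nat \<Rightarrow> 'w measure" and X :: "nat \<Rightarrow> real \<Rightarrow> 'w \<Rightarrow> 'd config"
  assumes K: "K > 0" and p: "\<And>i. p i \<ge> 0" and pp: "\<And>i. p (Inl i) + p (Inr i) > 0"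
    and \<rho>star: "0 < \<rho>star" "\<rho>star < real K" and \<alpha>: "\<alpha> > 0" and \<kappa>: "\<kappa> \<le> \<alpha>" "\<kappa> < 1" and T: "T > 0" and \<tau>: "\<tau> > 0"
    and sol: "burgers_solution (drift p) \<rho>ini \<tau> \<rho>" and T\<tau>: "\<kappa> = \<alpha> \<Longrightarrow> T \<le> \<tau>"
    and markov: "\<And>N. N > 0 \<Longrightarrow> markov_process (M N) (X N) (Config K N) (\<lambda>f \<eta>. real N powr (1 + \<kappa>) * generator K p N f \<eta>)"
    and initial: "(\<lambda>N. entropy_H K p \<rho>star \<alpha> \<kappa> \<rho> M X N 0) \<in> o(\<lambda>N. real N powr (real CARD('d) - 2 * \<alpha>))"
    and g: "0 < g" "g < 1" "2 * g < 1 + \<kappa>" "2 * \<kappa> < g * real CARD('d)"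
    and \<gamma>: "\<kappa> - 1 + \<gamma> < 0" "\<gamma> = (if CARD('d) = 1 then g else 0)"
    and t: "t \<in> {0..T}"
  shows "(\<lambda>N. entropy_H K p \<rho>star \<alpha> \<kappa> \<rho> M X N t) \<in> o(\<lambda>N. real N powr (real CARD('d) - 2 * \<alpha>))"
proof -
  obtain C and D :: "'d \<Rightarrow> real \<Rightarrow> real ^ 'd \<Rightarrow> real" where C: "C > 0"
    and \<rho>C: "\<And>s u. s \<in> {0..\<tau>} \<Longrightarrow> \<bar>\<rho> s u\<bar> \<le> C" and DC: "\<And>i s u. s \<in> {0..\<tau>} \<Longrightarrow> \<bar>D i s u\<bar> \<le> C"
    and taylor: "\<And>i s u h. s \<in> {0..\<tau>} \<Longrightarrow> \<bar>\<rho> s (u + h *\<^sub>R axis i 1) - \<rho> s u - h * D i s u\<bar> \<le> C * h\<^sup>2"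
    and time: "\<And>a b T t u. (\<And>t. t \<in> {0..T} \<Longrightarrow> a * t \<in> {0..\<tau>}) \<Longrightarrow> t \<in> {0..T} \<Longrightarrow>
       ((\<lambda>t. \<rho> (a * t) (u - (b * t) *\<^sub>R drift p)) has_real_derivative
         (2 * a * \<rho> (a * t) (u - (b * t) *\<^sub>R drift p) - b) * (\<Sum>i\<in>UNIV. drift p $ i * D i (a * t) (u - (b * t) *\<^sub>R drift p))) (at t within {0..T})"
    using burgers_regularity[OF \<tau> sol] by blast
  have per: "periodic (\<rho> s)" if "s \<in> {0..\<tau>}" for s using sol that by (simp add: burgers_solution_def)
  define \<delta> where "\<delta> = min \<rho>star (real K - \<rho>star) / 8"
  define c where "c = min \<rho>star (real K - \<rho>star) / 2"
  have \<delta>: "\<delta> > 0" "8 * \<delta> \<le> \<rho>star" "8 * \<delta> \<le> real K - \<rho>star" and c: "c > 0" using \<rho>star by (auto simp: \<delta>_def c_def)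
  define c0 where "c0 = Min (range (\<lambda>j. (p (Inl j) + p (Inr j)) / 2))"
  have c0: "c0 > 0" "c0 \<le> (p (Inl j) + p (Inr j)) / 2" for j
  proof -
    show "c0 > 0" unfolding c0_def using pp by simp
    show "c0 \<le> (p (Inl j) + p (Inr j)) / 2" unfolding c0_def by (rule Min_le) auto
  qed
  define d where "d = CARD('d)"
  have d: "d > 0" unfolding d_def by simp
  define P where "P = (\<Sum>i\<in>UNIV. p i)"
  define b where "b = real K / c\<^sup>2"
  define C' where "C' = 3 / (2 * c ^ 4) + 1 / 2"
  have C': "C' > 0" unfolding C'_def using c by (intro add_pos_pos) auto
  define cA where "cA = P * real K ^ 3 * (2 * C)"
  define cB where "cB = (real K)\<^sup>2 * P * C"
  define cE where "cE = 2 * C"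
  define n where "n = (\<lambda>N. nat \<lfloor>g * log 2 (real N)\<rfloor>)"
  \<comment> \<open>A bound for 2^(k (2 - d)) over the scales k < n: the largest scale decides for d
    = 1, and 1 suffices in higher dimension.\<close>
  define G :: "nat \<Rightarrow> real" where "G = (\<lambda>N. if d = 1 then 2 ^ n N else 1)"
  define L where "L = (\<lambda>N. (real d * g) * log 2 (real N) + 1)"
  define R where "R = (\<lambda>N. L N ^ 2 * real N powr (2 * g - 1 - \<kappa>))"
  define W where "W = (\<lambda>N. cB\<^sup>2 / 2 * real N powr (2 * \<kappa> - 2) + real d * ((C' * real d / c0 * 4 * b\<^sup>2 * cA\<^sup>2) * ((L N)\<^sup>2 * real N powr (\<kappa> - 1 + \<gamma>))
           + b ^ 4 * cE\<^sup>2 * c0 / (2 * real d) * real N powr (\<kappa> - 1) + 8 * b\<^sup>2 * cA\<^sup>2 * 2 ^ d * real N powr (2 * \<kappa> - g * real d)))"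
  define a where "a = 2 * b\<^sup>2 + real d * ((C' * real d / c0 * 4 * b\<^sup>2 * cA\<^sup>2) * 1 + (1 + cA\<^sup>2) * (4 * b\<^sup>2))"
  let ?g = "\<lambda>N. real N powr (real CARD('d) - 2 * \<alpha>)"
  let ?H = "\<lambda>t N. entropy_H K p \<rho>star \<alpha> \<kappa> \<rho> M X N t"
  have R: "R \<longlonglongrightarrow> 0" unfolding R_def L_def using g by (intro log_square_powr_tendsto_0) simp
  have W: "W \<longlonglongrightarrow> 0"
  proof -
    have pw: "(\<lambda>N. real N powr e) \<longlonglongrightarrow> 0" if "e < 0" for e
      using that by (intro tendsto_neg_powr filterlim_real_sequentially)
    have "W \<longlonglongrightarrow> cB\<^sup>2 / 2 * 0 + real d * ((C' * real d / c0 * 4 * b\<^sup>2 * cA\<^sup>2) * 0 + b ^ 4 * cE\<^sup>2 * c0 / (2 * real d) * 0 + 8 * b\<^sup>2 * cA\<^sup>2 * 2 ^ d * 0)"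
      unfolding W_def L_def using g \<kappa> \<gamma>(1)
      by (intro tendsto_add tendsto_mult tendsto_const pw log_square_powr_tendsto_0) (auto simp: d_def)
    thus ?thesis by simp
  qed
  have ev1: "eventually (\<lambda>N. N > 1) sequentially" by (rule eventually_gt_at_top)
  have ev2: "eventually (\<lambda>N. real N powr (- \<alpha>) * C < \<delta>) sequentially"
  proof -
    have "(\<lambda>N. real N powr (- \<alpha>) * C) \<longlonglongrightarrow> 0 * C"
      using \<alpha> by (intro tendsto_mult tendsto_const tendsto_neg_powr filterlim_real_sequentially) simp
    thus ?thesis using \<delta>(1) by (intro order_tendstoD) simp_all
  qed
  \<comment> \<open>The Burgers clock is N^(\<kappa> - \<alpha>) t. For \<kappa> < \<alpha> it
    shrinks to 0, so any lifetime \<open>\<tau>\<close> of the smooth solution is eventually long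
    enough; for \<kappa> = \<alpha> it is t itself.\<close>
  have ev3: "eventually (\<lambda>N. real N powr (\<kappa> - \<alpha>) * T \<le> \<tau>) sequentially"
  proof (cases "\<kappa> = \<alpha>")
    case True
    show ?thesis using ev1 by eventually_elim (use T\<tau>[OF True] True in simp)
  next
    case False
    have "(\<lambda>N. real N powr (\<kappa> - \<alpha>) * T) \<longlonglongrightarrow> 0 * T"
      using \<kappa> False by (intro tendsto_mult tendsto_const tendsto_neg_powr filterlim_real_sequentially) simp
    hence "eventually (\<lambda>N. real N powr (\<kappa> - \<alpha>) * T < \<tau>) sequentially" using \<tau> by (intro order_tendstoD) simp_all
    thus ?thesis by eventually_elim simp
  qed
  \<comment> \<open>Once R N < 1, the Gronwall rate is at most the constant \<open>a\<close>, which
    does not depend on N.\<close>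
  have ev4: "eventually (\<lambda>N. R N < 1) sequentially" by (rule order_tendstoD(2)[OF R]) simp
  have bound: "eventually (\<lambda>N. 0 \<le> ?H t N \<and> ?H t N \<le> exp (a * T) * (?H 0 N + ?g N * W N * T)) sequentially"
    using ev1 ev2 ev3 ev4
  proof eventually_elim
    case (elim N)
    note N = elim(1)
    define r where "r = (\<lambda>t x. profile K p \<rho>star \<alpha> \<kappa> \<rho> N t (embed_site N x))"
    have aT: "real N powr (\<kappa> - \<alpha>) * s \<in> {0..\<tau>}" if "s \<in> {0..T}" for s
    proof -
      have "real N powr (\<kappa> - \<alpha>) * s \<le> real N powr (\<kappa> - \<alpha>) * T" using that by (intro mult_left_mono) auto
      thus ?thesis using elim(3) that by auto
    qed
    obtain r' where gas: "\<And>t. t \<in> {0..T} \<Longrightarrow> lattice_gas K N (r t)"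
      and rc: "\<And>t x. t \<in> {0..T} \<Longrightarrow> \<rho>star / 2 \<le> r t x \<and> (real K - \<rho>star) / 2 \<le> real K - r t x"
      and dr: "\<And>t x. t \<in> {0..T} \<Longrightarrow> ((\<lambda>s. r s x) has_real_derivative r' t x) (at t within {0..T})"
      and \<epsilon>: "\<And>t x i. t \<in> {0..T} \<Longrightarrow> \<bar>r t x - r t (torus_add N x (axis i 1))\<bar> \<le> 2 * C * real N powr (- 1 - \<alpha>)"
      and \<beta>: "\<And>t x. t \<in> {0..T} \<Longrightarrow> \<bar>real K * (real N powr (1 + \<kappa>) * current_divergence K p N (r t) x - r' t x)\<bar>
         \<le> (real K)\<^sup>2 * (\<Sum>i\<in>UNIV. p i) * C * real N powr (\<kappa> - 1 - \<alpha>)"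
      using profile_estimates[OF N K p \<rho>star C \<rho>C DC taylor time per aT less_imp_le[OF elim(2)] \<delta>(2,3)]
      unfolding r_def by blast
    have cle: "c \<le> r t x \<and> c \<le> real K - r t x" if "t \<in> {0..T}" for t x
      using rc[OF that, of x] by (auto simp: c_def)
    have nN: "2 ^ n N < N"
    proof -
      have "2 ^ n N \<le> real N powr g" unfolding n_def by (rule block_exponent_bounds(2)[OF N g(1)])
      also have "\<dots> < real N powr 1" using N g by (intro powr_less_mono) auto
      finally have "real (2 ^ n N) < real N" using N by simp
      thus ?thesis by (simp only: of_nat_less_iff)
    qed
    have G0: "0 \<le> G N" unfolding G_def by simp
    have G1: "(2 ^ k)\<^sup>2 \<le> G N * 2 ^ (k * CARD('d))" if k: "k < n N" for k
    proof (cases "d = 1")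
      case True
      have "(2::real) ^ k \<le> 2 ^ n N" using k by (intro power_increasing) auto
      thus ?thesis using True unfolding G_def d_def by (simp add: power2_eq_square mult_right_mono)
    next
      case False
      hence "2 \<le> CARD('d)" using d unfolding d_def by linarith
      hence "(2::real) ^ (k * 2) \<le> 2 ^ (k * CARD('d))" by (intro power_increasing) auto
      thus ?thesis using False unfolding G_def by (simp add: power_mult)
    qed
    have G2: "G N \<le> real N powr \<gamma>"
      unfolding G_def n_def \<gamma>(2) d_def using block_exponent_bounds(2)[OF N g(1)] N by simp
    have vol: "real (card (torus N :: 'd site set)) = real N powr real d"
      unfolding card_torus d_def using N by (simp add: powr_realpow)
    have A: "P * real K ^ 3 * (cE * real N powr (- 1 - \<alpha>)) * real N powr (1 + \<kappa>) = cA * real N powr (\<kappa> - \<alpha>)"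
      unfolding cA_def cE_def by (simp add: mult.assoc flip: powr_add)
    define nd where "nd = real (n N * d) + 1"
    define AA where "AA = cA * real N powr (\<kappa> - \<alpha>)"
    define a1 where "a1 = 2 * b\<^sup>2 + real d * (nd * (C' * (nd * real d) / (real N powr (1 + \<kappa>) * c0) * (AA\<^sup>2 * ((2 ^ n N)\<^sup>2 * (4 * b\<^sup>2)))) + (1 + AA\<^sup>2) * (4 * b\<^sup>2))"
    define B1 where "B1 = real N powr real d * (cB * real N powr (\<kappa> - 1 - \<alpha>))\<^sup>2 / 2 + real d * (nd * (C' * (nd * real d) / (real N powr (1 + \<kappa>) * c0) * (AA\<^sup>2 * (G N * (4 * b\<^sup>2) * real N powr real d)) + real N powr real d * (b ^ 4 * (cE * real N powr (- 1 - \<alpha>))\<^sup>2 * (real N powr (1 + \<kappa>) * c0 / (nd * real d)) / 2))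
           + 2 * AA\<^sup>2 * (4 * b\<^sup>2) * real N powr real d / 2 ^ (n N * d))"
    have \<Gamma>: "real N powr (1 + \<kappa>) > 0" using N by simp
    have grow: "0 \<le> kl (Config K N) (law (M N) (X N) t) (pmf (binomial_product K N (r t)))"
      "kl (Config K N) (law (M N) (X N) t) (pmf (binomial_product K N (r t)))
        \<le> exp (a1 * T) * (kl (Config K N) (law (M N) (X N) 0) (pmf (binomial_product K N (r 0))) + B1 * T)"
      using entropy_growth[OF gas \<rho>star c cle dr \<epsilon> p c0 \<Gamma> \<beta> nN G0 G1 markov t] N
      unfolding P_def[symmetric] cE_def[symmetric] d_def[symmetric] b_def[symmetric] C'_def[symmetric]
      unfolding vol A cB_def[symmetric] nd_def[symmetric]
      unfolding AA_def[symmetric] unfolding a1_def[symmetric] B1_def[symmetric]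
      by auto
    have "a1 \<le> 2 * b\<^sup>2 + real d * ((C' * real d / c0 * 4 * b\<^sup>2 * cA\<^sup>2) * R N + (1 + cA\<^sup>2) * (4 * b\<^sup>2))"
      unfolding a1_def nd_def AA_def R_def L_def n_def
      by (rule growth_constants_bound(1)[OF N d g(1) \<kappa>(1) c0(1) C' G0 G2])
    also have "\<dots> \<le> a" unfolding a_def using elim(4) C' c0 by (intro add_mono mult_left_mono) auto
    finally have a1: "a1 \<le> a" .
    have B1: "B1 \<le> ?g N * W N"
      unfolding B1_def nd_def AA_def W_def L_def n_def d_def[symmetric]
      by (rule growth_constants_bound(2)[OF N d g(1) \<kappa>(1) c0(1) C' G0 G2])
    have H: "?H s N = kl (Config K N) (law (M N) (X N) s) (pmf (binomial_product K N (r s)))" if "s \<in> {0..T}" for s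
      unfolding r_def by (rule entropy_H_eq_kl) (rule gas[OF that, unfolded r_def])
    have T0: "0 \<in> {0..T}" using T by simp
    \<comment> \<open>Enlarging the rate from \<open>a1\<close> to \<open>a\<close> preserves the
      bound only if the bracket is nonnegative, which follows from the nonnegative entropy at time
      t.\<close>
    have "0 \<le> exp (a1 * T) * (?H 0 N + B1 * T)" using grow unfolding H[OF T0] by linarith
    hence nn: "0 \<le> ?H 0 N + B1 * T" by (simp add: zero_le_mult_iff)
    have "exp (a1 * T) * (?H 0 N + B1 * T) \<le> exp (a * T) * (?H 0 N + ?g N * W N * T)"
      using a1 B1 T nn by (intro mult_mono) (auto intro!: mult_right_mono)
    thus ?case using grow unfolding H[OF t] H[OF T0] by linarith
  qed
  have "(\<lambda>N. ?H t N) \<in> O(\<lambda>N. ?H 0 N + ?g N * W N * T)"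
  proof (rule bigoI[where c = "exp (a * T)"])
    show "eventually (\<lambda>N. norm (?H t N) \<le> exp (a * T) * norm (?H 0 N + ?g N * W N * T)) sequentially"
      using bound
    proof eventually_elim
      case (elim N)
      have le: "exp (a * T) * (?H 0 N + ?g N * W N * T) \<le> exp (a * T) * \<bar>?H 0 N + ?g N * W N * T\<bar>" by (intro mult_left_mono) auto
      have "norm (?H t N) = ?H t N" using elim by simp
      thus ?case using order_trans[OF conjunct2[OF elim] le] by (simp only: real_norm_def)
    qed
  qed
  moreover have "(\<lambda>N. ?H 0 N + ?g N * W N * T) \<in> o(?g)"
  proof (rule sum_in_smallo(1)[OF initial])
    show "(\<lambda>N. ?g N * W N * T) \<in> o(?g)"
    proof (rule smalloI_tendsto)
      have "(\<lambda>N. W N * T) \<longlonglongrightarrow> 0 * T" by (intro tendsto_intros W)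
      moreover have "eventually (\<lambda>N. W N * T = ?g N * W N * T / ?g N) sequentially"
        using ev1 by eventually_elim simp
      ultimately show "(\<lambda>N. ?g N * W N * T / ?g N) \<longlonglongrightarrow> 0" by (simp add: tendsto_cong)
      show "eventually (\<lambda>N. ?g N \<noteq> 0) sequentially" using ev1 by eventually_elim simp
    qed
  qed
  ultimately show ?thesis by (rule landau_o.big_small_trans)
qed

theorem theorem2p1:
  fixes K :: nat
    and p :: "'d::finite + 'd \<Rightarrow> real"
    and \<rho>star \<alpha> \<kappa> T \<tau> :: real
    and \<rho>ini :: "real ^ 'd \<Rightarrow> real"
    and \<rho> :: "real \<Rightarrow> real ^ 'd \<Rightarrow> real"
    and \<mu> :: "nat \<Rightarrow> 'd config pmf"
    and M :: "nat \<Rightarrow> 'w measure"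
    and X :: "nat \<Rightarrow> real \<Rightarrow> 'w \<Rightarrow> 'd config"
  assumes "K > 0"
    and "\<And>i. p i \<ge> 0"
    and "\<And>i. p (Inl i) + p (Inr i) > 0"
    and "drift p \<noteq> 0"
    and "\<rho>star \<in> {0<..<real K}"
    and "smooth_on UNIV \<rho>ini" and "periodic \<rho>ini"
    and "\<alpha> > 0" and "\<kappa> \<in> {0<..\<alpha>}"
    and "T > 0"
    and "\<tau> > 0" and "burgers_solution (drift p) \<rho>ini \<tau> \<rho>"
    and "\<kappa> = \<alpha> \<Longrightarrow> T \<le> \<tau>"
    and "\<And>N. N > 0 \<Longrightarrow> set_pmf (\<mu> N) \<subseteq> Config K N"
    and "associated_to_profile \<rho>star \<alpha> \<rho>ini \<mu>"
    and "\<And>N. N > 0 \<Longrightarrow> markov_process (M N) (X N) (Config K N)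
            (\<lambda>f \<eta>. real N powr (1 + \<kappa>) * generator K p N f \<eta>)"
    and "\<And>N \<eta>. N > 0 \<Longrightarrow> law (M N) (X N) 0 \<eta> = pmf (\<mu> N) \<eta>"
    and "(\<lambda>N. entropy_H K p \<rho>star \<alpha> \<kappa> \<rho> M X N 0) \<in> o(\<lambda>N. real N powr (real CARD('d) - 2 * \<alpha>))"
  shows "(CARD('d) = 1 \<and> \<alpha> \<in> {0<..<1/2} \<and> \<kappa> \<in> {0<..\<alpha>} \<inter> {0<..<1 - 2 * \<alpha>} \<longrightarrow>
           (\<forall>t\<in>{0..T}. (\<lambda>N. entropy_H K p \<rho>star \<alpha> \<kappa> \<rho> M X N t)
                          \<in> o(\<lambda>N. real N powr (1 - 2 * \<alpha>)))) \<and>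
         (CARD('d) \<ge> 2 \<and> \<alpha> > 0 \<and> \<kappa> \<in> {0<..\<alpha>} \<inter> {0<..<1} \<longrightarrow>
           (\<forall>t\<in>{0..T}. (\<lambda>N. entropy_H K p \<rho>star \<alpha> \<kappa> \<rho> M X N t)
                          \<in> o(\<lambda>N. real N powr (real CARD('d) - 2 * \<alpha>))))"
proof (intro conjI impI ballI; elim conjE)
  fix t assume d: "CARD('d) = 1" and "\<alpha> \<in> {0<..<1/2}" and \<kappa>: "\<kappa> \<in> {0<..\<alpha>} \<inter> {0<..<1 - 2 * \<alpha>}" and t: "t \<in> {0..T}"
  \<comment> \<open>From \<kappa> < 1 - 2 \<alpha> and \<kappa> \<le> \<alpha>, hence \<kappa> < 1 -
    2 \<kappa>.\<close>
  have "3 * \<kappa> < 1" using \<kappa> by auto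
  \<comment> \<open>The exponent is the midpoint of 2 kappa and (1 + kappa) / 2, which is at most 1 - kappa.\<close>
  thus "(\<lambda>N. entropy_H K p \<rho>star \<alpha> \<kappa> \<rho> M X N t) \<in> o(\<lambda>N. real N powr (1 - 2 * \<alpha>))"
    using entropy_H_smallo[where g = "(1 + 5 * \<kappa>) / 4" and \<gamma> = "(1 + 5 * \<kappa>) / 4", OF assms(1,2,3) _ _ assms(8) _ _ assms(10,11,12,13,16,18) _ _ _ _ _ _ t]
      assms(5) \<kappa> d by (simp add: field_simps)
next
  fix t assume d: "2 \<le> CARD('d)" and \<kappa>: "\<kappa> \<in> {0<..\<alpha>} \<inter> {0<..<1}" and t: "t \<in> {0..T}"
  \<comment> \<open>The exponent is the midpoint of \<kappa> and (1 + \<kappa>) / 2, the two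
    constraints for d = 2; the lower one weakens as d grows. The interval is nonempty because
    \<kappa> < 1.\<close>
  have g: "0 < (1 + 3 * \<kappa>) / 4" using \<kappa> by simp
  have "2 * \<kappa> < (1 + 3 * \<kappa>) / 4 * 2" using \<kappa> by simp
  also have "\<dots> \<le> (1 + 3 * \<kappa>) / 4 * real CARD('d)" using d g by (intro mult_left_mono) auto
  finally show "(\<lambda>N. entropy_H K p \<rho>star \<alpha> \<kappa> \<rho> M X N t) \<in> o(\<lambda>N. real N powr (real CARD('d) - 2 * \<alpha>))"
    using entropy_H_smallo[where g = "(1 + 3 * \<kappa>) / 4" and \<gamma> = 0, OF assms(1,2,3) _ _ assms(8) _ _ assms(10,11,12,13,16,18) _ _ _ _ _ _ t]
      assms(5) \<kappa> d g by simp
qed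

end
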